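(* Let $r$ and $k$ be positive integers. Then \[ \operatorname{Hilb}\Big(\operatorname{Tor}_{\bullet}^{S^{\circ}_{\mathbb{U}_{r,k+r}}}\big(\mathbb{C}[\Sigma_{\mathbb{U}_{r,k+r}}]\big)_{\bullet}\Big) =\operatorname{Hilb}\Big(\operatorname{Tor}_{\bullet}^{S^{\circ}_{\mathbb{U}_{r,k+r}}}\big(\mathbb{C}[\Sigma_{\mathbb{U}_{r,k+r},\emptyset}]\big)_{\bullet}\Big) +\sum_{i=1}^{r-1}\binom{r+k}{i}\Big(\frac{y-y^{i}}{1-y}\Big)\operatorname{Hilb}\Big(\operatorname{Tor}_{\bullet}^{S^{\circ}_{\mathbb{U}_{r-i,r+k-i}}}\big(\mathbb{C}[\Sigma_{\mathbb{U}_{r-i,r+k-i}}]\big)_{\bullet}\Big). \]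
   Context: $\mathbb{U}_{a,m}$ denotes the uniform matroid of rank $a$ on $[m]$ (bases: all $a$-element subsets). For a matroid $\mathsf{M}$ of rank $r$ on $[n]$: $S_{\mathsf{M}}=\mathbb{C}[x_1,\dots,x_n]$, $S^{\circ}_{\mathsf{M}}=\mathbb{C}[x_1-x_n,\dots,x_{n-1}-x_n]$. $\mathbb{C}[\Sigma_{\mathsf{M},\emptyset}]=S_{\mathsf{M}}/\langle\prod_{i\in B}x_i : B\text{ a basis}\rangle$ with its quotient module structure. $\mathbb{C}[\Sigma_{\mathsf{M}}]=\mathbb{C}[x_F : F\text{ proper nonempty flat}]/\langle x_Fx_G: F,G\text{ incomparable}\rangle$, an $S_{\mathsf{M}}$-algebra via $x_i\mapsto\sum_{F\ni i}x_F$. Both are graded by polynomial degree (Stanley–Reisner degree). Tor groups: for a polynomial ring $R$ over $\mathbb{C}$ generated by a space $V$ of degree-one elements (for $S^{\circ}_{\mathsf{M}}$, $V=\{\sum c_ix_i:\sum c_i=0\}$) and a graded module $A=\bigoplus_sA_s$, take the Koszul complex $A\otimes\bigwedge^\bullet V$ with $d(a\otimes\ell_1\wedge\cdots\wedge\ell_t)=\sum_j(-1)^j(\ell_ja)\otimes\ell_1\wedge\cdots\widehat{\ell_j}\cdots\wedge\ell_t$; $\operatorname{Tor}^R_t(A)_s$ is the homology at $A_s\otimes\bigwedge^tV$. The Hilbert series is $\operatorname{Hilb}(\operatorname{Tor}^R_\bullet(A)_\bullet)=\sum_{t,s}\dim\operatorname{Tor}^R_t(A)_s\,x^ty^s$.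 *)

theory Defs
  imports
    Complex_Main
    "HOL-Library.Poly_Mapping"
    "HOL-Computational_Algebra.Formal_Power_Series"
begin

section \<open>Matroids\<close>

text \<open>A matroid on \<open>{1..n}\<close> is given by \<open>n\<close> and its set of bases.\<close>

definition is_matroid :: "nat \<Rightarrow> nat set set \<Rightarrow> bool" where
  "is_matroid n Bs \<longleftrightarrow> Bs \<noteq> {} \<and> (\<forall>B\<in>Bs. B \<subseteq> {1..n}) \<and>
    (\<forall>B1\<in>Bs. \<forall>B2\<in>Bs. \<forall>x\<in>B1 - B2. \<exists>y\<in>B2 - B1. insert y (B1 - {x}) \<in> Bs)"

definition matroid_rank :: "nat set set \<Rightarrow> nat set \<Rightarrow> nat" where
  "matroid_rank Bs X = Max ((\<lambda>B. card (X \<inter> B)) ` Bs)"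

definition is_flat :: "nat \<Rightarrow> nat set set \<Rightarrow> nat set \<Rightarrow> bool" where
  "is_flat n Bs F \<longleftrightarrow> F \<subseteq> {1..n} \<and>
    (\<forall>e\<in>{1..n} - F. matroid_rank Bs (insert e F) > matroid_rank Bs F)"

definition proper_flats :: "nat \<Rightarrow> nat set set \<Rightarrow> nat set set" where
  "proper_flats n Bs = {F. is_flat n Bs F \<and> F \<noteq> {} \<and> F \<noteq> {1..n}}"

definition uniform_bases :: "nat \<Rightarrow> nat \<Rightarrow> nat set set" where
  "uniform_bases a m = {B. B \<subseteq> {1..m} \<and> card B = a}"

lemma is_matroid_uniform:
  assumes "a \<le> m"
  shows "is_matroid m (uniform_bases a m)"
  unfolding is_matroid_def
proof (intro conjI ballI)
  have "{1..a} \<in> uniform_bases a m"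
    using assms by (auto simp: uniform_bases_def)
  then show "uniform_bases a m \<noteq> {}" by blast
next
  fix B assume "B \<in> uniform_bases a m"
  then show "B \<subseteq> {1..m}" by (simp add: uniform_bases_def)
next
  fix B1 B2 x
  assume B1: "B1 \<in> uniform_bases a m" and B2: "B2 \<in> uniform_bases a m" and x: "x \<in> B1 - B2"
  have fin: "finite B1"
    using B1 finite_subset[of B1 "{1..m}"] by (simp add: uniform_bases_def)
  have cards: "card B1 = card B2"
    using B1 B2 by (simp add: uniform_bases_def)
  have "\<not> B2 \<subseteq> B1"
  proof
    assume "B2 \<subseteq> B1"
    then have "B2 = B1"
      using card_subset_eq[OF fin] cards by simp
    then show False using x by simp
  qed
  then obtain y where y: "y \<in> B2" "y \<notin> B1" by blast
  have "card (insert y (B1 - {x})) = Suc (card (B1 - {x}))"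
    using y fin by simp
  also have "\<dots> = card B1"
    using x fin by (intro card_Suc_Diff1) auto
  finally have "card (insert y (B1 - {x})) = card B1" .
  then have "insert y (B1 - {x}) \<in> uniform_bases a m"
    using B1 B2 y by (auto simp: uniform_bases_def)
  then show "\<exists>y\<in>B2 - B1. insert y (B1 - {x}) \<in> uniform_bases a m"
    using y by blast
qed

section \<open>Polynomials over the complex numbers\<close>

type_synonym 'v cpoly = "('v \<Rightarrow>\<^sub>0 nat) \<Rightarrow>\<^sub>0 complex"

definition pvar :: "'v \<Rightarrow> 'v cpoly" where
  "pvar v = Poly_Mapping.single (Poly_Mapping.single v 1) 1"

text \<open>The polynomial ring in the variables \<open>X\<close>, inside the ring in all variables of the type.\<close>

definition poly_ring :: "'v set \<Rightarrow> 'v cpoly set" where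
  "poly_ring X = {p. \<forall>m\<in>Poly_Mapping.keys p. Poly_Mapping.keys m \<subseteq> X}"

definition homogeneous :: "nat \<Rightarrow> 'v cpoly \<Rightarrow> bool" where
  "homogeneous s p \<longleftrightarrow>
    (\<forall>m\<in>Poly_Mapping.keys p. (\<Sum>v\<in>Poly_Mapping.keys m. Poly_Mapping.lookup m v) = s)"

definition ideal_gen :: "'v cpoly set \<Rightarrow> 'v cpoly set \<Rightarrow> 'v cpoly set" where
  "ideal_gen R G = {(\<Sum>g\<in>F. q g * g) | F q. finite F \<and> F \<subseteq> G \<and> (\<forall>g\<in>F. q g \<in> R)}"

section \<open>The two graded algebras\<close>

text \<open>
  A record \<open>A\<close> presents the graded \<open>S\<close>-algebra \<open>poly_ring (vars A) / \<langle>gens A\<rangle>\<close>, where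
  \<open>S\<close> is the polynomial ring in \<open>x\<^sub>1, \<dots>, x\<^sub>n\<close> and \<open>x\<^sub>i\<close> acts as multiplication by \<open>act A i\<close>.
  All generators used below are homogeneous.
\<close>

record 'v graded_alg =
  vars :: "'v set"
  gens :: "'v cpoly set"
  act :: "nat \<Rightarrow> 'v cpoly"

definition rel_ideal :: "'v graded_alg \<Rightarrow> 'v cpoly set" where
  "rel_ideal A = ideal_gen (poly_ring (vars A)) (gens A)"

definition bergman_alg :: "nat \<Rightarrow> nat set set \<Rightarrow> nat set graded_alg" where
  "bergman_alg n Bs =
    \<lparr> vars = proper_flats n Bs,
      gens = {pvar F * pvar G | F G. F \<in> proper_flats n Bs \<and> G \<in> proper_flats n Bs \<and>
                \<not> F \<subseteq> G \<and> \<not> G \<subseteq> F},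
      act = (\<lambda>i. \<Sum>F\<in>{F \<in> proper_flats n Bs. i \<in> F}. pvar F) \<rparr>"

definition empty_alg :: "nat \<Rightarrow> nat set set \<Rightarrow> nat graded_alg" where
  "empty_alg n Bs =
    \<lparr> vars = {1..n}, gens = {(\<Prod>i\<in>B. pvar i) | B. B \<in> Bs}, act = pvar \<rparr>"

section \<open>The Koszul complex and Tor\<close>

text \<open>
  The space \<open>V\<close> of linear forms with coefficient sum zero has the basis
  \<open>\<ell>\<^sub>i = x\<^sub>i - x\<^sub>n\<close>, \<open>1 \<le> i < n\<close>. With respect to it, \<open>A \<otimes> \<And>\<^sup>t V\<close> is the free \<open>A\<close>-module on the
  symbols \<open>\<ell>\<^sub>T = \<ell>\<^bsub>i1\<^esub> \<and> \<dots> \<and> \<ell>\<^bsub>it\<^esub>\<close> for \<open>T = {i1 < \<dots> < it} \<subseteq> {1..<n}\<close>.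
  A chain is written as the finite formal sum of the \<open>Poly_Mapping.single T a\<close>, standing for
  \<open>a \<otimes> \<ell>\<^sub>T\<close>; the coefficients \<open>a\<close> are polynomials representing elements of \<open>A\<close>, and
  chains are identified when all their coefficients agree modulo \<open>rel_ideal A\<close>.
\<close>

type_synonym 'v chain = "nat set \<Rightarrow>\<^sub>0 'v cpoly"

definition chains :: "'v graded_alg \<Rightarrow> nat \<Rightarrow> nat \<Rightarrow> nat \<Rightarrow> 'v chain set" where
  "chains A n t s = {f. \<forall>T\<in>Poly_Mapping.keys f. T \<subseteq> {1..<n} \<and> card T = t \<and>
     Poly_Mapping.lookup f T \<in> poly_ring (vars A) \<and> homogeneous s (Poly_Mapping.lookup f T)}"

definition null_chain :: "'v graded_alg \<Rightarrow> 'v chain \<Rightarrow> bool" where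
  "null_chain A f \<longleftrightarrow> (\<forall>T. Poly_Mapping.lookup f T \<in> rel_ideal A)"

text \<open>The exponent of \<open>-1\<close> is the position of \<open>i\<close> in \<open>T\<close>, counted from 1.\<close>

definition koszul_d :: "'v graded_alg \<Rightarrow> nat \<Rightarrow> 'v chain \<Rightarrow> 'v chain" where
  "koszul_d A n f = (\<Sum>T\<in>Poly_Mapping.keys f. \<Sum>i\<in>T.
     Poly_Mapping.single (T - {i})
       ((- 1) ^ card {j \<in> T. j \<le> i} * ((act A i - act A n) * Poly_Mapping.lookup f T)))"

text \<open>
  Representatives of the cycles and boundaries in \<open>A\<^sub>s \<otimes> \<And>\<^sup>t V\<close>. Both spaces contain the null
  chains, so their quotient is the homology. The differential raises \<open>s\<close> by one and lowers \<open>t\<close>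
  by one; in degree \<open>s = 0\<close> only the zero chain maps in.
\<close>

definition cycles :: "'v graded_alg \<Rightarrow> nat \<Rightarrow> nat \<Rightarrow> nat \<Rightarrow> 'v chain set" where
  "cycles A n t s = {f \<in> chains A n t s. null_chain A (koszul_d A n f)}"

definition boundaries :: "'v graded_alg \<Rightarrow> nat \<Rightarrow> nat \<Rightarrow> nat \<Rightarrow> 'v chain set" where
  "boundaries A n t s = {f \<in> chains A n t s.
     \<exists>g \<in> (case s of 0 \<Rightarrow> {0} | Suc s' \<Rightarrow> chains A n (Suc t) s').
       null_chain A (f - koszul_d A n g)}"

definition chain_scale :: "complex \<Rightarrow> 'v chain \<Rightarrow> 'v chain" where
  "chain_scale c f = Poly_Mapping.map (Poly_Mapping.map ((*) c)) f"

text \<open>\<open>C\<close> is a finite set whose classes form a basis of \<open>Z / B\<close>.\<close>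

definition quot_basis :: "'v chain set \<Rightarrow> 'v chain set \<Rightarrow> 'v chain set \<Rightarrow> bool" where
  "quot_basis Z B C \<longleftrightarrow> finite C \<and> C \<subseteq> Z \<and>
     (\<forall>z\<in>Z. \<exists>a. z - (\<Sum>c\<in>C. chain_scale (a c) c) \<in> B) \<and>
     (\<forall>a. (\<Sum>c\<in>C. chain_scale (a c) c) \<in> B \<longrightarrow> (\<forall>c\<in>C. a c = 0))"

definition quot_dim :: "'v chain set \<Rightarrow> 'v chain set \<Rightarrow> nat" where
  "quot_dim Z B = (THE d. \<exists>C. quot_basis Z B C \<and> card C = d)"

definition tor_dim :: "'v graded_alg \<Rightarrow> nat \<Rightarrow> nat \<Rightarrow> nat \<Rightarrow> nat" where
  "tor_dim A n t s = quot_dim (cycles A n t s) (boundaries A n t s)"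

text \<open>
  Hilbert series live in \<open>\<rat>[[y]][[x]]\<close>: the outer variable is \<open>x\<close> (exponent \<open>t\<close>), the inner
  one is \<open>y\<close> (exponent \<open>s\<close>).
\<close>

definition hilb_tor :: "'v graded_alg \<Rightarrow> nat \<Rightarrow> rat fps fps" where
  "hilb_tor A n = Abs_fps (\<lambda>t. Abs_fps (\<lambda>s. of_nat (tor_dim A n t s)))"

definition hilb_bergman :: "nat \<Rightarrow> nat set set \<Rightarrow> rat fps fps" where
  "hilb_bergman n Bs = hilb_tor (bergman_alg n Bs) n"

definition hilb_empty :: "nat \<Rightarrow> nat set set \<Rightarrow> rat fps fps" where
  "hilb_empty n Bs = hilb_tor (empty_alg n Bs) n"

end

theory Submission
  imports Defs "HOL-Library.Function_Algebras" "HOL-Library.Infinite_Set"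
begin

text \<open>
  \<open>\<complex>[\<Sigma>\<^bsub>M,\<emptyset>\<^esub>]\<close> is the Stanley--Reisner ring of a skeleton of a simplex, and \<open>\<complex>[\<Sigma>\<^bsub>M\<^esub>]\<close>
  that of its barycentric subdivision, which arises by stellar subdivision of the faces in decreasing
  order of size. A stellar subdivision at a face \<open>F\<close> with new vertex \<open>y\<close> is an algebraic blow-up: with
  \<open>x\<^sub>v \<mapsto> x\<^sub>v + y\<close> for \<open>v \<in> F\<close>, the new ring is, as a module, the direct sum of the old ring and of
  \<open>y\<^sup>j \<complex>[star F]\<close> for \<open>0 < j < |F|\<close>, by division by the monic polynomial \<open>\<Prod>v\<in>F. (x\<^sub>v - y)\<close>.
  When \<open>F\<close> is subdivided, all larger faces have been subdivided already, so its star is the join of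
  the simplex on \<open>F\<close> with the order complex of the flats above \<open>F\<close>. The linear forms
  \<open>x\<^sub>v - x\<^sub>n\<close> eliminate the vertices of \<open>F\<close> one by one, which leaves the Koszul homology of
  \<open>\<complex>[\<Sigma>]\<close> of the contraction of \<open>F\<close>.
\<close>

section \<open>Bases of quotient spaces\<close>

text \<open>The substitution is dictated by the action of the ring: a new vertex \<open>F\<close>
  has to enter the form of \<open>x_i\<close> exactly when \<open>i\<close> lies in
  \<open>F\<close>, that is, when the vertex \<open>{i}\<close> belongs to the subdivided face.
  Hence the splitting at each subdivision is linear over the forms, and Tor of the summands simply
  adds up; no long exact sequence occurs. The summand with \<open>y^j\<close> is shifted by
  \<open>j\<close> in the polynomial degree, so a face of size \<open>i\<close> contributes the
  factor y + ... + y^(i-1) = (y - y^i)/(1 - y), and the binomial coefficient counts the faces of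
  size \<open>i\<close>. Two points shape the development. Dimensions are definite descriptions, so
  existence and uniqueness of bases modulo a subspace have to be available before numbers can be
  compared. And the basis \<open>x_i - x_n\<close> of the linear forms distinguishes the index
  \<open>n\<close>: when \<open>n\<close> belongs to \<open>F\<close>, the vertex \<open>{n}\<close>
  is removed by the form of an index outside \<open>F\<close>, which then becomes the reference
  index of the contraction.\<close>

lemma nontrivial_solution:
  fixes M :: "'k \<Rightarrow> 'q \<Rightarrow> complex"
  assumes "finite Q" "finite K" "card Q < card K"
  shows "\<exists>a. (\<exists>k\<in>K. a k \<noteq> 0) \<and> (\<forall>q\<in>Q. (\<Sum>k\<in>K. a k * M k q) = 0)"
  using assms
proof (induction Q arbitrary: K M rule: finite_induct)
  case empty
  then have "K \<noteq> {}" by auto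
  then show ?case by (intro exI[of _ "\<lambda>_. 1"]) auto
next
  case (insert q Q)
  show ?case
  proof (cases "\<forall>k\<in>K. M k q = 0")
    case True
    have "card Q < card K" using insert by simp
    from insert.IH[OF insert.prems(1) this, of M] True show ?thesis by auto
  next
    case False
    then obtain k0 where k0: "k0 \<in> K" "M k0 q \<noteq> 0" by auto
    have "card Q < card (K - {k0})" using insert k0 by simp
    from insert.IH[OF _ this, of "\<lambda>k p. M k p - M k q / M k0 q * M k0 p"] insert.prems
    obtain a where a: "\<exists>k\<in>K - {k0}. a k \<noteq> 0"
      and sol: "\<forall>p\<in>Q. (\<Sum>k\<in>K - {k0}. a k * (M k p - M k q / M k0 q * M k0 p)) = 0"
      by auto
    \<comment> \<open>Row \<open>q\<close> serves as pivot row for the unknown \<open>k0\<close>,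
      whose value is read off from it once the others are known.\<close>
    define a' where "a' = a(k0 := - (\<Sum>k\<in>K - {k0}. a k * M k q) / M k0 q)"
    have split: "(\<Sum>k\<in>K. a' k * M k p) = a' k0 * M k0 p + (\<Sum>k\<in>K - {k0}. a k * M k p)" for p
      using sum.remove[OF insert.prems(1) k0(1), of "\<lambda>k. a' k * M k p"]
      by (simp add: a'_def)
    have "(\<Sum>k\<in>K. a' k * M k p) = 0" if "p \<in> insert q Q" for p
    proof (cases "p = q")
      case True
      then show ?thesis using k0 by (simp add: split) (simp add: a'_def)
    next
      case False
      with that have "p \<in> Q" by simp
      with sol have "(\<Sum>k\<in>K - {k0}. a k * M k p)
          = (\<Sum>k\<in>K - {k0}. a k * M k q) / M k0 q * M k0 p"
        by (simp add: algebra_simps sum_subtractf sum_distrib_left sum_divide_distrib)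
      then show ?thesis by (simp add: split) (simp add: a'_def)
    qed
    moreover have "\<exists>k\<in>K. a' k \<noteq> 0" using a by (auto simp: a'_def)
    ultimately show ?thesis by blast
  qed
qed

text \<open>A basis of \<open>Z\<close> modulo \<open>B\<close> as an indexed family instead of a
  set: families can be mapped, reindexed and glued over disjoint unions without checking that the
  vectors stay distinct.\<close>

definition qfam :: "(complex \<Rightarrow> 'c \<Rightarrow> 'c) \<Rightarrow> 'c::ab_group_add set \<Rightarrow> 'c set \<Rightarrow> 'k set \<Rightarrow> ('k \<Rightarrow> 'c) \<Rightarrow> bool"
  where "qfam sc Z B K b \<longleftrightarrow> finite K \<and> (\<forall>k\<in>K. b k \<in> Z) \<and>
    (\<forall>z\<in>Z. \<exists>a. z - (\<Sum>k\<in>K. sc (a k) (b k)) \<in> B) \<and>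
    (\<forall>a. (\<Sum>k\<in>K. sc (a k) (b k)) \<in> B \<longrightarrow> (\<forall>k\<in>K. a k = 0))"

lemma
  assumes "qfam sc Z B K b"
  shows qfam_finite: "finite K"
    and qfam_mem: "k \<in> K \<Longrightarrow> b k \<in> Z"
    and qfam_span: "z \<in> Z \<Longrightarrow> \<exists>a. z - (\<Sum>k\<in>K. sc (a k) (b k)) \<in> B"
    and qfam_indep: "(\<Sum>k\<in>K. sc (a k) (b k)) \<in> B \<Longrightarrow> k \<in> K \<Longrightarrow> a k = 0"
  using assms by (simp_all add: qfam_def)

context
  fixes sc :: "complex \<Rightarrow> 'c::ab_group_add \<Rightarrow> 'c"
  assumes vs: "vector_space sc"
begin

interpretation vector_space sc by (rule vs)

text \<open>Steinitz bound: expressing the \<open>b'\<close> through the \<open>b\<close> modulo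
  \<open>B\<close> gives a matrix with more rows than columns, and a relation among its rows is a
  forbidden relation among the \<open>b'\<close>.\<close>

lemma indep_card_le:
  assumes K: "qfam sc Z B K b" and B: "subspace B"
    and K': "finite K'" "\<And>k. k \<in> K' \<Longrightarrow> b' k \<in> Z"
    and ind: "\<And>a. (\<Sum>k\<in>K'. sc (a k) (b' k)) \<in> B \<Longrightarrow> \<forall>k\<in>K'. a k = 0"
  shows "card K' \<le> card K"
proof (rule ccontr)
  assume "\<not> ?thesis"
  then have lt: "card K < card K'" by simp
  have "\<forall>k'\<in>K'. \<exists>a. b' k' - (\<Sum>k\<in>K. sc (a k) (b k)) \<in> B"
    using qfam_span[OF K K'(2)] by blast
  then obtain M where M: "\<And>k'. k' \<in> K' \<Longrightarrow> b' k' - (\<Sum>k\<in>K. sc (M k' k) (b k)) \<in> B"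
    by metis
  have "finite K" using K by (simp add: qfam_def)
  from nontrivial_solution[OF this K'(1) lt, of M]
  obtain a where a: "\<exists>k\<in>K'. a k \<noteq> 0" "\<forall>q\<in>K. (\<Sum>k\<in>K'. a k * M k q) = 0" by blast
  have "(\<Sum>k'\<in>K'. sc (a k') (\<Sum>k\<in>K. sc (M k' k) (b k)))
      = (\<Sum>k\<in>K. \<Sum>k'\<in>K'. sc (a k' * M k' k) (b k))"
    by (simp add: scale_sum_right sum.swap[of _ K])
  also have "\<dots> = (\<Sum>k\<in>K. sc (\<Sum>k'\<in>K'. a k' * M k' k) (b k))"
    by (simp add: scale_sum_left)
  also have "\<dots> = 0" using a by simp
  finally have "(\<Sum>k'\<in>K'. sc (a k') (b' k'))
      = (\<Sum>k'\<in>K'. sc (a k') (b' k' - (\<Sum>k\<in>K. sc (M k' k) (b k))))"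
    by (simp add: scale_right_diff_distrib sum_subtractf)
  also have "\<dots> \<in> B" using M by (intro subspace_sum[OF B] subspace_scale[OF B]) auto
  finally show False using ind a by blast
qed

lemma qfam_card_unique:
  assumes "qfam sc Z B K b" "qfam sc Z B K' b'" and "subspace B"
  shows "card K = card K'"
proof (rule antisym)
  show "card K \<le> card K'"
    by (rule indep_card_le[OF assms(2,3) qfam_finite[OF assms(1)] qfam_mem[OF assms(1)]])
      (auto dest: qfam_indep[OF assms(1)])
  show "card K' \<le> card K"
    by (rule indep_card_le[OF assms(1,3) qfam_finite[OF assms(2)] qfam_mem[OF assms(2)]])
      (auto dest: qfam_indep[OF assms(2)])
qed

text \<open>Equal vectors at two indices would cancel with coefficients 1 and -1. Injectivity lets a
  family be turned back into a set as in \<open>quot_basis\<close>.\<close>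

lemma qfam_inj_on:
  assumes "qfam sc Z B K b" and B: "subspace B"
  shows "inj_on b K"
proof (rule inj_onI, rule ccontr)
  fix k l assume *: "k \<in> K" "l \<in> K" "b k = b l" "k \<noteq> l"
  define a :: "_ \<Rightarrow> complex" where "a = (\<lambda>j. if j = k then 1 else if j = l then - 1 else 0)"
  have "finite K" using assms by (simp add: qfam_def)
  then have "(\<Sum>j\<in>K. sc (a j) (b j)) = (\<Sum>j\<in>{k, l}. sc (a j) (b j))"
    using * by (intro sum.mono_neutral_right) (auto simp: a_def)
  also have "\<dots> = 0" using * by (simp add: a_def)
  finally have "(\<Sum>j\<in>K. sc (a j) (b j)) \<in> B" using subspace_0[OF B] by simp
  from qfam_indep[OF assms(1) this] have "a k = 0" using * by blast
  then show False by (simp add: a_def)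
qed

lemma qfam_reindex:
  assumes K: "qfam sc Z B K b" and h: "bij_betw h L K"
  shows "qfam sc Z B L (b \<circ> h)"
proof -
  have sum: "(\<Sum>k\<in>L. sc (a (h k)) (b (h k))) = (\<Sum>k\<in>K. sc (a k) (b k))" for a
    using sum.reindex_bij_betw[OF h, of "\<lambda>k. sc (a k) (b k)"] .
  show ?thesis unfolding qfam_def
  proof (intro conjI ballI allI impI)
    show "finite L" using K bij_betw_finite[OF h] by (simp add: qfam_def)
    show "(b \<circ> h) k \<in> Z" if "k \<in> L" for k
      using K that bij_betwE[OF h] by (auto simp: qfam_def)
    show "\<exists>a. z - (\<Sum>k\<in>L. sc (a k) ((b \<circ> h) k)) \<in> B" if "z \<in> Z" for z
    proof -
      from qfam_span[OF K that] obtain a where "z - (\<Sum>k\<in>K. sc (a k) (b k)) \<in> B" ..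
      then show ?thesis by (intro exI[of _ "a \<circ> h"]) (simp add: sum)
    qed
    fix a l assume a: "(\<Sum>k\<in>L. sc (a k) ((b \<circ> h) k)) \<in> B" and l: "l \<in> L"
    define g where "g = the_inv_into L h"
    have g: "g (h k) = k" if "k \<in> L" for k
      using that h by (simp add: g_def the_inv_into_f_f bij_betw_def)
    have "(\<Sum>k\<in>L. sc (a k) ((b \<circ> h) k)) = (\<Sum>k\<in>L. sc ((a \<circ> g) (h k)) (b (h k)))"
      by (intro sum.cong) (auto simp: g)
    then have "(\<Sum>k\<in>K. sc ((a \<circ> g) k) (b k)) \<in> B" using a sum by metis
    from qfam_indep[OF K this] have "(a \<circ> g) (h l) = 0" using l bij_betwE[OF h] by blast
    then show "a l = 0" using g l by simp
  qed
qed

text \<open>A relation instead of a function, so that dimensions can be transported along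
  isomorphisms without first knowing that they exist.\<close>

definition qdim :: "'c set \<Rightarrow> 'c set \<Rightarrow> nat \<Rightarrow> bool"
  where "qdim Z B d \<longleftrightarrow> (\<exists>b. qfam sc Z B {..<d} b)"

lemma qdim_qfam:
  assumes "qfam sc Z B K b"
  shows "qdim Z B (card K)"
proof -
  have "finite K" using assms by (simp add: qfam_def)
  then obtain h where "bij_betw h {..<card K} K"
    using ex_bij_betw_nat_finite[of K] by (auto simp: atLeast0LessThan)
  from qfam_reindex[OF assms this] show ?thesis by (auto simp: qdim_def)
qed

lemma qdim_unique:
  assumes "qdim Z B d" "qdim Z B d'" "subspace B"
  shows "d = d'"
proof -
  from assms obtain b b' where "qfam sc Z B {..<d} b" "qfam sc Z B {..<d'} b'"
    unfolding qdim_def by (elim exE)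
  from qfam_card_unique[OF this assms(3)] show ?thesis by simp
qed

text \<open>The coordinates \<open>co q\<close> embed \<open>Z\<close> into a space of dimension
  \<open>card Q\<close>, and a family independent modulo \<open>B\<close> is independent in
  \<open>Z\<close>. So such families have bounded length, and one of maximal length spans
  \<open>Z\<close> modulo \<open>B\<close>.\<close>

lemma qdim_exists:
  fixes co :: "'q \<Rightarrow> 'c \<Rightarrow> complex"
  assumes Q: "finite Q" and Z: "subspace Z" and B: "subspace B"
    and add: "\<And>q x y. co q (x + y) = co q x + co q y"
    and scal: "\<And>q c x. co q (sc c x) = c * co q x"
    and inj: "\<And>z. z \<in> Z \<Longrightarrow> (\<And>q. q \<in> Q \<Longrightarrow> co q z = 0) \<Longrightarrow> z = 0"
  shows "\<exists>d. qdim Z B d"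
proof -
  define P where "P = (\<lambda>d. \<exists>b::nat \<Rightarrow> 'c. (\<forall>k<d. b k \<in> Z) \<and>
    (\<forall>a. (\<Sum>k<d. sc (a k) (b k)) \<in> B \<longrightarrow> (\<forall>k<d. a k = 0)))"
  have co0: "co q 0 = 0" for q using add[of q 0 0] by simp
  have cosum: "co q (\<Sum>k\<in>K. x k) = (\<Sum>k\<in>K. co q (x k))" for q K and x :: "nat \<Rightarrow> 'c"
    by (induction K rule: infinite_finite_induct) (simp_all add: co0 add)
  have bound: "d \<le> card Q" if "P d" for d
  proof (rule ccontr)
    assume "\<not> d \<le> card Q"
    then have lt: "card Q < card {..<d}" by simp
    from that obtain b where b: "\<forall>k<d. b k \<in> Z"
      "\<forall>a. (\<Sum>k<d. sc (a k) (b k)) \<in> B \<longrightarrow> (\<forall>k<d. a k = 0)" unfolding P_def by blast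
    from nontrivial_solution[OF Q _ lt, of "\<lambda>k q. co q (b k)"] obtain a where
      a: "\<exists>k<d. a k \<noteq> 0" "\<forall>q\<in>Q. (\<Sum>k<d. a k * co q (b k)) = 0" by auto
    have "(\<Sum>k<d. sc (a k) (b k)) = 0"
      using b a by (intro inj subspace_sum[OF Z] subspace_scale[OF Z]) (auto simp: cosum scal)
    then have "\<forall>k<d. a k = 0" using b(2) subspace_0[OF B] by metis
    with a show False by blast
  qed
  have P0: "P 0" by (simp add: P_def)
  define d where "d = (GREATEST d. P d)"
  have Pd: "P d" unfolding d_def by (rule GreatestI_nat[where P = P, OF P0 bound])
  have max: "e \<le> d" if "P e" for e unfolding d_def by (rule Greatest_le_nat[where P = P, OF that bound])
  from Pd obtain b where b: "\<forall>k<d. b k \<in> Z"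
    and ind: "\<forall>a. (\<Sum>k<d. sc (a k) (b k)) \<in> B \<longrightarrow> (\<forall>k<d. a k = 0)" unfolding P_def by blast
  have "\<exists>a. z - (\<Sum>k<d. sc (a k) (b k)) \<in> B" if z: "z \<in> Z" for z
  proof (rule ccontr)
    assume no: "\<not> ?thesis"
    have "P (Suc d)" unfolding P_def
    proof (intro exI[of _ "b(d := z)"] conjI allI impI)
      show "(b(d := z)) k \<in> Z" if "k < Suc d" for k using b z that by (auto simp: less_Suc_eq)
      fix a k assume a: "(\<Sum>k<Suc d. sc (a k) ((b(d := z)) k)) \<in> B" and k: "k < Suc d"
      from a have s: "(\<Sum>k<d. sc (a k) (b k)) + sc (a d) z \<in> B" by simp
      have ad: "a d = 0"
      proof (rule ccontr)
        assume nz: "a d \<noteq> 0"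
        have "sc (1 / a d) ((\<Sum>k<d. sc (a k) (b k)) + sc (a d) z) \<in> B"
          by (rule subspace_scale[OF B s])
        also have "sc (1 / a d) ((\<Sum>k<d. sc (a k) (b k)) + sc (a d) z)
            = z - (\<Sum>k<d. sc (- (a k / a d)) (b k))"
          using nz by (simp add: scale_right_distrib scale_sum_right sum_negf)
        finally show False using no by (auto dest!: spec[of _ "\<lambda>k. - (a k / a d)"])
      qed
      with s have "\<forall>k<d. a k = 0" using ind by simp
      with ad k show "a k = 0" by (auto simp: less_Suc_eq)
    qed
    with max[of "Suc d"] show False by simp
  qed
  then have "qfam sc Z B {..<d} b" using b ind by (auto simp: qfam_def)
  then show ?thesis by (auto simp: qdim_def)
qed

end

text \<open>\<phi> induces an isomorphism of \<open>Z / B\<close> with \<open>Z' / B'\<close>: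
  \<open>ker\<close> is injectivity and \<open>sur\<close> surjectivity. The dimension travels from
  target to source, because a basis of the target can be lifted.\<close>

lemma qdim_lift:
  assumes vs: "vector_space sc" "vector_space sc'"
    and B: "module.subspace sc B" "module.subspace sc' B'" and Z: "module.subspace sc Z"
    and add: "\<And>x y. \<phi> (x + y) = \<phi> x + \<phi> y"
    and scal: "\<And>c x. \<phi> (sc c x) = sc' c (\<phi> x)"
    and into: "\<And>z. z \<in> Z \<Longrightarrow> \<phi> z \<in> Z'"
    and ker: "\<And>z. z \<in> Z \<Longrightarrow> \<phi> z \<in> B' \<longleftrightarrow> z \<in> B"
    and sur: "\<And>z'. z' \<in> Z' \<Longrightarrow> \<exists>z\<in>Z. z' - \<phi> z \<in> B'"
    and d: "qdim sc' Z' B' d"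
  shows "qdim sc Z B d"
proof -
  interpret V: vector_space sc by (rule vs)
  interpret V': vector_space sc' by (rule vs)
  from d obtain b' where b': "qfam sc' Z' B' {..<d} b'" by (auto simp: qdim_def[OF vs(2)])
  have "\<forall>k\<in>{..<d}. \<exists>z\<in>Z. b' k - \<phi> z \<in> B'" using sur[OF qfam_mem[OF b']] by blast
  then obtain b where b: "\<And>k. k < d \<Longrightarrow> b k \<in> Z" "\<And>k. k < d \<Longrightarrow> b' k - \<phi> (b k) \<in> B'"
    by (metis lessThan_iff)
  have \<phi>0: "\<phi> 0 = 0" using add[of 0 0] by simp
  have \<phi>m: "\<phi> (x - y) = \<phi> x - \<phi> y" for x y using add[of "x - y" y] by simp
  have \<phi>s: "\<phi> (\<Sum>k\<in>K. x k) = (\<Sum>k\<in>K. \<phi> (x k))" for K and x :: "nat \<Rightarrow> _"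
    by (induction K rule: infinite_finite_induct) (simp_all add: \<phi>0 add)
  have diff: "(\<Sum>k<d. sc' (a k) (b' k)) - \<phi> (\<Sum>k<d. sc (a k) (b k)) \<in> B'" for a
  proof -
    have "(\<Sum>k<d. sc' (a k) (b' k - \<phi> (b k))) \<in> B'"
      using b by (intro V'.subspace_sum[OF B(2)] V'.subspace_scale[OF B(2)]) auto
    then show ?thesis by (simp add: \<phi>s scal V'.scale_right_diff_distrib sum_subtractf)
  qed
  have inZ: "(\<Sum>k<d. sc (a k) (b k)) \<in> Z" for a
    using b by (intro V.subspace_sum[OF Z] V.subspace_scale[OF Z]) auto
  have "qfam sc Z B {..<d} b" unfolding qfam_def
  proof (intro conjI ballI allI impI)
    fix z assume z: "z \<in> Z"
    then obtain a where "\<phi> z - (\<Sum>k<d. sc' (a k) (b' k)) \<in> B'"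
      using qfam_span[OF b' into] by blast
    from V'.subspace_add[OF B(2) this diff[of a]] have "\<phi> (z - (\<Sum>k<d. sc (a k) (b k))) \<in> B'"
      by (simp add: \<phi>m)
    then show "\<exists>a. z - (\<Sum>k<d. sc (a k) (b k)) \<in> B"
      using ker V.subspace_diff[OF Z z inZ] by blast
  next
    fix a k assume "(\<Sum>k<d. sc (a k) (b k)) \<in> B" "k \<in> {..<d}"
    then have "\<phi> (\<Sum>k<d. sc (a k) (b k)) \<in> B'" using ker inZ by blast
    from V'.subspace_add[OF B(2) diff[of a] this] have "(\<Sum>k<d. sc' (a k) (b' k)) \<in> B'" by simp
    from qfam_indep[OF b' this] show "a k = 0" using \<open>k \<in> {..<d}\<close> by blast
  qed (use b in auto)
  then show ?thesis by (auto simp: qdim_def[OF vs(1)])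
qed

section \<open>Koszul complexes\<close>

abbreviation keys :: "('a \<Rightarrow>\<^sub>0 'b::zero) \<Rightarrow> 'a set" where "keys \<equiv> Poly_Mapping.keys"
abbreviation lookup :: "('a \<Rightarrow>\<^sub>0 'b::zero) \<Rightarrow> 'a \<Rightarrow> 'b" where "lookup \<equiv> Poly_Mapping.lookup"
abbreviation single :: "'a \<Rightarrow> 'b::zero \<Rightarrow> 'a \<Rightarrow>\<^sub>0 'b" where "single \<equiv> Poly_Mapping.single"

definition cst :: "complex \<Rightarrow> 'v cpoly"
  where "cst c = single 0 c"

lemma cst_simps [simp]: "cst 0 = 0" "cst 1 = 1"
  by (simp_all add: cst_def)

lemma cst_add: "cst (a + b) = cst a + cst b"
  by (simp add: cst_def single_add)

lemma cst_mult: "cst (a * b) = cst a * cst b"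
  by (simp add: cst_def mult_single)

lemma cst_uminus: "cst (- a) = - cst a"
  by (simp add: cst_def single_uminus)

lemma cst_power: "cst (a ^ n) = cst a ^ n"
  by (induction n) (simp_all add: cst_mult)

definition csub :: "'v cpoly set \<Rightarrow> bool"
  where "csub S \<longleftrightarrow> 0 \<in> S \<and> (\<forall>a\<in>S. \<forall>b\<in>S. a + b \<in> S) \<and> (\<forall>c. \<forall>a\<in>S. cst c * a \<in> S)"

lemma csub_0: "csub S \<Longrightarrow> 0 \<in> S"
  and csub_add: "csub S \<Longrightarrow> a \<in> S \<Longrightarrow> b \<in> S \<Longrightarrow> a + b \<in> S"
  and csub_cst: "csub S \<Longrightarrow> a \<in> S \<Longrightarrow> cst c * a \<in> S"
  by (auto simp: csub_def)

lemma csub_uminus: "csub S \<Longrightarrow> a \<in> S \<Longrightarrow> - a \<in> S"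
  using csub_cst[of S a "- 1"] by (simp add: cst_uminus)

lemma csub_diff: "csub S \<Longrightarrow> a \<in> S \<Longrightarrow> b \<in> S \<Longrightarrow> a - b \<in> S"
  using csub_add[of S a "- b"] csub_uminus[of S b] by simp

lemma csub_sum: "csub S \<Longrightarrow> (\<And>i. i \<in> I \<Longrightarrow> f i \<in> S) \<Longrightarrow> (\<Sum>i\<in>I. f i) \<in> S"
  by (induction I rule: infinite_finite_induct) (auto intro: csub_0 csub_add)

lemma csub_sgn: "csub S \<Longrightarrow> a \<in> S \<Longrightarrow> (- 1) ^ n * a \<in> S"
  using csub_cst[of S a "(- 1) ^ n"] by (simp add: cst_power cst_uminus)

lemma csub_congD: "csub S \<Longrightarrow> a - b \<in> S \<Longrightarrow> b \<in> S \<Longrightarrow> a \<in> S"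
  using csub_add[of S "a - b" b] by simp

lemma csub_congD': "csub S \<Longrightarrow> a - b \<in> S \<Longrightarrow> a \<in> S \<Longrightarrow> b \<in> S"
  using csub_diff[of S a "a - b"] by simp

definition fsc :: "complex \<Rightarrow> (nat set \<Rightarrow> 'v cpoly) \<Rightarrow> nat set \<Rightarrow> 'v cpoly"
  where "fsc c f = (\<lambda>T. cst c * f T)"

lemma vector_space_fsc: "vector_space fsc"
  by unfold_locales (auto simp: fsc_def plus_fun_def fun_eq_iff algebra_simps cst_add cst_mult)

lemma fsc_apply: "fsc c f T = cst c * f T"
  by (simp add: fsc_def)

lemma fun_sum_apply: "(\<Sum>i\<in>I. f i) T = (\<Sum>i\<in>I. f i T)" for f :: "'i \<Rightarrow> 'a \<Rightarrow> 'b::comm_monoid_add"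
  by (induction I rule: infinite_finite_induct) (auto simp: plus_fun_def zero_fun_def)

lemma fsubspaceI:
  assumes "0 \<in> S" "\<And>f g. f \<in> S \<Longrightarrow> g \<in> S \<Longrightarrow> f + g \<in> S" "\<And>c f. f \<in> S \<Longrightarrow> fsc c f \<in> S"
  shows "module.subspace fsc S"
proof -
  interpret vector_space fsc by (rule vector_space_fsc)
  show ?thesis using assms by (auto simp: subspace_def)
qed

text \<open>
  The graded pieces are indexed with a shift by one: \<open>A (s + 1)\<close> is the piece of degree \<open>s\<close>, so
  that \<open>A 0\<close> can play the role of the zero piece in degree \<open>-1\<close>.
\<close>

definition kch :: "nat set \<Rightarrow> (nat \<Rightarrow> 'v cpoly set) \<Rightarrow> nat \<Rightarrow> nat \<Rightarrow> (nat set \<Rightarrow> 'v cpoly) set"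
  where "kch I A t u = {f. \<forall>T. if T \<subseteq> I \<and> card T = t then f T \<in> A u else f T = 0}"

text \<open>The sign of the term that leads from \<open>insert i T\<close> to \<open>T\<close>;
  inserting \<open>i\<close> first makes the position of \<open>i\<close> meaningful for
  \<open>i\<close> outside \<open>T\<close>.\<close>

definition ksg :: "nat \<Rightarrow> nat set \<Rightarrow> 'v cpoly"
  where "ksg i T = (- 1) ^ card {j \<in> insert i T. j \<le> i}"

text \<open>The Koszul differential read at a target \<open>T\<close>, whose coefficient collects
  one term from each \<open>insert i T\<close>. Chains are total functions on sets, which makes
  pointwise choices and sums easy.\<close>

definition kd :: "nat set \<Rightarrow> (nat \<Rightarrow> 'v cpoly) \<Rightarrow> (nat set \<Rightarrow> 'v cpoly) \<Rightarrow> nat set \<Rightarrow> 'v cpoly"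
  where "kd I \<theta> f T = (\<Sum>i\<in>I - T. ksg i T * (\<theta> i * f (insert i T)))"

definition kcyc where
  "kcyc I \<theta> A N t s = {f \<in> kch I A t (Suc s). \<forall>T. kd I \<theta> f T \<in> N}"

definition kbd where
  "kbd I \<theta> A N t s = {f \<in> kch I A t (Suc s). \<exists>g\<in>kch I A (Suc t) s. \<forall>T. f T - kd I \<theta> g T \<in> N}"

definition kdim where
  "kdim I \<theta> A N t s d \<longleftrightarrow> qdim fsc (kcyc I \<theta> A N t s) (kbd I \<theta> A N t s) d"

lemma kd_add: "kd I \<theta> (f + g) T = kd I \<theta> f T + kd I \<theta> g T"
  by (simp add: kd_def plus_fun_def algebra_simps sum.distrib)

lemma kd_zero: "kd I \<theta> 0 T = 0"
  by (simp add: kd_def zero_fun_def)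

lemma plus_fun_apply: "(f + g) T = f T + g T" for f g :: "'i \<Rightarrow> 'b::plus"
  by (simp add: plus_fun_def)

lemma kd_diff: "kd I \<theta> (f - g) T = kd I \<theta> f T - kd I \<theta> g T"
  by (simp add: kd_def fun_diff_def algebra_simps sum_subtractf)

lemma kd_fsc: "kd I \<theta> (fsc c f) T = cst c * kd I \<theta> f T"
  by (simp add: kd_def fsc_def sum_distrib_left algebra_simps)

lemma kd_sum: "kd I \<theta> (\<Sum>k\<in>K. f k) T = (\<Sum>k\<in>K. kd I \<theta> (f k) T)"
  by (simp add: kd_def fun_sum_apply sum_distrib_left sum.swap[of _ K])

text \<open>Adding the larger index \<open>j\<close> leaves the position of \<open>i\<close>
  unchanged, while adding \<open>i\<close> moves \<open>j\<close> up by one place.\<close>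

lemma ksg_swap_aux:
  assumes "finite T" "i \<notin> T" "j \<notin> T" "i < j"
  shows "ksg i T * ksg j (insert i T) = - (ksg j T * ksg i (insert j T) :: 'v cpoly)"
proof -
  have "{x \<in> insert i (insert j T). x \<le> i} = {x \<in> insert i T. x \<le> i}" using assms by auto
  moreover have "{x \<in> insert j (insert i T). x \<le> j} = insert i {x \<in> insert j T. x \<le> j}"
    using assms by auto
  moreover have "card (insert i {x \<in> insert j T. x \<le> j}) = Suc (card {x \<in> insert j T. x \<le> j})"
    using assms by (intro card_insert_disjoint) auto
  ultimately show ?thesis by (simp add: ksg_def)
qed

lemma ksg_swap:
  assumes "finite T" "i \<notin> T" "j \<notin> T" "i \<noteq> j"
  shows "ksg i T * ksg j (insert i T) = - (ksg j T * ksg i (insert j T) :: 'v cpoly)"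
proof (cases "i < j")
  case True
  with assms show ?thesis by (intro ksg_swap_aux)
next
  case False
  with assms have "ksg j T * ksg i (insert j T) = - (ksg i T * ksg j (insert i T) :: 'v cpoly)"
    by (intro ksg_swap_aux) auto
  then show ?thesis by (simp only: minus_minus)
qed

lemma ksg_ksg [simp]: "ksg i T * (ksg i T * a) = a"
  by (simp add: ksg_def flip: mult.assoc power_mult_distrib)

lemma csub_ksg: "csub S \<Longrightarrow> a \<in> S \<Longrightarrow> ksg i T * a \<in> S"
  by (simp add: ksg_def csub_sgn)

lemma sum_antisym:
  fixes g :: "'i \<Rightarrow> 'i \<Rightarrow> 'v cpoly"
  assumes "finite J" and anti: "\<And>i j. i \<in> J \<Longrightarrow> j \<in> J \<Longrightarrow> i \<noteq> j \<Longrightarrow> g i j = - g j i"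
  shows "(\<Sum>i\<in>J. \<Sum>j\<in>J - {i}. g i j) = 0"
proof -
  let ?h = "\<lambda>i j. if i = j then 0 else g i j"
  have "(\<Sum>j\<in>J - {i}. g i j) = (\<Sum>j\<in>J. ?h i j)" if "i \<in> J" for i
  proof -
    have "(\<Sum>j\<in>J - {i}. g i j) = (\<Sum>j\<in>J - {i}. ?h i j)" by (rule sum.cong) auto
    then show ?thesis using sum.remove[OF assms(1) that, of "?h i"] by simp
  qed
  then have eq: "(\<Sum>i\<in>J. \<Sum>j\<in>J - {i}. g i j) = (\<Sum>i\<in>J. \<Sum>j\<in>J. ?h i j)" (is "?S = _") by simp
  also have "\<dots> = (\<Sum>j\<in>J. \<Sum>i\<in>J. ?h i j)" by (rule sum.swap)
  also have "\<dots> = (\<Sum>j\<in>J. \<Sum>i\<in>J. - ?h j i)"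
  proof (intro sum.cong refl)
    fix i j assume "i \<in> J" "j \<in> J"
    then show "?h j i = - ?h i j" using anti[of j i] by (cases "i = j") simp_all
  qed
  also have "\<dots> = - ?S" by (simp add: eq sum_negf)
  finally have "?S = - ?S" .
  then have "?S + ?S = 0" by (simp only: eq_neg_iff_add_eq_0)
  \<comment> \<open>Division by 2 takes place in the coefficients, which are complex
    numbers.\<close>
  then have "lookup (?S + ?S) m = 0" for m by (simp only: lookup_zero)
  then have "lookup ?S m = 0" for m
    unfolding lookup_add by (simp only: mult_2[symmetric] mult_eq_0_iff zero_neq_numeral[symmetric] simp_thms)
  then show ?thesis by (intro poly_mapping_eqI) (simp only: lookup_zero)
qed

text \<open>The two orders of adding \<open>i\<close> and \<open>j\<close> to \<open>T\<close> reach
  the same coefficient of \<open>f\<close> with opposite signs.\<close>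

lemma kd_kd:
  assumes "finite I" "finite T"
  shows "kd I \<theta> (kd I \<theta> f) T = 0"
proof -
  let ?g = "\<lambda>i j. ksg i T * ksg j (insert i T) * (\<theta> i * \<theta> j * f (insert j (insert i T)))"
  have "kd I \<theta> (kd I \<theta> f) T = (\<Sum>i\<in>I - T. \<Sum>j\<in>(I - T) - {i}. ?g i j)"
    unfolding kd_def
    by (simp only: sum_distrib_left Diff_insert2[symmetric] Diff_insert[symmetric] mult.assoc mult.left_commute)
  also have "\<dots> = 0"
  proof (rule sum_antisym)
    show "finite (I - T)" using assms by simp
    fix i j assume ij: "i \<in> I - T" "j \<in> I - T" "i \<noteq> j"
    have s: "ksg i T * ksg j (insert i T) = - (ksg j T * ksg i (insert j T) :: 'a cpoly)"
      using ij assms by (intro ksg_swap) auto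
    show "?g i j = - ?g j i" unfolding s by (simp add: insert_commute mult.commute mult.left_commute)
  qed
  finally show ?thesis .
qed

lemma kchD: "f \<in> kch I A t u \<Longrightarrow> T \<subseteq> I \<Longrightarrow> card T = t \<Longrightarrow> f T \<in> A u"
  and kch_0: "f \<in> kch I A t u \<Longrightarrow> \<not> (T \<subseteq> I \<and> card T = t) \<Longrightarrow> f T = 0"
  unfolding kch_def by auto

lemma kchI:
  "(\<And>T. T \<subseteq> I \<Longrightarrow> card T = t \<Longrightarrow> f T \<in> A u) \<Longrightarrow>
   (\<And>T. \<not> (T \<subseteq> I \<and> card T = t) \<Longrightarrow> f T = 0) \<Longrightarrow> f \<in> kch I A t u"
  unfolding kch_def by auto

text \<open>A graded module \<open>A / N\<close> as far as the Koszul complex sees it: pieces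
  \<open>A u\<close>, relations \<open>N\<close> (one set for all degrees) and stability under the
  forms \<theta>. The quotient is never formed; equality is tested by membership in
  \<open>N\<close>.\<close>

locale koszul =
  fixes I :: "nat set" and \<theta> :: "nat \<Rightarrow> 'v cpoly" and A :: "nat \<Rightarrow> 'v cpoly set" and N
  assumes fin: "finite I"
    and A_sub: "csub (A u)" and N_sub: "csub N"
    and A_mult: "i \<in> I \<Longrightarrow> a \<in> A u \<Longrightarrow> \<theta> i * a \<in> A (Suc u)"
    and N_mult: "i \<in> I \<Longrightarrow> a \<in> N \<Longrightarrow> \<theta> i * a \<in> N"
begin

lemma kch_all: "f \<in> kch I A t u \<Longrightarrow> f T \<in> A u"
  using kchD[of f I A t u T] kch_0[of f I A t u T] csub_0[OF A_sub]
  by (cases "T \<subseteq> I \<and> card T = t") auto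

lemma kch_add: "f \<in> kch I A t u \<Longrightarrow> g \<in> kch I A t u \<Longrightarrow> f + g \<in> kch I A t u"
  by (intro kchI) (auto simp: plus_fun_def kch_0 intro!: csub_add[OF A_sub] dest: kchD)

lemma kch_fsc: "f \<in> kch I A t u \<Longrightarrow> fsc c f \<in> kch I A t u"
  by (intro kchI) (auto simp: fsc_def kch_0 intro!: csub_cst[OF A_sub] dest: kchD)

lemma kch_zero: "0 \<in> kch I A t u"
  by (intro kchI) (auto simp: zero_fun_def intro!: csub_0[OF A_sub])

lemma kch_sum: "(\<And>k. k \<in> K \<Longrightarrow> f k \<in> kch I A t u) \<Longrightarrow> (\<Sum>k\<in>K. f k) \<in> kch I A t u"
  by (induction K rule: infinite_finite_induct) (auto intro: kch_zero kch_add)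

lemma kch_diff: "f \<in> kch I A t u \<Longrightarrow> g \<in> kch I A t u \<Longrightarrow> f - g \<in> kch I A t u"
  by (intro kchI) (auto simp: fun_diff_def kch_0 intro!: csub_diff[OF A_sub] dest: kchD)

lemma kd_mem: "f \<in> kch I A t u \<Longrightarrow> kd I \<theta> f T \<in> A (Suc u)"
  unfolding kd_def by (intro csub_sum[OF A_sub] csub_ksg[OF A_sub] A_mult) (auto intro: kch_all)

lemma kd_null: "(\<And>T. f T \<in> N) \<Longrightarrow> kd I \<theta> f T \<in> N"
  unfolding kd_def by (intro csub_sum[OF N_sub] csub_ksg[OF N_sub] N_mult) auto

lemma kd_outside:
  assumes "f \<in> kch I A (Suc t) u" "\<not> (T \<subseteq> I \<and> card T = t)"
  shows "kd I \<theta> f T = 0"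
proof -
  have "f (insert i T) = 0" if "i \<in> I - T" for i
  proof (rule kch_0[OF assms(1)], rule notI)
    assume *: "insert i T \<subseteq> I \<and> card (insert i T) = Suc t"
    then have "finite T" by (intro finite_subset[OF _ fin]) simp
    with * that assms(2) show False by auto
  qed
  then show ?thesis by (simp add: kd_def)
qed

lemma kd_kch: "f \<in> kch I A (Suc t) u \<Longrightarrow> kd I \<theta> f \<in> kch I A t (Suc u)"
  by (intro kchI) (auto intro: kd_mem simp: kd_outside)

lemma kd_kch0: assumes "f \<in> kch I A 0 u" shows "kd I \<theta> f T = 0"
proof -
  have "f (insert i T) = 0" for i
  proof (rule kch_0[OF assms], rule notI)
    assume *: "insert i T \<subseteq> I \<and> card (insert i T) = 0"
    then have "finite (insert i T)" by (intro finite_subset[OF _ fin]) simp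
    with * show False by (simp add: card_eq_0_iff)
  qed
  then show ?thesis by (simp add: kd_def)
qed

lemma kcyc_sub: "module.subspace fsc (kcyc I \<theta> A N t s)"
  by (rule fsubspaceI)
    (auto simp: kcyc_def kch_zero kch_add kch_fsc kd_add kd_fsc kd_zero csub_0[OF N_sub]
      intro!: csub_add[OF N_sub] csub_cst[OF N_sub])

lemma kbd_sub: "module.subspace fsc (kbd I \<theta> A N t s)"
proof (rule fsubspaceI)
  show "0 \<in> kbd I \<theta> A N t s"
    by (auto simp: kbd_def kch_zero kd_zero csub_0[OF N_sub] intro!: bexI[of _ 0])
next
  fix f g assume "f \<in> kbd I \<theta> A N t s" "g \<in> kbd I \<theta> A N t s"
  then obtain f' g' where *: "f \<in> kch I A t (Suc s)" "g \<in> kch I A t (Suc s)"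
    "f' \<in> kch I A (Suc t) s" "g' \<in> kch I A (Suc t) s"
    "\<And>T. f T - kd I \<theta> f' T \<in> N" "\<And>T. g T - kd I \<theta> g' T \<in> N" unfolding kbd_def by blast
  have "(f + g) T - kd I \<theta> (f' + g') T \<in> N" for T
    using csub_add[OF N_sub *(5,6)[of T]] unfolding kd_add plus_fun_apply by (simp add: algebra_simps)
  then show "f + g \<in> kbd I \<theta> A N t s" using * kch_add unfolding kbd_def by blast
next
  fix c f assume "f \<in> kbd I \<theta> A N t s"
  then obtain f' where *: "f \<in> kch I A t (Suc s)" "f' \<in> kch I A (Suc t) s"
    "\<And>T. f T - kd I \<theta> f' T \<in> N" unfolding kbd_def by blast
  have "fsc c f T - kd I \<theta> (fsc c f') T \<in> N" for T
    using csub_cst[OF N_sub *(3)[of T], of c] unfolding kd_fsc fsc_apply by (simp add: algebra_simps)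
  then show "fsc c f \<in> kbd I \<theta> A N t s" using * kch_fsc unfolding kbd_def by blast
qed

lemma kdim_unique: "kdim I \<theta> A N t s d \<Longrightarrow> kdim I \<theta> A N t s d' \<Longrightarrow> d = d'"
  unfolding kdim_def by (rule qdim_unique[OF vector_space_fsc _ _ kbd_sub])

end

lemma kdimI:
  assumes "qfam fsc (kcyc I \<theta> A N t s) (kbd I \<theta> A N t s) K b" "card K = d"
  shows "kdim I \<theta> A N t s d"
  using qdim_qfam[OF vector_space_fsc assms(1)] assms(2) by (simp add: kdim_def)

lemma kdimE:
  assumes "kdim I \<theta> A N t s d"
  obtains b where "qfam fsc (kcyc I \<theta> A N t s) (kbd I \<theta> A N t s) {..<d} b"
  using assms unfolding kdim_def qdim_def[OF vector_space_fsc] by (elim exE)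

lemma fun_diff_apply: "(f - g) T = f T - g T" for f g :: "'i \<Rightarrow> 'b::minus"
  by (simp add: fun_diff_def)

section \<open>Direct sums of Koszul complexes\<close>

context koszul
begin

lemma kd_cong_null:
  assumes "\<And>T. f T - g T \<in> N"
  shows "kd I \<theta> f T - kd I \<theta> g T \<in> N"
  using kd_null[of "f - g" T] assms by (simp only: kd_diff fun_diff_apply)

end

text \<open>The maps \<open>\<phi> j\<close> are the inclusions of a decomposition of
  \<open>A / N\<close> into the modules \<open>As j / Ns j\<close>. They are merely linear, because
  in the stellar case they carry a factor \<open>y^j\<close> and are no ring homomorphisms.\<close>

locale koszul_sum = koszul I \<theta> A N
  for I :: "nat set" and \<theta> :: "nat \<Rightarrow> 'w cpoly" and A N +
  fixes J :: "'j set" and \<theta>s :: "'j \<Rightarrow> nat \<Rightarrow> 'v cpoly" and As Ns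
    and \<phi> :: "'j \<Rightarrow> 'v cpoly \<Rightarrow> 'w cpoly"
  assumes fin_J: "finite J"
    and mods: "j \<in> J \<Longrightarrow> koszul I (\<theta>s j) (As j) (Ns j)"
    and \<phi>_add: "j \<in> J \<Longrightarrow> \<phi> j (a + b) = \<phi> j a + \<phi> j b"
    and \<phi>_cst: "j \<in> J \<Longrightarrow> \<phi> j (cst c * a) = cst c * \<phi> j a"
    and \<phi>_into: "j \<in> J \<Longrightarrow> a \<in> As j u \<Longrightarrow> \<phi> j a \<in> A u"
    and \<phi>_null: "j \<in> J \<Longrightarrow> a \<in> As j u \<Longrightarrow> a \<in> Ns j \<Longrightarrow> \<phi> j a \<in> N"
    and \<phi>_comm: "j \<in> J \<Longrightarrow> i \<in> I \<Longrightarrow> a \<in> As j u \<Longrightarrow> \<phi> j (\<theta>s j i * a) - \<theta> i * \<phi> j a \<in> N"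
    and \<phi>_inj: "(\<And>j. j \<in> J \<Longrightarrow> f j \<in> As j u) \<Longrightarrow> (\<Sum>j\<in>J. \<phi> j (f j)) \<in> N \<Longrightarrow> j \<in> J \<Longrightarrow> f j \<in> Ns j"
    and \<phi>_sur: "w \<in> A u \<Longrightarrow> \<exists>f. (\<forall>j\<in>J. f j \<in> As j u) \<and> w - (\<Sum>j\<in>J. \<phi> j (f j)) \<in> N"
begin

lemma \<phi>_0: "j \<in> J \<Longrightarrow> \<phi> j 0 = 0"
  using \<phi>_cst[of j 0 0] by simp

lemma \<phi>_diff: "j \<in> J \<Longrightarrow> \<phi> j (a - b) = \<phi> j a - \<phi> j b"
  using \<phi>_add[of j "a - b" b] by simp

lemma \<phi>_sum: "j \<in> J \<Longrightarrow> \<phi> j (\<Sum>k\<in>K. f k) = (\<Sum>k\<in>K. \<phi> j (f k))"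
  by (induction K rule: infinite_finite_induct) (simp_all add: \<phi>_0 \<phi>_add)

lemma \<phi>_ksg: "j \<in> J \<Longrightarrow> \<phi> j (ksg i T * a) = ksg i T * \<phi> j a"
  using \<phi>_cst[of j "(- 1) ^ card {j \<in> insert i T. j \<le> i}" a]
  by (simp add: ksg_def cst_power cst_uminus)

lemma lift_kch: "j \<in> J \<Longrightarrow> f \<in> kch I (As j) t u \<Longrightarrow> (\<lambda>T. \<phi> j (f T)) \<in> kch I A t u"
  by (intro kchI) (auto intro!: \<phi>_into dest: kchD simp: kch_0 \<phi>_0)

lemma lift_kd:
  assumes "j \<in> J" "f \<in> kch I (As j) t u"
  shows "\<phi> j (kd I (\<theta>s j) f T) - kd I \<theta> (\<lambda>T. \<phi> j (f T)) T \<in> N"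
proof -
  have "\<phi> j (kd I (\<theta>s j) f T) - kd I \<theta> (\<lambda>T. \<phi> j (f T)) T
      = (\<Sum>i\<in>I - T. ksg i T * (\<phi> j (\<theta>s j i * f (insert i T)) - \<theta> i * \<phi> j (f (insert i T))))"
    using assms(1) by (simp add: kd_def \<phi>_sum \<phi>_ksg sum_subtractf right_diff_distrib)
  also have "\<dots> \<in> N"
    using assms koszul.kch_all[OF mods]
    by (intro csub_sum[OF N_sub] csub_ksg[OF N_sub] \<phi>_comm) auto
  finally show ?thesis .
qed

lemma decompose:
  assumes "z \<in> kch I A t u"
  shows "\<exists>y. (\<forall>j\<in>J. y j \<in> kch I (As j) t u) \<and> (\<forall>T. z T - (\<Sum>j\<in>J. \<phi> j (y j T)) \<in> N)"
proof -
  from \<phi>_sur[OF kch_all[OF assms]] obtain y where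
    y: "\<And>T j. j \<in> J \<Longrightarrow> y T j \<in> As j u" "\<And>T. z T - (\<Sum>j\<in>J. \<phi> j (y T j)) \<in> N"
    by metis
  \<comment> \<open>The pointwise choice has values at every \<open>T\<close>, whereas chains vanish
    away from the subsets of \<open>I\<close> of size \<open>t\<close>.\<close>
  define w where "w j T = (if T \<subseteq> I \<and> card T = t then y T j else 0)" for j T
  have "w j \<in> kch I (As j) t u" if "j \<in> J" for j
    using y(1)[OF that] by (intro kchI) (auto simp: w_def)
  moreover have "z T - (\<Sum>j\<in>J. \<phi> j (w j T)) \<in> N" for T
  proof (cases "T \<subseteq> I \<and> card T = t")
    case True
    then show ?thesis using y(2)[of T] by (simp add: w_def)
  next
    case False
    then have "w j T = 0" for j by (auto simp: w_def)
    then show ?thesis using kch_0[OF assms False] by (simp add: \<phi>_0 csub_0[OF N_sub])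
  qed
  ultimately show ?thesis by blast
qed

lemma lift_sum_kd:
  assumes "\<And>j. j \<in> J \<Longrightarrow> y j \<in> kch I (As j) t u"
  shows "(\<Sum>j\<in>J. \<phi> j (kd I (\<theta>s j) (y j) T)) - kd I \<theta> (\<lambda>T. \<Sum>j\<in>J. \<phi> j (y j T)) T \<in> N"
proof -
  have "(\<lambda>T. \<Sum>j\<in>J. \<phi> j (y j T)) = (\<Sum>j\<in>J. (\<lambda>T. \<phi> j (y j T)))"
    by (simp add: fun_sum_apply fun_eq_iff)
  then have "kd I \<theta> (\<lambda>T. \<Sum>j\<in>J. \<phi> j (y j T)) T = (\<Sum>j\<in>J. kd I \<theta> (\<lambda>T. \<phi> j (y j T)) T)"
    by (simp add: kd_sum)
  then show ?thesis
    using assms by (auto simp flip: sum_subtractf intro!: csub_sum[OF N_sub] lift_kd)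
qed

text \<open>Homology commutes with direct sums: the lifted bases of the summands, indexed by pairs
  of a summand and a number, form a basis of the whole.\<close>

lemma kdim_sum:
  assumes d: "\<And>j. j \<in> J \<Longrightarrow> kdim I (\<theta>s j) (As j) (Ns j) t s (d j)"
  shows "kdim I \<theta> A N t s (\<Sum>j\<in>J. d j)"
proof -
  have "\<forall>j\<in>J. \<exists>b. qfam fsc (kcyc I (\<theta>s j) (As j) (Ns j) t s) (kbd I (\<theta>s j) (As j) (Ns j) t s) {..<d j} b"
    using d kdimE by metis
  then obtain b where b: "\<And>j. j \<in> J \<Longrightarrow>
      qfam fsc (kcyc I (\<theta>s j) (As j) (Ns j) t s) (kbd I (\<theta>s j) (As j) (Ns j) t s) {..<d j} (b j)"
    by metis
  define K where "K = (SIGMA j:J. {..<d j})"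
  define B where "B = (\<lambda>(j, k). (\<lambda>T. \<phi> j (b j k T)))"
  have b_kch: "b j k \<in> kch I (As j) t (Suc s)" "kd I (\<theta>s j) (b j k) T \<in> Ns j"
    if "j \<in> J" "k < d j" for j k T
    using qfam_mem[OF b[OF that(1)], of k] that(2) by (auto simp: kcyc_def)
  define S where "S j a = (\<Sum>k<d j. fsc (a (j, k)) (b j k))" for j a
  have S_kch: "S j a \<in> kch I (As j) t (Suc s)" if "j \<in> J" for j a
    unfolding S_def using b_kch[OF that]
    by (intro koszul.kch_sum[OF mods] koszul.kch_fsc[OF mods] that) auto
  have sum_B: "(\<Sum>x\<in>K. fsc (a x) (B x)) T = (\<Sum>j\<in>J. \<phi> j (S j a T))" for a T
  proof -
    have "(\<Sum>x\<in>K. fsc (a x) (B x)) T = (\<Sum>j\<in>J. \<Sum>k<d j. cst (a (j, k)) * \<phi> j (b j k T))"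
      unfolding K_def B_def
      by (subst sum.Sigma) (auto simp: fun_sum_apply fsc_apply fin_J intro!: sum.cong)
    also have "\<dots> = (\<Sum>j\<in>J. \<phi> j (S j a T))"
      by (intro sum.cong refl) (simp add: S_def fun_sum_apply fsc_apply \<phi>_sum \<phi>_cst)
    finally show ?thesis .
  qed
  show ?thesis
  proof (rule kdimI[where K = K and b = B])
    show "card K = (\<Sum>j\<in>J. d j)" unfolding K_def using fin_J by simp
    show "qfam fsc (kcyc I \<theta> A N t s) (kbd I \<theta> A N t s) K B"
      unfolding qfam_def
    proof (intro conjI ballI allI impI)
      show "finite K" unfolding K_def using fin_J by simp
    next
      fix x assume "x \<in> K"
      then obtain j k where x: "x = (j, k)" "j \<in> J" "k < d j" by (auto simp: K_def)
      have "kd I \<theta> (B x) T \<in> N" for T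
      proof (rule csub_congD'[OF N_sub])
        show "\<phi> j (kd I (\<theta>s j) (b j k) T) - kd I \<theta> (B x) T \<in> N"
          using lift_kd[OF x(2) b_kch(1)[OF x(2,3)]] x(1) by (simp add: B_def)
        show "\<phi> j (kd I (\<theta>s j) (b j k) T) \<in> N"
          using koszul.kd_mem[OF mods b_kch(1)] b_kch(2) x by (blast intro: \<phi>_null)
      qed
      then show "B x \<in> kcyc I \<theta> A N t s"
        using lift_kch[OF x(2) b_kch(1)[OF x(2,3)]] x(1) by (simp add: kcyc_def B_def)
    next
      fix z assume z: "z \<in> kcyc I \<theta> A N t s"
      then have zc: "z \<in> kch I A t (Suc s)" "\<And>T. kd I \<theta> z T \<in> N" by (auto simp: kcyc_def)
      from decompose[OF zc(1)] obtain y where y: "\<And>j. j \<in> J \<Longrightarrow> y j \<in> kch I (As j) t (Suc s)"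
        "\<And>T. z T - (\<Sum>j\<in>J. \<phi> j (y j T)) \<in> N" by blast
      \<comment> \<open>A cycle decomposes into cycles: the lifted boundaries add up to something
        null, and joint injectivity separates them. Boundaries have degree \<open>s + 1\<close>,
        hence the index \<open>Suc (Suc s)\<close>.\<close>
      have dy: "kd I (\<theta>s j) (y j) T \<in> Ns j" if "j \<in> J" for j T
      proof (rule \<phi>_inj[where f = "\<lambda>j. kd I (\<theta>s j) (y j) T" and u = "Suc (Suc s)", OF _ _ that])
        show "kd I (\<theta>s j) (y j) T \<in> As j (Suc (Suc s))" if "j \<in> J" for j
          using koszul.kd_mem[OF mods y(1)] that by blast
        have "kd I \<theta> (\<lambda>T. \<Sum>j\<in>J. \<phi> j (y j T)) T \<in> N"
          by (rule csub_congD'[OF N_sub kd_cong_null[OF y(2)] zc(2)])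
        with lift_sum_kd[OF y(1)] show "(\<Sum>j\<in>J. \<phi> j (kd I (\<theta>s j) (y j) T)) \<in> N"
          by (rule csub_congD[OF N_sub])
      qed
      have "\<forall>j\<in>J. \<exists>a. y j - (\<Sum>k<d j. fsc (a k) (b j k)) \<in> kbd I (\<theta>s j) (As j) (Ns j) t s"
        using qfam_span[OF b] y dy by (simp add: kcyc_def)
      then obtain a where a: "\<And>j. j \<in> J \<Longrightarrow>
          y j - (\<Sum>k<d j. fsc (a j k) (b j k)) \<in> kbd I (\<theta>s j) (As j) (Ns j) t s" by metis
      let ?a = "\<lambda>(j, k). a j k"
      from a have "\<forall>j\<in>J. \<exists>g\<in>kch I (As j) (Suc t) s. \<forall>T. y j T - S j ?a T - kd I (\<theta>s j) g T \<in> Ns j"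
        by (simp add: kbd_def S_def fun_diff_def)
      then obtain g where g: "\<And>j. j \<in> J \<Longrightarrow> g j \<in> kch I (As j) (Suc t) s"
        "\<And>j T. j \<in> J \<Longrightarrow> y j T - S j ?a T - kd I (\<theta>s j) (g j) T \<in> Ns j" by metis
      define G where "G = (\<lambda>T. \<Sum>j\<in>J. \<phi> j (g j T))"
      have G: "G \<in> kch I A (Suc t) s"
      proof -
        have "G = (\<Sum>j\<in>J. (\<lambda>T. \<phi> j (g j T)))" by (simp add: G_def fun_sum_apply fun_eq_iff)
        then show ?thesis using lift_kch g(1) by (auto intro: kch_sum)
      qed
      define s' where "s' = (\<Sum>x\<in>K. fsc (?a x) (B x))"
      have s': "s' T = (\<Sum>j\<in>J. \<phi> j (S j ?a T))" for T unfolding s'_def by (rule sum_B)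
      have "s' \<in> kch I A t (Suc s)"
        unfolding s'_def using lift_kch b_kch(1)
        by (intro kch_sum kch_fsc) (auto simp: K_def B_def)
      moreover have "z T - s' T - kd I \<theta> G T \<in> N" for T
      proof -
        have "(\<Sum>j\<in>J. \<phi> j (y j T - S j ?a T - kd I (\<theta>s j) (g j) T)) \<in> N"
        proof (rule csub_sum[OF N_sub], rule \<phi>_null[where u = "Suc s"])
          fix j assume j: "j \<in> J"
          show "y j T - S j ?a T - kd I (\<theta>s j) (g j) T \<in> Ns j" by (rule g(2)[OF j])
          show "y j T - S j ?a T - kd I (\<theta>s j) (g j) T \<in> As j (Suc s)"
            using koszul.kd_mem[OF mods[OF j] g(1)[OF j]] y(1)[OF j] S_kch[OF j]
              koszul.kch_all[OF mods[OF j]]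
            by (intro csub_diff koszul.A_sub[OF mods[OF j]]) blast+
        qed
        then have "(\<Sum>j\<in>J. \<phi> j (y j T)) - s' T - (\<Sum>j\<in>J. \<phi> j (kd I (\<theta>s j) (g j) T)) \<in> N"
          by (simp add: s' \<phi>_diff sum_subtractf)
        from csub_add[OF N_sub csub_add[OF N_sub this y(2)[of T]] lift_sum_kd[OF g(1), where T = T]]
        show ?thesis by (simp add: G_def algebra_simps)
      qed
      ultimately have "z - s' \<in> kbd I \<theta> A N t s"
        using zc(1) G by (auto simp: kbd_def fun_diff_def[abs_def] intro!: kch_diff[unfolded fun_diff_def])
      then show "\<exists>a. z - (\<Sum>x\<in>K. fsc (a x) (B x)) \<in> kbd I \<theta> A N t s" unfolding s'_def by blast
    next
      fix a x assume bd: "(\<Sum>x\<in>K. fsc (a x) (B x)) \<in> kbd I \<theta> A N t s" and x: "x \<in> K"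
      then obtain g where g: "g \<in> kch I A (Suc t) s"
        "\<And>T. (\<Sum>j\<in>J. \<phi> j (S j a T)) - kd I \<theta> g T \<in> N" by (auto simp: kbd_def sum_B)
      from decompose[OF g(1)] obtain h where h: "\<And>j. j \<in> J \<Longrightarrow> h j \<in> kch I (As j) (Suc t) s"
        "\<And>T. g T - (\<Sum>j\<in>J. \<phi> j (h j T)) \<in> N" by blast
      \<comment> \<open>A bounding chain decomposes likewise, so each part of the combination is a
        boundary in its own summand.\<close>
      have null: "S j a T - kd I (\<theta>s j) (h j) T \<in> Ns j" if "j \<in> J" for j T
      proof (rule \<phi>_inj[where f = "\<lambda>j. S j a T - kd I (\<theta>s j) (h j) T" and u = "Suc s", OF _ _ that])
        show "S j a T - kd I (\<theta>s j) (h j) T \<in> As j (Suc s)" if "j \<in> J" for j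
          using koszul.kd_mem[OF mods h(1)] S_kch koszul.kch_all[OF mods] that
          by (intro csub_diff koszul.A_sub[OF mods]) blast+
        from csub_add[OF N_sub g(2)[of T] csub_diff[OF N_sub kd_cong_null[where f = g and g = "\<lambda>T. \<Sum>j\<in>J. \<phi> j (h j T)" and T = T, OF h(2)] lift_sum_kd[OF h(1), where T = T]]]
        show "(\<Sum>j\<in>J. \<phi> j (S j a T - kd I (\<theta>s j) (h j) T)) \<in> N"
          by (simp add: \<phi>_diff sum_subtractf)
      qed
      obtain j k where jk: "x = (j, k)" "j \<in> J" "k < d j" using x by (auto simp: K_def)
      have "S j a \<in> kbd I (\<theta>s j) (As j) (Ns j) t s"
        using null[OF jk(2)] S_kch[OF jk(2)] h(1)[OF jk(2)] by (auto simp: kbd_def)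
      from qfam_indep[OF b[OF jk(2)] this[unfolded S_def]] jk show "a x = 0" by simp
    qed
  qed
qed

end

lemma kdim_cong:
  assumes "\<And>i. i \<in> I \<Longrightarrow> \<theta> i = \<theta>' i"
  shows "kdim I \<theta> A N t s d \<longleftrightarrow> kdim I \<theta>' A N t s d"
proof -
  have "kd I \<theta> = kd I \<theta>'" by (simp add: fun_eq_iff kd_def assms)
  then show ?thesis by (simp add: kdim_def kcyc_def kbd_def)
qed

lemma kd_outside_I:
  assumes "f \<in> kch I A t u" "\<not> T \<subseteq> I"
  shows "kd I \<theta> f T = 0"
proof -
  have "f (insert i T) = 0" for i using assms by (intro kch_0[OF assms(1)]) auto
  then show ?thesis by (simp add: kd_def)
qed

lemma (in koszul) kd_kd_chain:
  assumes f: "f \<in> kch I A (Suc t) u"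
  shows "kd I \<theta> (kd I \<theta> f) T = 0"
proof (cases "T \<subseteq> I")
  case True
  show ?thesis by (rule kd_kd[OF fin finite_subset[OF True fin]])
next
  case False
  then have "\<not> (insert i T \<subseteq> I \<and> card (insert i T) = t)" for i by auto
  then have "kd I \<theta> f (insert i T) = 0" for i by (rule kd_outside[OF f])
  then show ?thesis by (simp add: kd_def[of _ _ "kd I \<theta> f"])
qed

text \<open>Change of rings: \<open>\<theta> e\<close> is a nonzerodivisor on \<open>A / N\<close>, with quotient \<open>A' / N'\<close>.\<close>

locale koszul_kill = src: koszul I \<theta> A N + tgt: koszul "I - {e}" \<theta>' A' N'
  for I :: "nat set" and \<theta> :: "nat \<Rightarrow> 'v cpoly" and A N
    and e and \<theta>' :: "nat \<Rightarrow> 'v cpoly" and A' N' +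
  fixes \<pi> :: "'v cpoly \<Rightarrow> 'v cpoly"
  assumes e: "e \<in> I" and A_0: "A 0 = {0}"
    and \<pi>_add: "\<pi> (a + b) = \<pi> a + \<pi> b"
    and \<pi>_cst: "\<pi> (cst c * a) = cst c * \<pi> a"
    and \<pi>_into: "a \<in> A u \<Longrightarrow> \<pi> a \<in> A' u"
    and \<pi>_sur: "w \<in> A' u \<Longrightarrow> \<exists>a\<in>A u. \<pi> a - w \<in> N'"
    and \<pi>_null: "a \<in> A u \<Longrightarrow> a \<in> N \<Longrightarrow> \<pi> a \<in> N'"
    and \<pi>_comm: "i \<in> I - {e} \<Longrightarrow> a \<in> A u \<Longrightarrow> \<pi> (\<theta> i * a) - \<theta>' i * \<pi> a \<in> N'"
    and \<pi>_e: "a \<in> A u \<Longrightarrow> \<pi> (\<theta> e * a) \<in> N'"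
    and \<pi>_ker: "a \<in> A (Suc u) \<Longrightarrow> \<pi> a \<in> N' \<Longrightarrow> \<exists>b\<in>A u. a - \<theta> e * b \<in> N"
    and regular: "a \<in> A u \<Longrightarrow> \<theta> e * a \<in> N \<Longrightarrow> a \<in> N"
begin

lemma \<pi>_0: "\<pi> 0 = 0"
  using \<pi>_cst[of 0 0] by simp

lemma \<pi>_diff: "\<pi> (a - b) = \<pi> a - \<pi> b"
  using \<pi>_add[of "a - b" b] by simp

lemma \<pi>_sum: "\<pi> (\<Sum>k\<in>K. f k) = (\<Sum>k\<in>K. \<pi> (f k))"
  by (induction K rule: infinite_finite_induct) (simp_all add: \<pi>_0 \<pi>_add)

lemma \<pi>_ksg: "\<pi> (ksg i T * a) = ksg i T * \<pi> a"
  using \<pi>_cst[of "(- 1) ^ card {j \<in> insert i T. j \<le> i}" a]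
  by (simp add: ksg_def cst_power cst_uminus)

text \<open>The projection onto the Koszul complex of the remaining forms over the quotient by
  \<open>\<theta> e\<close>; the generator of index \<open>e\<close> goes to 0.\<close>

definition P :: "(nat set \<Rightarrow> 'v cpoly) \<Rightarrow> nat set \<Rightarrow> 'v cpoly"
  where "P f = (\<lambda>T. if e \<in> T then 0 else \<pi> (f T))"

lemma P_kch: "f \<in> kch I A t u \<Longrightarrow> P f \<in> kch (I - {e}) A' t u"
proof (intro kchI)
  fix T assume f: "f \<in> kch I A t u" and "\<not> (T \<subseteq> I - {e} \<and> card T = t)"
  then have "e \<in> T \<or> f T = 0" using kch_0[OF f] by auto
  then show "P f T = 0" by (auto simp: P_def \<pi>_0)
qed (auto simp: P_def intro!: \<pi>_into dest: kchD)

lemma kd_split: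
  assumes "e \<notin> T"
  shows "kd I \<theta> f T = ksg e T * (\<theta> e * f (insert e T)) +
    (\<Sum>i\<in>I - {e} - T. ksg i T * (\<theta> i * f (insert i T)))"
proof -
  have "I - T - {e} = I - {e} - T" by auto
  then show ?thesis
    using sum.remove[of "I - T" e "\<lambda>i. ksg i T * (\<theta> i * f (insert i T))"] e assms src.fin
    by (simp add: kd_def)
qed

lemma P_kd:
  assumes f: "f \<in> kch I A t u"
  shows "P (kd I \<theta> f) T - kd (I - {e}) \<theta>' (P f) T \<in> N'"
proof (cases "e \<in> T")
  case True
  then show ?thesis by (simp add: P_def kd_def csub_0[OF tgt.N_sub])
next
  case False
  have "P (kd I \<theta> f) T - kd (I - {e}) \<theta>' (P f) T = ksg e T * \<pi> (\<theta> e * f (insert e T)) +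
     (\<Sum>i\<in>I - {e} - T. ksg i T * (\<pi> (\<theta> i * f (insert i T)) - \<theta>' i * \<pi> (f (insert i T))))"
    using False by (simp add: P_def kd_split \<pi>_add \<pi>_sum \<pi>_ksg)
      (simp add: kd_def right_diff_distrib sum_subtractf P_def)
  also have "\<dots> \<in> N'"
    using src.kch_all[OF f]
    by (intro csub_add csub_sum csub_ksg tgt.N_sub \<pi>_e \<pi>_comm) auto
  finally show ?thesis .
qed

text \<open>At \<open>T0\<close> without \<open>e\<close>, the boundary contains
  \<open>c (insert e T0)\<close> only with the factor \<open>\<theta> e\<close>. The other terms are
  null, and regularity cancels the factor.\<close>

lemma null_from_base:
  assumes c: "c \<in> kch I A t u" and d: "\<And>T. e \<notin> T \<Longrightarrow> kd I \<theta> c T \<in> N"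
    and n: "\<And>T. e \<notin> T \<Longrightarrow> c T \<in> N"
  shows "c T \<in> N"
proof (cases "e \<in> T")
  case True
  define T0 where "T0 = T - {e}"
  then have T: "T = insert e T0" "e \<notin> T0" using True by auto
  have "(\<Sum>i\<in>I - {e} - T0. ksg i T0 * (\<theta> i * c (insert i T0))) \<in> N"
    using T n by (intro csub_sum csub_ksg src.N_sub src.N_mult) auto
  from csub_diff[OF src.N_sub d[OF T(2)] this]
  have "ksg e T0 * (\<theta> e * c T) \<in> N" by (simp add: kd_split[OF T(2)] T(1))
  from csub_ksg[OF src.N_sub this, of e T0] have "\<theta> e * c T \<in> N" by simp
  then show ?thesis by (rule regular[OF src.kch_all[OF c]])
qed (use n in auto)

text \<open>The boundary of \<open>c\<close> is itself a chain with zero boundary, so it is null as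
  soon as it is null on the sets without \<open>e\<close>.\<close>

lemma cycle_from_base:
  assumes c: "c \<in> kch I A t u" and d: "\<And>T. e \<notin> T \<Longrightarrow> kd I \<theta> c T \<in> N"
  shows "kd I \<theta> c T \<in> N"
proof (cases t)
  case 0
  then show ?thesis using src.kd_kch0 c csub_0[OF src.N_sub] by simp
next
  case (Suc t')
  show ?thesis
  proof (rule null_from_base[OF src.kd_kch[OF c[unfolded Suc]] _ d])
    fix T
    show "kd I \<theta> (kd I \<theta> c) T \<in> N"
      by (simp add: src.kd_kd_chain[OF c[unfolded Suc]] csub_0[OF src.N_sub])
  qed auto
qed

lemma lift_base:
  assumes h: "h \<in> kch (I - {e}) A' t u"
  shows "\<exists>f\<in>kch I A t u. (\<forall>T. P f T - h T \<in> N') \<and> (\<forall>T. e \<in> T \<longrightarrow> f T = 0)"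
proof -
  from \<pi>_sur[OF tgt.kch_all[OF h]] obtain y where
    y: "\<And>T. y T \<in> A u" "\<And>T. \<pi> (y T) - h T \<in> N'" by metis
  define f where "f T = (if T \<subseteq> I - {e} \<and> card T = t then y T else 0)" for T
  have "P f T - h T \<in> N'" for T
  proof (cases "T \<subseteq> I - {e} \<and> card T = t")
    case True
    then show ?thesis using y(2)[of T] by (auto simp: P_def f_def)
  next
    case False
    then have "f T = 0" by (auto simp: f_def)
    then have "P f T = 0" by (simp add: P_def \<pi>_0)
    then show ?thesis using kch_0[OF h False] by (simp add: csub_0[OF tgt.N_sub])
  qed
  moreover have "f \<in> kch I A t u"
    using y(1) csub_0[OF src.A_sub] by (intro kchI) (auto simp: f_def)
  moreover have "f T = 0" if "e \<in> T" for T using that by (auto simp: f_def)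
  ultimately show ?thesis by blast
qed

text \<open>On sets without \<open>e\<close>, the coefficients of a chain killed by \<open>P\<close>
  are divisible by \<open>\<theta> e\<close> modulo \<open>N\<close>. The quotients, moved to the
  sets containing \<open>e\<close>, form a chain whose boundary agrees with it there.\<close>

lemma correct_base:
  assumes w: "w \<in> kch I A t (Suc u)" and n: "\<And>T. P w T \<in> N'"
  shows "\<exists>f\<in>kch I A (Suc t) u. \<forall>T. e \<notin> T \<longrightarrow> f T = 0 \<and> w T - kd I \<theta> f T \<in> N"
proof -
  have "\<forall>T. \<exists>b\<in>A u. e \<notin> T \<longrightarrow> w T - \<theta> e * b \<in> N"
  proof
    fix T
    show "\<exists>b\<in>A u. e \<notin> T \<longrightarrow> w T - \<theta> e * b \<in> N"
      using n[of T] csub_0[OF src.A_sub] \<pi>_ker[OF src.kch_all[OF w]]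
      by (cases "e \<in> T") (auto simp: P_def)
  qed
  then obtain b where b: "\<And>T. b T \<in> A u" "\<And>T. e \<notin> T \<Longrightarrow> w T - \<theta> e * b T \<in> N" by metis
  \<comment> \<open>The sign is its own inverse and cancels the one in \<open>kd\<close>.\<close>
  define f where "f T = (if e \<in> T \<and> T \<subseteq> I \<and> card T = Suc t then ksg e (T - {e}) * b (T - {e}) else 0)" for T
  have "f \<in> kch I A (Suc t) u"
    using b(1) by (intro kchI) (auto simp: f_def intro!: csub_ksg src.A_sub csub_0)
  moreover have "w T - kd I \<theta> f T \<in> N" if T: "e \<notin> T" for T
  proof (cases "T \<subseteq> I \<and> card T = t")
    case True
    then have "finite T" using finite_subset[OF _ src.fin] by blast
    then have "f (insert e T) = ksg e T * b T" using T True e by (simp add: f_def)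
    moreover have "f (insert i T) = 0" if "i \<in> I - {e}" for i using T that by (auto simp: f_def)
    ultimately have "kd I \<theta> f T = \<theta> e * b T"
      by (simp add: kd_split[OF T] mult.left_commute[of "\<theta> e"])
    then show ?thesis using b(2)[OF T] by simp
  next
    case False
    have "w T = 0" by (rule kch_0[OF w False])
    moreover have "kd I \<theta> f T = 0"
      by (rule src.kd_outside[OF \<open>f \<in> kch I A (Suc t) u\<close> False])
    ultimately show ?thesis by (simp add: csub_0[OF src.N_sub])
  qed
  moreover have "f T = 0" if "e \<notin> T" for T using that by (simp add: f_def)
  ultimately show ?thesis by blast
qed

lemma P_add: "P (f + g) = P f + P g"
  by (auto simp: P_def plus_fun_def \<pi>_add)

lemma P_diff: "P (f - g) T = P f T - P g T"
  by (auto simp: P_def fun_diff_def \<pi>_diff)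

lemma P_fsc: "P (fsc c f) = fsc c (P f)"
  by (auto simp: P_def fsc_def \<pi>_cst)

lemma P_null: "f \<in> kch I A t u \<Longrightarrow> f T \<in> N \<Longrightarrow> P f T \<in> N'"
  using \<pi>_null[OF src.kch_all] csub_0[OF tgt.N_sub] by (auto simp: P_def)

lemma P_cycle:
  assumes "f \<in> kch I A t u" "\<And>T. kd I \<theta> f T \<in> N"
  shows "kd (I - {e}) \<theta>' (P f) T \<in> N'"
proof (rule csub_congD'[OF tgt.N_sub P_kd[OF assms(1)]])
  show "P (kd I \<theta> f) T \<in> N'"
    using \<pi>_null[OF src.kd_mem[OF assms(1)] assms(2)] csub_0[OF tgt.N_sub] by (auto simp: P_def)
qed

lemma P_boundary:
  assumes f: "f \<in> kch I A t (Suc s)" and g: "g \<in> kch I A (Suc t) s"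
    and n: "\<And>T. f T - kd I \<theta> g T \<in> N"
  shows "P f T - kd (I - {e}) \<theta>' (P g) T \<in> N'"
proof -
  have "P (f - kd I \<theta> g) T \<in> N'"
    using P_null[OF src.kch_diff[OF f src.kd_kch[OF g]]] n by (simp add: fun_diff_def)
  from csub_add[OF tgt.N_sub this P_kd[OF g, of T]] show ?thesis by (simp add: P_diff)
qed

text \<open>\<open>P\<close> induces an isomorphism on homology. Chains are corrected only on the
  sets without \<open>e\<close>; regularity then takes care of the sets containing
  \<open>e\<close>.\<close>

lemma kdim_kill:
  assumes "kdim (I - {e}) \<theta>' A' N' t s d"
  shows "kdim I \<theta> A N t s d"
  unfolding kdim_def
proof (rule qdim_lift[where \<phi> = P and sc = fsc and sc' = fsc,
    OF vector_space_fsc vector_space_fsc src.kbd_sub tgt.kbd_sub src.kcyc_sub P_add P_fsc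
      _ _ _ assms[unfolded kdim_def]])
  show "P z \<in> kcyc (I - {e}) \<theta>' A' N' t s" if "z \<in> kcyc I \<theta> A N t s" for z
    using that P_kch P_cycle by (auto simp: kcyc_def)
next
  fix z assume "z \<in> kcyc I \<theta> A N t s"
  then have z: "z \<in> kch I A t (Suc s)" "\<And>T. kd I \<theta> z T \<in> N" by (auto simp: kcyc_def)
  show "P z \<in> kbd (I - {e}) \<theta>' A' N' t s \<longleftrightarrow> z \<in> kbd I \<theta> A N t s"
  proof
    assume "z \<in> kbd I \<theta> A N t s"
    then show "P z \<in> kbd (I - {e}) \<theta>' A' N' t s"
      using P_boundary P_kch unfolding kbd_def by blast
  next
    assume "P z \<in> kbd (I - {e}) \<theta>' A' N' t s"
    then obtain h where h: "h \<in> kch (I - {e}) A' (Suc t) s"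
      "\<And>T. P z T - kd (I - {e}) \<theta>' h T \<in> N'" by (auto simp: kbd_def)
    from lift_base[OF h(1)] obtain g where g: "g \<in> kch I A (Suc t) s" "\<And>T. P g T - h T \<in> N'"
      by blast
    \<comment> \<open>Once the boundary of a lift of \<open>h\<close> is subtracted, the cycle
      projects to zero, so \<open>correct_base\<close> applies to the rest.\<close>
    define w where "w = z - kd I \<theta> g"
    have w: "w \<in> kch I A t (Suc s)" unfolding w_def by (rule src.kch_diff[OF z(1) src.kd_kch[OF g(1)]])
    have "P w T \<in> N'" for T
    proof -
      have "kd (I - {e}) \<theta>' (P g) T - kd (I - {e}) \<theta>' h T \<in> N'"
        by (rule tgt.kd_cong_null[OF g(2)])
      from csub_diff[OF tgt.N_sub csub_diff[OF tgt.N_sub h(2)[of T] this] P_kd[OF g(1), of T]]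
      show ?thesis by (simp add: w_def P_diff)
    qed
    from correct_base[OF w this] obtain f where f: "f \<in> kch I A (Suc t) s"
      "\<And>T. e \<notin> T \<Longrightarrow> w T - kd I \<theta> f T \<in> N" by blast
    have "(w - kd I \<theta> f) T \<in> N" for T
    proof (rule null_from_base[OF src.kch_diff[OF w src.kd_kch[OF f(1)]]])
      show "kd I \<theta> (w - kd I \<theta> f) T \<in> N" for T
        by (simp add: kd_diff w_def src.kd_kd_chain[OF f(1)] src.kd_kd_chain[OF g(1)] z(2))
      show "(w - kd I \<theta> f) T \<in> N" if "e \<notin> T" for T using f(2)[OF that] by (simp add: fun_diff_def)
    qed
    then have "z T - kd I \<theta> (g + f) T \<in> N" for T
      by (simp add: w_def kd_add fun_diff_apply diff_diff_eq)
    then show "z \<in> kbd I \<theta> A N t s" using z(1) src.kch_add[OF g(1) f(1)] by (auto simp: kbd_def)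
  qed
next
  fix z' assume "z' \<in> kcyc (I - {e}) \<theta>' A' N' t s"
  then have z': "z' \<in> kch (I - {e}) A' t (Suc s)" "\<And>T. kd (I - {e}) \<theta>' z' T \<in> N'"
    by (auto simp: kcyc_def)
  from lift_base[OF z'(1)] obtain g where g: "g \<in> kch I A t (Suc s)" "\<And>T. P g T - z' T \<in> N'" by blast
  \<comment> \<open>A lift of a cycle need not be a cycle. Its boundary projects to zero and is
    cancelled by a chain on sets containing \<open>e\<close>, which \<open>P\<close> does not
    see.\<close>
  obtain f where f: "f \<in> kch I A t (Suc s)" "\<And>T. e \<notin> T \<Longrightarrow> f T = 0"
    "\<And>T. e \<notin> T \<Longrightarrow> kd I \<theta> g T - kd I \<theta> f T \<in> N"
  proof (cases t)
    case 0
    then show ?thesis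
      using that[of 0] src.kch_zero src.kd_kch0 g(1)
      by (simp add: kd_zero csub_0[OF src.N_sub] zero_fun_def)
  next
    case (Suc t')
    have "P (kd I \<theta> g) T \<in> N'" for T
    proof -
      from csub_congD[OF tgt.N_sub tgt.kd_cong_null[OF g(2)] z'(2)]
      have "kd (I - {e}) \<theta>' (P g) T \<in> N'" .
      from csub_congD[OF tgt.N_sub P_kd[OF g(1)] this] show ?thesis .
    qed
    from correct_base[OF src.kd_kch[OF g(1)[unfolded Suc]] this] that Suc show ?thesis by blast
  qed
  have "kd I \<theta> (g - f) T \<in> N" for T
    by (rule cycle_from_base[OF src.kch_diff[OF g(1) f(1)]]) (simp add: kd_diff f(3))
  then have "g - f \<in> kcyc I \<theta> A N t s" using src.kch_diff[OF g(1) f(1)] by (simp add: kcyc_def)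
  moreover have "z' - P (g - f) \<in> kbd (I - {e}) \<theta>' A' N' t s"
  proof -
    have eq: "P (g - f) T = P g T" for T using f(2) by (simp add: P_def fun_diff_apply)
    have "z' T - P (g - f) T \<in> N'" for T
      using csub_uminus[OF tgt.N_sub g(2)[of T]] by (simp add: eq)
    then show ?thesis
      using tgt.kch_diff[OF z'(1) P_kch[OF src.kch_diff[OF g(1) f(1)]]]
      by (auto simp: kbd_def fun_diff_apply kd_zero intro!: bexI[of _ 0] tgt.kch_zero)
  qed
  ultimately show "\<exists>z\<in>kcyc I \<theta> A N t s. z' - P z \<in> kbd (I - {e}) \<theta>' A' N' t s" by blast
qed

end

text \<open>An increasing renumbering preserves the position of each index in a set, hence all signs
  of the differential. \<open>Q\<close> pulls chains back along the renumbering, \<open>R\<close>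
  along its inverse.\<close>

lemma kdim_reindex:
  assumes src: "koszul I \<theta> A N" and tgt: "koszul (\<sigma> ` I) \<theta>' A N"
    and mono: "strict_mono_on I \<sigma>" and \<theta>: "\<And>i. i \<in> I \<Longrightarrow> \<theta>' (\<sigma> i) = \<theta> i"
    and d: "kdim I \<theta> A N t s d"
  shows "kdim (\<sigma> ` I) \<theta>' A N t s d"
proof -
  interpret src: koszul I \<theta> A N by (rule src)
  interpret tgt: koszul "\<sigma> ` I" \<theta>' A N by (rule tgt)
  have inj: "inj_on \<sigma> I" by (rule strict_mono_on_imp_inj_on[OF mono])
  define Q :: "(nat set \<Rightarrow> 'a cpoly) \<Rightarrow> nat set \<Rightarrow> 'a cpoly"
    where "Q f = (\<lambda>T. if T \<subseteq> I then f (\<sigma> ` T) else 0)" for f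
  have sub: "\<sigma> ` T \<subseteq> \<sigma> ` I \<and> card (\<sigma> ` T) = card T" if "T \<subseteq> I" for T
    using that inj card_image inj_on_subset by blast
  have Q_kch: "Q f \<in> kch I A t u" if "f \<in> kch (\<sigma> ` I) A t u" for f t u
    using sub that by (intro kchI) (auto simp: Q_def kch_0 intro!: kchD)
  have Q_kd: "kd I \<theta> (Q f) T = kd (\<sigma> ` I) \<theta>' f (\<sigma> ` T)" if T: "T \<subseteq> I" for f T
  proof -
    have im: "\<sigma> ` I - \<sigma> ` T = \<sigma> ` (I - T)" using inj T by (auto simp: inj_on_def)
    have "ksg (\<sigma> i) (\<sigma> ` T) = (ksg i T :: 'a cpoly)" if "i \<in> I" for i
    proof -
      have "{j \<in> insert (\<sigma> i) (\<sigma> ` T). j \<le> \<sigma> i} = \<sigma> ` {j \<in> insert i T. j \<le> i}"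
        using that T strict_mono_on_less_eq[OF mono] by auto
      moreover have "card (\<sigma> ` {j \<in> insert i T. j \<le> i}) = card {j \<in> insert i T. j \<le> i}"
        using that T by (intro card_image inj_on_subset[OF inj]) auto
      ultimately show ?thesis by (simp add: ksg_def)
    qed
    then show ?thesis
      unfolding kd_def im using T
      by (subst sum.reindex) (auto intro!: sum.cong inj_on_subset[OF inj] simp: Q_def \<theta>)
  qed
  have Q_kd0: "kd I \<theta> (Q f) T = 0" if "\<not> T \<subseteq> I" for f T
    using that by (auto simp: kd_def Q_def)
  define R :: "(nat set \<Rightarrow> 'a cpoly) \<Rightarrow> nat set \<Rightarrow> 'a cpoly"
    where "R f = (\<lambda>T. if T \<subseteq> \<sigma> ` I then f (I \<inter> \<sigma> -` T) else 0)" for f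
  have QR: "I \<inter> \<sigma> -` (\<sigma> ` T) = T" if "T \<subseteq> I" for T using that inj by (auto simp: inj_on_def)
  have RQ: "\<sigma> ` (I \<inter> \<sigma> -` T) = T" if "T \<subseteq> \<sigma> ` I" for T using that by auto
  have card_R: "card (I \<inter> \<sigma> -` T) = card T" if "T \<subseteq> \<sigma> ` I" for T
    using sub[of "I \<inter> \<sigma> -` T"] RQ[OF that] by simp
  have R_kch: "R f \<in> kch (\<sigma> ` I) A t u" if "f \<in> kch I A t u" for f t u
    using that card_R by (intro kchI) (auto simp: R_def intro!: kchD kch_0)
  have QR_id: "Q (R f) = f" if "f \<in> kch I A t u" for f t u
  proof
    fix T show "Q (R f) T = f T"
      using kch_0[OF that, of T] QR[of T] by (auto simp: Q_def R_def)
  qed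
  have kd_null_iff: "(\<forall>T. kd I \<theta> (Q f) T \<in> N) \<longleftrightarrow> (\<forall>T. kd (\<sigma> ` I) \<theta>' f T \<in> N)"
    if f: "f \<in> kch (\<sigma> ` I) A t u" for f t u
  proof -
    have "kd (\<sigma> ` I) \<theta>' f T = 0" if "\<not> T \<subseteq> \<sigma> ` I" for T
      by (rule kd_outside_I[OF f that])
    then show ?thesis
      using Q_kd Q_kd0 csub_0[OF src.N_sub] RQ by (metis Int_lower1)
  qed
  show ?thesis
    unfolding kdim_def
  proof (rule qdim_lift[where \<phi> = Q and sc = fsc and sc' = fsc,
      OF vector_space_fsc vector_space_fsc tgt.kbd_sub src.kbd_sub tgt.kcyc_sub
        _ _ _ _ _ d[unfolded kdim_def]])
    show "Q (x + y) = Q x + Q y" for x y by (auto simp: Q_def plus_fun_def)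
    show "Q (fsc c x) = fsc c (Q x)" for c x by (auto simp: Q_def fsc_def)
    show "Q z \<in> kcyc I \<theta> A N t s" if "z \<in> kcyc (\<sigma> ` I) \<theta>' A N t s" for z
    proof -
      have z: "z \<in> kch (\<sigma> ` I) A t (Suc s)" using that by (simp add: kcyc_def)
      show ?thesis using that kd_null_iff[OF z] Q_kch[OF z] by (simp add: kcyc_def)
    qed
    show "Q z \<in> kbd I \<theta> A N t s \<longleftrightarrow> z \<in> kbd (\<sigma> ` I) \<theta>' A N t s"
      if "z \<in> kcyc (\<sigma> ` I) \<theta>' A N t s" for z
    proof -
      have z: "z \<in> kch (\<sigma> ` I) A t (Suc s)" using that by (simp add: kcyc_def)
      have *: "(\<forall>T. Q z T - kd I \<theta> (Q g) T \<in> N) \<longleftrightarrow> (\<forall>T. z T - kd (\<sigma> ` I) \<theta>' g T \<in> N)"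
        if g: "g \<in> kch (\<sigma> ` I) A (Suc t) s" for g
      proof -
        have "kd (\<sigma> ` I) \<theta>' g T = 0 \<and> z T = 0" if "\<not> T \<subseteq> \<sigma> ` I" for T
          using that by (auto simp: kd_outside_I[OF g] intro!: kch_0[OF z])
        moreover have "Q z T - kd I \<theta> (Q g) T = z (\<sigma> ` T) - kd (\<sigma> ` I) \<theta>' g (\<sigma> ` T)"
          if "T \<subseteq> I" for T using that by (simp add: Q_kd) (simp add: Q_def)
        moreover have "Q z T - kd I \<theta> (Q g) T = 0" if "\<not> T \<subseteq> I" for T
          using that by (simp add: Q_kd0) (simp add: Q_def)
        ultimately show ?thesis
          using csub_0[OF src.N_sub] RQ by (metis Int_lower1 diff_zero)
      qed
      show ?thesis
      proof
        assume "Q z \<in> kbd I \<theta> A N t s"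
        then obtain g where g: "g \<in> kch I A (Suc t) s" "\<forall>T. Q z T - kd I \<theta> g T \<in> N"
          by (auto simp: kbd_def)
        then show "z \<in> kbd (\<sigma> ` I) \<theta>' A N t s"
          using *[OF R_kch[OF g(1)]] R_kch[OF g(1)] z by (auto simp: kbd_def QR_id[OF g(1)])
      next
        assume "z \<in> kbd (\<sigma> ` I) \<theta>' A N t s"
        then obtain g where g: "g \<in> kch (\<sigma> ` I) A (Suc t) s" "\<forall>T. z T - kd (\<sigma> ` I) \<theta>' g T \<in> N"
          by (auto simp: kbd_def)
        then show "Q z \<in> kbd I \<theta> A N t s"
          using *[OF g(1)] Q_kch[OF g(1)] Q_kch[OF z] by (auto simp: kbd_def)
      qed
    qed
    show "\<exists>z\<in>kcyc (\<sigma> ` I) \<theta>' A N t s. z' - Q z \<in> kbd I \<theta> A N t s" if "z' \<in> kcyc I \<theta> A N t s" for z'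
    proof (rule bexI)
      have z': "z' \<in> kch I A t (Suc s)" using that by (simp add: kcyc_def)
      have "0 \<in> kbd I \<theta> A N t s"
        using src.kch_zero csub_0[OF src.N_sub]
        by (auto simp: kbd_def kd_zero intro!: bexI[of _ 0])
      then show "z' - Q (R z') \<in> kbd I \<theta> A N t s" by (simp add: QR_id[OF z'])
      show "R z' \<in> kcyc (\<sigma> ` I) \<theta>' A N t s"
        using that kd_null_iff[OF R_kch[OF z']] R_kch[OF z'] by (simp add: kcyc_def QR_id[OF z'])
    qed
  qed
qed

section \<open>Polynomials and Stanley--Reisner ideals\<close>

lemma lookup_cst_mult [simp]: "lookup (cst c * p) m = c * lookup p m"
  unfolding cst_def mult_map_scale_conv_mult[symmetric] by transfer (simp add: when_def)

lemma cpoly_eq_sum: "(p :: 'v cpoly) = (\<Sum>m\<in>keys p. single m (lookup p m))"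
  by (rule poly_mapping_eqI)
    (simp add: lookup_sum lookup_single when_def in_keys_iff)

text \<open>The monomial case may use \<open>m \<in> keys p\<close>, so facts about the support of
  the given polynomial enter the induction without being carried along.\<close>

lemma cpoly_sum_induct [case_names single zero add]:
  fixes p :: "'v cpoly"
  assumes "\<And>m c. m \<in> keys p \<Longrightarrow> P (single m c)"
    and "P 0" "\<And>p q. P p \<Longrightarrow> P q \<Longrightarrow> P (p + q)"
  shows "P p"
proof -
  have "P (\<Sum>m\<in>M. single m (lookup p m))"
    if "finite M" "M \<subseteq> keys p" for M
    using that by (induction M) (auto intro: assms)
  from this[of "keys p"] show ?thesis using cpoly_eq_sum[of p] by simp
qed

definition mdeg :: "('v \<Rightarrow>\<^sub>0 nat) \<Rightarrow> nat"
  where "mdeg m = (\<Sum>v\<in>keys m. lookup m v)"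

lemma mdeg_add: "mdeg (a + b) = mdeg a + mdeg b"
  unfolding mdeg_def by (rule setsum_keys_plus_distrib) auto

lemma mdeg_single [simp]: "mdeg (single v k) = k"
  by (simp add: mdeg_def)

lemma mdeg_0 [simp]: "mdeg 0 = 0"
  by (simp add: mdeg_def)

lemma mdeg_eq_0: "mdeg m = 0 \<Longrightarrow> m = 0"
  by (rule poly_mapping_eqI) (auto simp: mdeg_def in_keys_iff)

lemma homogeneous_mdeg: "homogeneous s p \<longleftrightarrow> (\<forall>m\<in>keys p. mdeg m = s)"
  by (simp add: homogeneous_def mdeg_def)

lemma keys_add_nat: "keys (a + b) = keys a \<union> keys b"
  for a b :: "'v \<Rightarrow>\<^sub>0 nat"
  by (auto simp: in_keys_iff lookup_add)

lemma monomial_split: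
  assumes "v \<in> keys m"
  obtains m' where "m = single v (1::nat) + m'"
    "keys m = insert v (keys m')" "mdeg m = Suc (mdeg m')"
proof
  have "lookup m v \<noteq> 0" using assms by (simp add: in_keys_iff)
  then show eq: "m = single v 1 + (m - single v 1)"
    by (intro poly_mapping_eqI) (auto simp: lookup_add lookup_minus lookup_single when_def)
  show "keys m = insert v (keys (m - single v 1))"
    by (subst eq, subst keys_add_nat) simp
  show "mdeg m = Suc (mdeg (m - single v 1))"
    by (subst eq, subst mdeg_add) simp
qed

lemma pvar_mult_single: "pvar v * single m c = single (single v 1 + m) c"
  by (simp add: pvar_def mult_single)

lemma monomial_induct [consumes 1, case_names const mult]:
  assumes "keys m \<subseteq> V"
    and "\<And>c. P 0 (cst c)"
    and "\<And>m c v. v \<in> V \<Longrightarrow> keys m \<subseteq> V \<Longrightarrow> P (mdeg m) (single m c) \<Longrightarrow>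
      P (Suc (mdeg m)) (pvar v * single m c)"
  shows "P (mdeg m) (single m c)"
  using assms(1)
proof (induction "mdeg m" arbitrary: m)
  case 0
  then have "m = 0" by (simp add: mdeg_eq_0)
  then show ?case using assms(2) by (simp add: cst_def)
next
  case (Suc d)
  then obtain v where v: "v \<in> keys m" by (force simp: mdeg_def)
  from monomial_split[OF this] obtain m' where m': "m = single v 1 + m'"
    "keys m = insert v (keys m')" "mdeg m = Suc (mdeg m')" .
  then show ?case using Suc assms(3)[of v m' c] by (simp add: pvar_mult_single)
qed

definition hp :: "'v set \<Rightarrow> nat \<Rightarrow> 'v cpoly set"
  where "hp V s = {p \<in> poly_ring V. homogeneous s p}"

lemma hp_iff: "p \<in> hp V s \<longleftrightarrow> (\<forall>m\<in>keys p. keys m \<subseteq> V \<and> mdeg m = s)"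
  by (auto simp: hp_def poly_ring_def homogeneous_mdeg)

lemma poly_ring_cst: "cst c \<in> poly_ring V"
  by (simp add: poly_ring_def cst_def)

lemma poly_ring_pvar: "v \<in> V \<Longrightarrow> pvar v \<in> poly_ring V"
  by (simp add: poly_ring_def pvar_def)

lemma poly_ring_0: "0 \<in> poly_ring V"
  by (simp add: poly_ring_def)

lemma poly_ring_add: "p \<in> poly_ring V \<Longrightarrow> q \<in> poly_ring V \<Longrightarrow> p + q \<in> poly_ring V"
  unfolding poly_ring_def using keys_add[of p q] by blast

lemma poly_ring_mult: "p \<in> poly_ring V \<Longrightarrow> q \<in> poly_ring V \<Longrightarrow> p * q \<in> poly_ring V"
  unfolding poly_ring_def by (force dest!: subsetD[OF keys_mult] simp: keys_add_nat)

lemma csub_poly_ring: "csub (poly_ring V)"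
  by (auto simp: csub_def poly_ring_0 poly_ring_cst intro: poly_ring_add poly_ring_mult)

lemma poly_ring_mono: "p \<in> poly_ring V \<Longrightarrow> V \<subseteq> W \<Longrightarrow> p \<in> poly_ring W"
  by (auto simp: poly_ring_def)

lemma poly_ring_power: "p \<in> poly_ring V \<Longrightarrow> p ^ n \<in> poly_ring V"
  by (induction n) (auto intro: poly_ring_mult poly_ring_cst[of 1, simplified])

lemma hp_poly_ring: "p \<in> hp V s \<Longrightarrow> p \<in> poly_ring V"
  by (simp add: hp_def)

lemma hp_mono: "p \<in> hp V s \<Longrightarrow> V \<subseteq> W \<Longrightarrow> p \<in> hp W s"
  by (auto simp: hp_iff)

lemma keys_cst_mult: "keys (cst c * p) \<subseteq> keys p"
  by (auto simp: in_keys_iff)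

lemma csub_hp: "csub (hp V s)"
  unfolding csub_def hp_iff Ball_def mem_Collect_eq hp_iff
  by (auto dest!: subsetD[OF keys_add] subsetD[OF keys_cst_mult] simp: hp_iff)

lemma hp_mult: "p \<in> hp V s \<Longrightarrow> q \<in> hp V t \<Longrightarrow> p * q \<in> hp V (s + t)"
  unfolding hp_iff by (force dest!: subsetD[OF keys_mult] simp: keys_add_nat mdeg_add)

lemma hp_pvar: "v \<in> V \<Longrightarrow> pvar v \<in> hp V 1"
  by (simp add: hp_iff pvar_def)

lemma hp_cst: "cst c \<in> hp V 0"
  by (simp add: hp_iff cst_def)

lemma hp_pvar_mult: "v \<in> V \<Longrightarrow> p \<in> hp V s \<Longrightarrow> pvar v * p \<in> hp V (Suc s)"
  using hp_mult[OF hp_pvar] by fastforce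

lemma hp_pvar_power: "v \<in> V \<Longrightarrow> pvar v ^ n \<in> hp V n"
  using hp_cst[of 1 V] by (induction n) (auto intro: hp_pvar_mult)

lemma hp_induct [consumes 1, case_names const zero add mult]:
  assumes "p \<in> hp V s"
    and "\<And>c. P 0 (cst c)" "\<And>s. P s 0"
    and "\<And>s p q. P s p \<Longrightarrow> P s q \<Longrightarrow> P s (p + q)"
    and "\<And>s p v. v \<in> V \<Longrightarrow> p \<in> hp V s \<Longrightarrow> P s p \<Longrightarrow> P (Suc s) (pvar v * p)"
  shows "P s p"
proof (induction p rule: cpoly_sum_induct)
  case (single m c)
  then have m: "keys m \<subseteq> V" "mdeg m = s" using assms(1) by (auto simp: hp_iff)
  have "P (mdeg m) (single m c)"
    by (rule monomial_induct[OF m(1)]) (auto intro!: assms(2,5) simp: hp_iff)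
  then show ?case using m by simp
qed (auto intro: assms)

lemma poly_ring_induct [consumes 1, case_names const add mult]:
  assumes "p \<in> poly_ring V"
    and "\<And>c. P (cst c)"
    and "\<And>p q. P p \<Longrightarrow> P q \<Longrightarrow> P (p + q)"
    and "\<And>p v. v \<in> V \<Longrightarrow> p \<in> poly_ring V \<Longrightarrow> P p \<Longrightarrow> P (pvar v * p)"
  shows "P p"
proof (induction p rule: cpoly_sum_induct)
  case (single m c)
  then have m: "keys m \<subseteq> V" using assms(1) by (auto simp: poly_ring_def)
  show ?case
    by (rule monomial_induct[where P = "\<lambda>_. P", OF m])
      (auto intro!: assms(2,4) simp: poly_ring_def)
qed (use assms(2)[of 0] assms(3) in auto)

section \<open>Substitution homomorphisms and the supports of their values\<close>

definition monv :: "('v \<Rightarrow> 'w cpoly) \<Rightarrow> ('v \<Rightarrow>\<^sub>0 nat) \<Rightarrow> 'w cpoly"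
  where "monv \<sigma> m = (\<Prod>v\<in>keys m. \<sigma> v ^ lookup m v)"

definition psubst :: "('v \<Rightarrow> 'w cpoly) \<Rightarrow> 'v cpoly \<Rightarrow> 'w cpoly"
  where "psubst \<sigma> p = (\<Sum>m\<in>keys p. cst (lookup p m) * monv \<sigma> m)"

lemma monv_add: "monv \<sigma> (a + b) = monv \<sigma> a * monv \<sigma> b"
proof -
  have "monv \<sigma> m = (\<Prod>v\<in>K. \<sigma> v ^ lookup m v)"
    if "finite K" "keys m \<subseteq> K" for m K
    unfolding monv_def using that by (intro prod.mono_neutral_left) (auto simp: in_keys_iff)
  from this[of "keys (a + b)"] show ?thesis
    by (simp add: keys_add_nat lookup_add power_add prod.distrib)
qed

lemma psubst_add: "psubst \<sigma> (p + q) = psubst \<sigma> p + psubst \<sigma> q"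
  unfolding psubst_def by (rule setsum_keys_plus_distrib) (auto simp: cst_add algebra_simps)

lemma psubst_single: "psubst \<sigma> (single m c) = cst c * monv \<sigma> m"
  by (simp add: psubst_def)

lemma psubst_0 [simp]: "psubst \<sigma> 0 = 0"
  by (simp add: psubst_def)

lemma psubst_cst [simp]: "psubst \<sigma> (cst c) = cst c"
  unfolding cst_def[of c] psubst_single by (simp add: monv_def cst_def)

lemma psubst_pvar [simp]: "psubst \<sigma> (pvar v) = \<sigma> v"
  by (simp add: pvar_def psubst_single monv_def)

lemma psubst_mult: "psubst \<sigma> (p * q) = psubst \<sigma> p * psubst \<sigma> q"
proof (induction p rule: cpoly_sum_induct)
  case (single m c)
  show ?case
    by (induction q rule: cpoly_sum_induct)
      (simp_all add: mult_single psubst_single monv_add cst_mult psubst_add algebra_simps)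
qed (simp_all add: psubst_add distrib_right)

lemma psubst_diff: "psubst \<sigma> (p - q) = psubst \<sigma> p - psubst \<sigma> q"
  using psubst_add[of \<sigma> "p - q" q] by simp

lemma psubst_1 [simp]: "psubst \<sigma> 1 = 1"
  using psubst_cst[of \<sigma> 1] by simp

lemma psubst_sum: "psubst \<sigma> (\<Sum>i\<in>I. f i) = (\<Sum>i\<in>I. psubst \<sigma> (f i))"
  by (induction I rule: infinite_finite_induct) (simp_all add: psubst_add)

lemma psubst_prod: "psubst \<sigma> (\<Prod>i\<in>I. f i) = (\<Prod>i\<in>I. psubst \<sigma> (f i))"
  by (induction I rule: infinite_finite_induct) (simp_all add: psubst_mult)

lemma psubst_power: "psubst \<sigma> (p ^ n) = psubst \<sigma> p ^ n"
  by (induction n) (simp_all add: psubst_mult)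

lemma psubst_id:
  assumes "p \<in> poly_ring V" "\<And>v. v \<in> V \<Longrightarrow> \<sigma> v = pvar v"
  shows "psubst \<sigma> p = p"
  using assms(1) by (induction p rule: poly_ring_induct) (auto simp: psubst_add psubst_mult assms(2))

lemma psubst_psubst: "psubst \<tau> (psubst \<sigma> p) = psubst (\<lambda>v. psubst \<tau> (\<sigma> v)) p"
proof -
  have "p \<in> poly_ring UNIV" by (simp add: poly_ring_def)
  then show ?thesis by (induction p rule: poly_ring_induct) (auto simp: psubst_add psubst_mult)
qed

lemma psubst_poly_ring:
  assumes "p \<in> poly_ring V" "\<And>v. v \<in> V \<Longrightarrow> \<sigma> v \<in> poly_ring W"
  shows "psubst \<sigma> p \<in> poly_ring W"
  using assms(1)
  by (induction p rule: poly_ring_induct)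
    (auto simp: psubst_add psubst_mult poly_ring_cst intro: poly_ring_add poly_ring_mult assms(2))

lemma psubst_hp:
  assumes "p \<in> hp V s" "\<And>v. v \<in> V \<Longrightarrow> \<sigma> v \<in> hp W 1"
  shows "psubst \<sigma> p \<in> hp W s"
  using assms(1)
proof (induction p rule: hp_induct)
  case (mult s p v)
  then show ?case using hp_mult[OF assms(2)] by (fastforce simp: psubst_mult)
qed (auto simp: psubst_add hp_cst intro: csub_add[OF csub_hp] csub_0[OF csub_hp])

text \<open>\<open>R A B\<close> stands for: a monomial with support \<open>A\<close> can produce
  one with support \<open>B\<close>. Membership in a Stanley--Reisner ideal depends on supports
  only, so a relation stable under multiplication by one variable is all that has to be
  supplied.\<close>

lemma keys_psubst:
  assumes R: "R {} {}" "\<And>A B v l. R A B \<Longrightarrow> v \<in> V \<Longrightarrow> l \<in> keys (\<sigma> v) \<Longrightarrow>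
      R (insert v A) (B \<union> keys l)"
    and p: "p \<in> poly_ring V" and k: "k \<in> keys (psubst \<sigma> p)"
  shows "\<exists>m\<in>keys p. R (keys m) (keys k)"
proof -
  have mon: "\<forall>k\<in>keys (psubst \<sigma> (single m c)).
      R (keys m) (keys k)" if "keys m \<subseteq> V" for m c
    using that
  proof (induction "mdeg m" arbitrary: m)
    case 0
    then have "m = 0" by (simp add: mdeg_eq_0)
    then have "psubst \<sigma> (single m c) = cst c" by (simp flip: cst_def)
    then show ?case using \<open>m = 0\<close> R(1) by (auto simp: cst_def split: if_splits)
  next
    case (Suc d)
    then obtain v where v: "v \<in> keys m" by (force simp: mdeg_def)
    from monomial_split[OF this] obtain m' where m': "m = single v 1 + m'"
      "keys m = insert v (keys m')" "mdeg m = Suc (mdeg m')" .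
    have eq: "psubst \<sigma> (single m c) = \<sigma> v * psubst \<sigma> (single m' c)"
      by (simp only: m'(1) pvar_mult_single[symmetric] psubst_mult psubst_pvar)
    show ?case
    proof
      fix k assume "k \<in> keys (psubst \<sigma> (single m c))"
      then obtain l k' where k: "k = l + k'" "l \<in> keys (\<sigma> v)"
        "k' \<in> keys (psubst \<sigma> (single m' c))"
        unfolding eq using keys_mult by blast
      have "R (keys m') (keys k')"
        using Suc(1)[of m'] Suc(2,3) m'(2,3) k(3) by auto
      from R(2)[OF this _ k(2)] show "R (keys m) (keys k)"
        using m'(2) Suc(3) by (simp add: k(1) keys_add_nat Un_commute)
    qed
  qed
  have "psubst \<sigma> p = (\<Sum>m\<in>keys p. psubst \<sigma> (single m (lookup p m)))"
    by (subst (1) cpoly_eq_sum[of p]) (simp add: psubst_sum)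
  then obtain m where "m \<in> keys p"
    "k \<in> keys (psubst \<sigma> (single m (lookup p m)))"
    using k keys_sum[of "\<lambda>m. psubst \<sigma> (single m (lookup p m))" "keys p"]
    by auto
  then show ?thesis using mon[of m "lookup p m"] p by (auto simp: poly_ring_def)
qed

text \<open>For a simplicial complex \<Delta>, the span of the monomials whose support is not a
  face. No set of variables is fixed here; it enters through the graded pieces.\<close>

definition sr_ideal :: "'v set set \<Rightarrow> 'v cpoly set"
  where "sr_ideal \<Delta> = {p. \<forall>m\<in>keys p. keys m \<notin> \<Delta>}"

definition down :: "'v set set \<Rightarrow> bool"
  where "down \<Delta> \<longleftrightarrow> (\<forall>A\<in>\<Delta>. \<forall>B\<subseteq>A. B \<in> \<Delta>)"

lemma downD: "down \<Delta> \<Longrightarrow> A \<in> \<Delta> \<Longrightarrow> B \<subseteq> A \<Longrightarrow> B \<in> \<Delta>"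
  by (auto simp: down_def)

lemma csub_sr_ideal: "csub (sr_ideal \<Delta>)"
  unfolding csub_def sr_ideal_def by (auto dest: subsetD[OF keys_add] subsetD[OF keys_cst_mult])

lemma sr_ideal_mult:
  assumes "down \<Delta>" "p \<in> sr_ideal \<Delta>"
  shows "q * p \<in> sr_ideal \<Delta>"
  unfolding sr_ideal_def
proof safe
  fix m assume "m \<in> keys (q * p)" and m: "keys m \<in> \<Delta>"
  then obtain a b where "m = a + b" "b \<in> keys p" using keys_mult by blast
  with downD[OF assms(1) m, of "keys b"] assms(2) show False
    by (auto simp: keys_add_nat sr_ideal_def)
qed

lemma keys_prod_pvar:
  assumes "finite F" "k \<in> keys (\<Prod>v\<in>F. pvar v)"
  shows "keys k = F"
  using assms
proof (induction F arbitrary: k)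
  case (insert v F)
  then have "k \<in> keys (pvar v * (\<Prod>v\<in>F. pvar v))" by simp
  then obtain l where "k = single v 1 + l" "l \<in> keys (\<Prod>v\<in>F. pvar v)"
    using keys_mult[of "pvar v" "\<Prod>v\<in>F. pvar v"] by (auto simp: pvar_def)
  then show ?case using insert.IH by (simp add: keys_add_nat)
qed simp

lemma prod_pvar_sr_ideal: "finite F \<Longrightarrow> F \<notin> \<Delta> \<Longrightarrow> (\<Prod>v\<in>F. pvar v) \<in> sr_ideal \<Delta>"
  using keys_prod_pvar by (auto simp: sr_ideal_def)

lemma psubst_sr_ideal:
  assumes R: "R {} {}" "\<And>A B v l. R A B \<Longrightarrow> v \<in> V \<Longrightarrow> l \<in> keys (\<sigma> v) \<Longrightarrow>
      R (insert v A) (B \<union> keys l)"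
    and \<Delta>: "\<And>A B. R A B \<Longrightarrow> A \<subseteq> V \<Longrightarrow> B \<in> \<Delta>' \<Longrightarrow> A \<in> \<Delta>"
    and p: "p \<in> poly_ring V" "p \<in> sr_ideal \<Delta>"
  shows "psubst \<sigma> p \<in> sr_ideal \<Delta>'"
  unfolding sr_ideal_def
proof safe
  fix k assume "k \<in> keys (psubst \<sigma> p)" and k: "keys k \<in> \<Delta>'"
  from keys_psubst[of R, OF R p(1) this(1)] obtain m where
    m: "m \<in> keys p" "R (keys m) (keys k)" by blast
  moreover have "keys m \<subseteq> V" using m(1) p(1) by (simp add: poly_ring_def)
  ultimately have "keys m \<in> \<Delta>" using \<Delta> k by blast
  then show False using m p(2) by (auto simp: sr_ideal_def)
qed

text \<open>The pieces of \<open>\<complex>[V](-j)\<close>, with the index shifted by one as explained above.\<close>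

definition pieces :: "'v set \<Rightarrow> nat \<Rightarrow> nat \<Rightarrow> 'v cpoly set"
  where "pieces V j u = (if u \<le> j then {0} else hp V (u - Suc j))"

lemma pieces_0 [simp]: "pieces V j 0 = {0}"
  by (simp add: pieces_def)

lemma pieces_Suc: "pieces V 0 (Suc s) = hp V s"
  by (simp add: pieces_def)

lemma csub_pieces: "csub (pieces V j u)"
  using csub_hp[of V "u - Suc j"] by (simp add: pieces_def) (simp add: csub_def)

lemma pieces_mult:
  assumes "p \<in> hp V 1" "q \<in> pieces V j u"
  shows "p * q \<in> pieces V j (Suc u)"
proof (cases "u \<le> j")
  case True
  then have "q = 0" using assms(2) by (simp add: pieces_def)
  then show ?thesis using csub_0[OF csub_pieces, of V j "Suc u"] by simp
next
  case False
  then have "Suc (u - Suc j) = Suc u - Suc j" by simp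
  then show ?thesis using False hp_mult[OF assms(1), of q "u - Suc j"] assms(2) by (simp add: pieces_def)
qed

lemma pieces_poly_ring: "p \<in> pieces V j u \<Longrightarrow> p \<in> poly_ring V"
  by (auto simp: pieces_def poly_ring_0 hp_poly_ring split: if_splits)

lemma koszul_sr:
  assumes "finite I" "\<And>i. i \<in> I \<Longrightarrow> \<theta> i \<in> hp V 1" "down \<Delta>"
  shows "koszul I \<theta> (pieces V j) (sr_ideal \<Delta>)"
proof
  show "finite I" by (rule assms(1))
  show "csub (pieces V j u)" for u by (rule csub_pieces)
  show "csub (sr_ideal \<Delta>)" by (rule csub_sr_ideal)
  show "\<theta> i * a \<in> pieces V j (Suc u)" if "i \<in> I" "a \<in> pieces V j u" for i a u
    by (rule pieces_mult[OF assms(2)[OF that(1)] that(2)])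
  show "\<theta> i * a \<in> sr_ideal \<Delta>" if "i \<in> I" "a \<in> sr_ideal \<Delta>" for i a
    by (rule sr_ideal_mult[OF assms(3) that(2)])
qed

abbreviation sr_dim where
  "sr_dim I \<theta> V \<Delta> t s d \<equiv> kdim I \<theta> (pieces V 0) (sr_ideal \<Delta>) t s d"

lemma sr_dim_shift:
  assumes "\<And>s. sr_dim I \<theta> V \<Delta> t s (d s)" and K: "koszul I \<theta> (pieces V j) (sr_ideal \<Delta>)"
  shows "kdim I \<theta> (pieces V j) (sr_ideal \<Delta>) t s (if j \<le> s then d (s - j) else 0)"
proof (cases "j \<le> s")
  case True
  have "pieces V j (Suc s) = pieces V 0 (Suc (s - j))"
    using True by (simp add: pieces_def)
  \<comment> \<open>Boundaries come from one degree lower; for \<open>s = j\<close> that piece is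
    zero in both gradings.\<close>
  moreover have "pieces V j s = pieces V 0 (s - j)"
  proof (cases "s = j")
    case False
    with True have "\<not> s \<le> j" "\<not> s - j \<le> 0" by auto
    then show ?thesis unfolding pieces_def by simp
  qed (simp add: pieces_def)
  ultimately have "kch I (pieces V j) t' (Suc s) = kch I (pieces V 0) t' (Suc (s - j))"
    "kch I (pieces V j) t' s = kch I (pieces V 0) t' (s - j)" for t'
    by (simp_all only: kch_def)
  then have "kcyc I \<theta> (pieces V j) (sr_ideal \<Delta>) t s = kcyc I \<theta> (pieces V 0) (sr_ideal \<Delta>) t (s - j)"
    "kbd I \<theta> (pieces V j) (sr_ideal \<Delta>) t s = kbd I \<theta> (pieces V 0) (sr_ideal \<Delta>) t (s - j)"
    by (simp_all only: kcyc_def kbd_def)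
  then show ?thesis using assms(1)[of "s - j"] True by (simp add: kdim_def)
next
  case False
  interpret koszul I \<theta> "pieces V j" "sr_ideal \<Delta>" by (rule K)
  have "f = 0" if f: "f \<in> kcyc I \<theta> (pieces V j) (sr_ideal \<Delta>) t s" for f
  proof
    fix T
    have "f \<in> kch I (pieces V j) t (Suc s)" using f by (simp add: kcyc_def)
    from kch_all[OF this, of T] show "f T = 0 T" using False by (simp add: pieces_def zero_fun_def)
  qed
  moreover have "0 \<in> kbd I \<theta> (pieces V j) (sr_ideal \<Delta>) t s"
    by (auto simp: kbd_def kch_zero kd_zero csub_0[OF N_sub] intro!: bexI[of _ 0])
  ultimately have "qfam fsc (kcyc I \<theta> (pieces V j) (sr_ideal \<Delta>) t s)
      (kbd I \<theta> (pieces V j) (sr_ideal \<Delta>) t s) ({} :: nat set) undefined"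
    by (auto simp: qfam_def)
  from kdimI[OF this] show ?thesis using False by simp
qed

section \<open>Stellar subdivisions\<close>

lemma lookup_pvar_mult_0:
  assumes "lookup m y = 0"
  shows "lookup (pvar y * b) m = 0"
proof (rule ccontr)
  assume "lookup (pvar y * b) m \<noteq> 0"
  then have "m \<in> keys (pvar y * b)" by (simp add: in_keys_iff)
  then obtain k where "m = single y 1 + k"
    using keys_mult[of "pvar y" b] by (auto simp: pvar_def)
  then show False using assms by (simp add: lookup_add)
qed

lemma single_mult_eq_sum:
  "single a 1 * p
    = (\<Sum>m\<in>keys p. single (a + m) (lookup p m))"
  for p :: "'v cpoly"
  by (subst cpoly_eq_sum[of p]) (simp add: sum_distrib_left mult_single)

lemma lookup_single_mult: "lookup (single a 1 * p) (a + m) = lookup p m"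
  for p :: "'v cpoly"
  by (simp add: single_mult_eq_sum lookup_sum lookup_single when_def in_keys_iff)

lemma pvar_power: "pvar y ^ n = single (single y n) 1"
  by (induction n) (simp_all add: pvar_def mult_single single_add[symmetric])

lemma poly_ring_lookup_0:
  assumes "p \<in> poly_ring V" "y \<notin> V" "m \<in> keys p"
  shows "lookup m y = 0"
proof -
  have "y \<notin> keys m" using assms by (auto simp: poly_ring_def)
  then show ?thesis by (simp add: in_keys_iff)
qed

lemma pieces_Suc_Suc: "pieces V (Suc j) (Suc u) = pieces V j u"
  by (simp add: pieces_def)

lemma monomial_factor:
  assumes "S \<subseteq> keys m"
  shows "\<exists>h\<in>poly_ring (keys m). single m c = (\<Prod>v\<in>S. pvar v) * h"
  using finite_subset[OF assms finite_keys] assms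
proof (induction S arbitrary: m rule: finite_induct)
  case empty
  show ?case by (intro bexI[of _ "single m c"]) (auto simp: poly_ring_def)
next
  case (insert v S)
  then have "v \<in> keys m" by auto
  from monomial_split[OF this] obtain m' where m': "m = single v 1 + m'"
    "keys m = insert v (keys m')" .
  from insert.prems insert.hyps m'(2) have "S \<subseteq> keys m'" by auto
  from insert.IH[OF this] obtain h where h: "h \<in> poly_ring (keys m')"
    "single m' c = (\<Prod>v\<in>S. pvar v) * h" by blast
  have "single m c = (\<Prod>v\<in>insert v S. pvar v) * h"
    by (simp only: m'(1) pvar_mult_single[symmetric] prod.insert[OF insert.hyps] mult.assoc h(2))
  moreover have "h \<in> poly_ring (keys m)"
    by (rule poly_ring_mono[OF h(1)]) (use m'(2) in auto)
  ultimately show ?case by blast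
qed

definition ydeg_less :: "'v \<Rightarrow> nat \<Rightarrow> 'v cpoly \<Rightarrow> bool"
  where "ydeg_less y k p \<longleftrightarrow> (\<forall>m\<in>keys p. lookup m y < k)"

lemma ydeg_less_sum: "(\<And>i. i \<in> I \<Longrightarrow> ydeg_less y k (f i)) \<Longrightarrow> ydeg_less y k (\<Sum>i\<in>I. f i)"
  unfolding ydeg_less_def using keys_sum[of f I] by blast

lemma ydeg_less_power_mult:
  assumes "p \<in> poly_ring V" "y \<notin> V" "j < k"
  shows "ydeg_less y k (pvar y ^ j * p)"
  unfolding ydeg_less_def
proof
  fix m assume "m \<in> keys (pvar y ^ j * p)"
  then obtain l where l: "m = single y j + l" "l \<in> keys p"
    using keys_mult[of "pvar y ^ j" p] by (auto simp: pvar_power)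
  then show "lookup m y < k"
    using assms l poly_ring_lookup_0[OF assms(1,2) l(2)] by (simp add: lookup_add)
qed

text \<open>Compare the terms of top degree in \<open>y\<close>.\<close>

lemma monic_cancel:
  assumes M: "M = cst u * pvar y ^ s + L" "u \<noteq> 0" "ydeg_less y s L"
    and r: "ydeg_less y s r"
    and \<Delta>: "down \<Delta>" "\<And>A. A \<in> \<Delta> \<Longrightarrow> insert y A \<in> \<Delta>"
    and mem: "M * h + r \<in> sr_ideal \<Delta>"
  shows "h \<in> sr_ideal \<Delta>"
proof -
  \<comment> \<open>\<open>h\<close> is split according to whether the support of a monomial is a
    face. The non-face part is null from the outset; the face part \<open>h1\<close> will turn out
    to be 0.\<close>
  define part where "part S = (\<Sum>m\<in>{m \<in> keys h. keys m \<in> S}.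
    single m (lookup h m))" for S
  have lk: "lookup (part S) m = (if keys m \<in> S then lookup h m else 0)"
    for S m
    by (simp add: part_def lookup_sum lookup_single when_def in_keys_iff)
  define h1 where "h1 = part \<Delta>"
  define h2 where "h2 = part (- \<Delta>)"
  have h: "h = h1 + h2"
    by (rule poly_mapping_eqI) (simp only: h1_def h2_def lookup_add lk, simp)
  have h2: "h2 \<in> sr_ideal \<Delta>"
    by (auto simp: sr_ideal_def h2_def in_keys_iff lk split: if_splits)
  have h1: "keys m \<in> \<Delta>" if "m \<in> keys h1" for m
    using that by (auto simp: h1_def in_keys_iff lk split: if_splits)
  have mem1: "M * h1 + r \<in> sr_ideal \<Delta>"
    using csub_diff[OF csub_sr_ideal mem sr_ideal_mult[OF \<Delta>(1) h2, of M]]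
    by (simp add: h algebra_simps)
  have "h1 = 0"
  proof (rule ccontr)
    assume "h1 \<noteq> 0"
    then have ne: "keys h1 \<noteq> {}" by (metis poly_mapping_eqI in_keys_iff lookup_zero empty_iff)
    define k where "k = Max ((\<lambda>m. lookup m y) ` keys h1)"
    have "k \<in> (\<lambda>m. lookup m y) ` keys h1"
      unfolding k_def using ne by (intro Max_in) auto
    then obtain m where m: "m \<in> keys h1" "lookup m y = k" by blast
    have kmax: "lookup l y \<le> k" if "l \<in> keys h1" for l
      unfolding k_def using that by (intro Max_ge) auto
    \<comment> \<open>The product of the leading monomials: neither \<open>L * h1\<close> nor
      \<open>r\<close> has a term of this degree in \<open>y\<close>, and its support is a face
      because \<Delta> is a cone with apex \<open>y\<close>.\<close>
    define n where "n = single y s + m"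
    have ny: "lookup n y = s + k" using m by (simp add: n_def lookup_add)
    have "lookup r n = 0"
    proof (rule ccontr)
      assume "lookup r n \<noteq> 0"
      then have "n \<in> keys r" by (simp add: in_keys_iff)
      then have "lookup n y < s" using r by (simp add: ydeg_less_def)
      then show False using ny by simp
    qed
    moreover have "lookup (L * h1) n = 0"
    proof (rule ccontr)
      assume "lookup (L * h1) n \<noteq> 0"
      then have "n \<in> keys (L * h1)" by (simp add: in_keys_iff)
      then obtain a b where ab: "n = a + b" "a \<in> keys L" "b \<in> keys h1"
        using keys_mult by blast
      then have "lookup a y < s" "lookup b y \<le> k"
        using M(3) kmax by (auto simp: ydeg_less_def)
      then show False using ny ab(1) by (simp add: lookup_add)
    qed
    moreover have "lookup (cst u * pvar y ^ s * h1) n = u * lookup h1 m"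
      by (simp only: mult.assoc lookup_cst_mult pvar_power n_def lookup_single_mult)
    ultimately have "lookup (M * h1 + r) n \<noteq> 0"
      using m(1) M(2) by (simp add: M(1) distrib_right lookup_add in_keys_iff)
    then have "keys n \<notin> \<Delta>" using mem1 by (auto simp: sr_ideal_def in_keys_iff)
    moreover have "keys n \<subseteq> insert y (keys m)"
      by (auto simp: n_def keys_add_nat split: if_splits)
    ultimately show False using h1[OF m(1)] \<Delta> downD by metis
  qed
  then show ?thesis using h h2 by simp
qed

text \<open>Monomials \<open>y^j m\<close> with \<open>m\<close> free of \<open>y\<close> are
  distinct for distinct \<open>j\<close>, so the terms of the sum do not cancel; and in a cone with
  apex \<open>y\<close> the factor \<open>y^j\<close> does not affect whether a support is a
  face.\<close>

lemma sr_ideal_coeffs: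
  assumes q: "\<And>j. j < s \<Longrightarrow> q j \<in> poly_ring V" and y: "y \<notin> V"
    and \<Delta>: "\<And>A. A \<in> \<Delta> \<Longrightarrow> insert y A \<in> \<Delta>"
    and mem: "(\<Sum>j<s. pvar y ^ j * q j) \<in> sr_ideal \<Delta>" and j: "j < s"
  shows "q j \<in> sr_ideal \<Delta>"
  unfolding sr_ideal_def
proof safe
  fix m assume m: "m \<in> keys (q j)" and mD: "keys m \<in> \<Delta>"
  have ym: "lookup m y = 0" by (rule poly_ring_lookup_0[OF q[OF j] y m])
  define n where "n = single y j + m"
  have "lookup (pvar y ^ i * q i) n = (if i = j then lookup (q j) m else 0)"
    if i: "i < s" for i
  proof (cases "i = j")
    case True
    then show ?thesis by (simp add: pvar_power n_def lookup_single_mult)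
  next
    case False
    have "n \<notin> keys (pvar y ^ i * q i)"
    proof
      assume "n \<in> keys (pvar y ^ i * q i)"
      then obtain l where l: "n = single y i + l" "l \<in> keys (q i)"
        using keys_mult[of "pvar y ^ i" "q i"] by (auto simp: pvar_power)
      then have "lookup l y = 0" by (intro poly_ring_lookup_0[OF q[OF i] y])
      moreover have "lookup n y = j" using ym by (simp add: n_def lookup_add)
      ultimately show False using l(1) False by (simp add: lookup_add)
    qed
    then show ?thesis using False by (simp add: in_keys_iff)
  qed
  then have "lookup (\<Sum>i<s. pvar y ^ i * q i) n = lookup (q j) m"
    using j by (simp add: lookup_sum)
  then have "n \<in> keys (\<Sum>i<s. pvar y ^ i * q i)" using m by (simp add: in_keys_iff)
  then have "keys n \<notin> \<Delta>" using mem by (auto simp: sr_ideal_def)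
  moreover have "keys n = (if j = 0 then keys m else insert y (keys m))"
    by (simp add: n_def keys_add_nat)
  ultimately show False using mD \<Delta> by (auto split: if_splits)
qed

text \<open>The map \<phi> is left open for two uses: with the identity to divide by the product,
  and with the stellar substitution to write the relation of \<open>F\<close> over the image of the
  old ring. The degree of \<open>c j\<close> is recorded for the grading.\<close>

lemma expand_prod:
  assumes "finite F"
    and \<phi>: "\<And>p q. \<phi> (p * q) = \<phi> p * \<phi> q" "\<And>p q. \<phi> (p - q) = \<phi> p - \<phi> q" "\<And>c. \<phi> (cst c) = cst c"
  shows "\<exists>c. (\<forall>j<card F. c j \<in> hp F (card F - j)) \<and>
    (\<Prod>v\<in>F. \<phi> (pvar v) - pvar y) = (- 1) ^ card F * pvar y ^ card F + (\<Sum>j<card F. pvar y ^ j * \<phi> (c j))"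
  using assms(1)
proof (induction F)
  case empty
  then show ?case by (intro exI[of _ "\<lambda>_. 0"]) simp
next
  case (insert v F)
  define s where "s = card F"
  from insert.IH obtain c where c: "\<And>j. j < s \<Longrightarrow> c j \<in> hp F (s - j)"
    "(\<Prod>v\<in>F. \<phi> (pvar v) - pvar y) = (- 1) ^ s * pvar y ^ s + (\<Sum>j<s. pvar y ^ j * \<phi> (c j))"
    by (auto simp: s_def)
  have \<phi>0: "\<phi> 0 = 0" using \<phi>(3)[of 0] by simp
  have \<phi>s: "\<phi> ((- 1) ^ s) = (- 1) ^ s" using \<phi>(3)[of "(- 1) ^ s"] by (simp add: cst_power cst_uminus)
  define a where "a j = (if j = s then (- 1) ^ s else c j)" for j
  have a: "a j \<in> hp F (s - j)" if "j < Suc s" for j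
    using that c(1)[of j] csub_sgn[OF csub_hp hp_cst[of 1 F], of s] by (auto simp: a_def less_Suc_eq)
  \<comment> \<open>Coefficients after multiplication by \<open>\<phi> (pvar v) - pvar y\<close>,
    where \<open>a\<close> is the old list with its leading coefficient appended.\<close>
  define c' where "c' j = pvar v * a j - (if j = 0 then 0 else a (j - 1))" for j
  have P: "(\<Prod>v\<in>F. \<phi> (pvar v) - pvar y) = (\<Sum>j<Suc s. pvar y ^ j * \<phi> (a j))"
    by (simp add: c(2) a_def \<phi>s)
  have "c' j \<in> hp (insert v F) (Suc s - j)" if j: "j < Suc s" for j
  proof -
    have 1: "pvar v * a j \<in> hp (insert v F) (Suc (s - j))"
      by (rule hp_pvar_mult) (auto intro: hp_mono[OF a[OF j]])
    have 2: "(if j = 0 then 0 else a (j - 1)) \<in> hp (insert v F) (Suc s - j)"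
    proof (cases j)
      case (Suc i)
      then have "a i \<in> hp F (Suc s - j)" using a[of i] j by simp
      then show ?thesis using Suc by (auto intro: hp_mono)
    qed (simp add: csub_0[OF csub_hp])
    have "Suc s - j = Suc (s - j)" using j by simp
    then show ?thesis using csub_diff[OF csub_hp _ 2] 1 by (simp add: c'_def)
  qed
  moreover have "(\<Prod>v\<in>insert v F. \<phi> (pvar v) - pvar y)
    = (- 1) ^ Suc s * pvar y ^ Suc s + (\<Sum>j<Suc s. pvar y ^ j * \<phi> (c' j))"
  proof -
    have "(\<Prod>v\<in>insert v F. \<phi> (pvar v) - pvar y)
      = (\<Sum>j<Suc s. pvar y ^ j * (\<phi> (pvar v) * \<phi> (a j))) - (\<Sum>j<Suc s. pvar y ^ Suc j * \<phi> (a j))"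
      by (simp only: prod.insert[OF insert.hyps] P left_diff_distrib sum_distrib_left power_Suc
          right_diff_distrib sum_subtractf mult.assoc mult.left_commute mult.commute)
    also have "(\<Sum>j<Suc s. pvar y ^ Suc j * \<phi> (a j))
      = (\<Sum>j<Suc (Suc s). if j = 0 then 0 else pvar y ^ j * \<phi> (a (j - 1)))"
      by (subst (2) sum.lessThan_Suc_shift) simp
    also have "\<dots> = (\<Sum>j<Suc s. pvar y ^ j * \<phi> (if j = 0 then 0 else a (j - 1))) + pvar y ^ Suc s * (- 1) ^ s"
      by (subst sum.lessThan_Suc) (auto simp: \<phi>0 a_def \<phi>s intro!: sum.cong)
    finally show ?thesis
      by (simp add: c'_def \<phi> right_diff_distrib sum_subtractf ac_simps)
  qed
  moreover have "card (insert v F) = Suc s" using insert.hyps by (simp add: s_def)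
  ultimately show ?case by (intro exI[of _ c']) simp
qed

locale stellar =
  fixes V :: "'v set" and y :: 'v and F :: "'v set" and \<Delta> :: "'v set set"
  assumes finV: "finite V" and y: "y \<notin> V" and F: "F \<subseteq> V" "F \<noteq> {}"
    and \<Delta>: "down \<Delta>" "\<And>A. A \<in> \<Delta> \<Longrightarrow> A \<subseteq> V"
begin

definition sd :: "'v set set"
  where "sd = {A. A \<subseteq> insert y V \<and> \<not> F \<subseteq> A \<and> (if y \<in> A then A - {y} \<union> F \<in> \<Delta> else A \<in> \<Delta>)}"

definition star :: "'v set set"
  where "star = {A. A \<union> F \<in> \<Delta>}"

text \<open>The cone with apex \<open>y\<close> over the star: membership ignores \<open>y\<close>,
  so its ideal is that of the star with \<open>y\<close> adjoined as a free variable.\<close>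

definition star_y :: "'v set set"
  where "star_y = {A. A - {y} \<union> F \<in> \<Delta>}"

text \<open>Pullback of piecewise linear functions: the coordinate of an old vertex in
  \<open>F\<close> has value 1 at the new vertex, whose ray is the sum of the rays of
  \<open>F\<close>.\<close>

abbreviation \<phi> :: "'v cpoly \<Rightarrow> 'v cpoly"
  where "\<phi> \<equiv> psubst (\<lambda>v. if v \<in> F then pvar v + pvar y else pvar v)"

abbreviation \<psi> :: "'v cpoly \<Rightarrow> 'v cpoly"
  where "\<psi> \<equiv> psubst (\<lambda>v. if v \<in> F then pvar v - pvar y else pvar v)"

lemma finF: "finite F"
  using finV F finite_subset by blast

lemma yF: "y \<notin> F"
  using y F by blast

lemma card_F: "card F > 0"
  using finF F by (simp add: card_gt_0_iff)

lemma down_sd: "down sd"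
  unfolding down_def
proof (intro ballI allI impI)
  fix A B assume A: "A \<in> sd" and B: "B \<subseteq> A"
  show "B \<in> sd"
  proof (cases "y \<in> B")
    case True
    with A B have "A - {y} \<union> F \<in> \<Delta>" by (auto simp: sd_def)
    then have "B - {y} \<union> F \<in> \<Delta>" by (rule downD[OF \<Delta>(1)]) (use B in auto)
    then show ?thesis using A B True by (auto simp: sd_def)
  next
    case False
    have "B \<in> \<Delta>"
    proof (cases "y \<in> A")
      case True
      with A have "A - {y} \<union> F \<in> \<Delta>" by (auto simp: sd_def)
      then show ?thesis by (rule downD[OF \<Delta>(1)]) (use B False in auto)
    next
      case yA: False
      with A have "A \<in> \<Delta>" by (auto simp: sd_def)
      then show ?thesis by (rule downD[OF \<Delta>(1)]) (use B in auto)
    qed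
    then show ?thesis using A B False by (auto simp: sd_def)
  qed
qed

lemma down_star: "down star"
  unfolding down_def
proof (intro ballI allI impI)
  fix A B assume "A \<in> star" "B \<subseteq> A"
  then show "B \<in> star" unfolding star_def by (auto intro: downD[OF \<Delta>(1), of "A \<union> F"])
qed

lemma down_star_y: "down star_y"
  unfolding down_def
proof (intro ballI allI impI)
  fix A B assume "A \<in> star_y" "B \<subseteq> A"
  then show "B \<in> star_y" unfolding star_y_def by (auto intro: downD[OF \<Delta>(1), of "A - {y} \<union> F"])
qed

lemma \<phi>_hp: "p \<in> hp V s \<Longrightarrow> \<phi> p \<in> hp (insert y V) s"
  by (rule psubst_hp[of p V s])
    (use csub_add[OF csub_hp hp_pvar[of _ "insert y V"] hp_pvar[of y "insert y V"]]
      hp_pvar[of _ "insert y V"] in auto)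

lemma \<psi>_\<phi>: "\<psi> (\<phi> p) = p"
proof -
  have "p \<in> poly_ring UNIV" by (simp add: poly_ring_def)
  then show ?thesis
    unfolding psubst_psubst using yF by (intro psubst_id[of p UNIV]) (auto simp: psubst_add)
qed

lemma keys_sub: "l \<in> keys (if v \<in> F then pvar v + pvar y else pvar v) \<Longrightarrow>
    keys l = {v} \<or> v \<in> F \<and> keys l = {y}"
  using subsetD[OF keys_add, of l "pvar v" "pvar y"] by (auto simp: pvar_def split: if_splits)

text \<open>In a monomial of the image every variable outside \<open>F\<close> survives, and a
  variable of \<open>F\<close> can disappear only in favour of \<open>y\<close>; hence the two parts
  of the relation.\<close>

lemma \<phi>_null:
  assumes "p \<in> poly_ring V" "p \<in> sr_ideal \<Delta>"
  shows "\<phi> p \<in> sr_ideal sd"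
proof (rule psubst_sr_ideal[where R = "\<lambda>A B. A - F \<subseteq> B \<and> (y \<notin> B \<longrightarrow> A \<subseteq> B)", OF _ _ _ assms])
  fix A B v l assume "A - F \<subseteq> B \<and> (y \<notin> B \<longrightarrow> A \<subseteq> B)" and
    "l \<in> keys (if v \<in> F then pvar v + pvar y else pvar v)"
  then show "insert v A - F \<subseteq> B \<union> keys l \<and>
      (y \<notin> B \<union> keys l \<longrightarrow> insert v A \<subseteq> B \<union> keys l)"
    using keys_sub[of l v] by auto
next
  fix A B assume *: "A - F \<subseteq> B \<and> (y \<notin> B \<longrightarrow> A \<subseteq> B)" "A \<subseteq> V" "B \<in> sd"
  show "A \<in> \<Delta>"
  proof (cases "y \<in> B")
    case True
    then have "B - {y} \<union> F \<in> \<Delta>" using * by (simp add: sd_def)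
    then show ?thesis by (rule downD[OF \<Delta>(1)]) (use * y in auto)
  next
    case False
    then have "B \<in> \<Delta>" using * by (simp add: sd_def)
    then show ?thesis by (rule downD[OF \<Delta>(1)]) (use * False in auto)
  qed
qed auto

text \<open>A face containing \<open>y\<close> is tested after adding all of \<open>F\<close>, so in
  the presence of \<open>y\<close> the variables of \<open>F\<close> in \<open>p\<close> no longer
  matter. This is why the summands with \<open>y^j\<close>, \<open>j > 0\<close>, see only the
  star.\<close>

lemma y_\<phi>_null:
  assumes "p \<in> poly_ring V" "p \<in> sr_ideal star"
  shows "pvar y * \<phi> p \<in> sr_ideal sd"
proof -
  have *: "\<phi> p \<in> sr_ideal {B. B - {y} \<union> F \<in> \<Delta>}"
  proof (rule psubst_sr_ideal[where R = "\<lambda>A B. A - F \<subseteq> B", OF _ _ _ assms])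
    fix A B v l assume "A - F \<subseteq> B" and
      "l \<in> keys (if v \<in> F then pvar v + pvar y else pvar v)"
    then show "insert v A - F \<subseteq> B \<union> keys l" using keys_sub[of l v] by auto
  next
    fix A B assume *: "A - F \<subseteq> B" "A \<subseteq> V" "B \<in> {B. B - {y} \<union> F \<in> \<Delta>}"
    then have "A \<union> F \<in> \<Delta>" using y by (auto intro: downD[OF \<Delta>(1), of "B - {y} \<union> F"])
    then show "A \<in> star" by (simp add: star_def)
  qed auto
  show ?thesis unfolding sr_ideal_def
  proof safe
    fix m assume "m \<in> keys (pvar y * \<phi> p)" and m: "keys m \<in> sd"
    then obtain k where k: "m = single y 1 + k" "k \<in> keys (\<phi> p)"
      using keys_mult[of "pvar y" "\<phi> p"] by (auto simp: pvar_def)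
    then have "insert y (keys k) \<in> sd" using m by (simp add: keys_add_nat)
    then have "keys k - {y} \<union> F \<in> \<Delta>" by (simp add: sd_def)
    then show False using * k by (auto simp: sr_ideal_def)
  qed
qed

text \<open>Modulo \<open>y\<close> the substitution is the identity, so monomials without
  \<open>y\<close> keep their coefficients.\<close>

lemma \<phi>_mod_y: "\<exists>b. \<phi> p - p = pvar y * b"
proof -
  have "p \<in> poly_ring UNIV" by (simp add: poly_ring_def)
  then show ?thesis
  proof (induction p rule: poly_ring_induct)
    case (const c)
    then show ?case by (intro exI[of _ 0]) simp
  next
    case (add p q)
    then obtain b c where "\<phi> p - p = pvar y * b" "\<phi> q - q = pvar y * c" by blast
    then show ?case by (intro exI[of _ "b + c"]) (simp add: psubst_add distrib_left algebra_simps)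
  next
    case (mult p v)
    then obtain b where "\<phi> p - p = pvar y * b" by blast
    then have b: "\<phi> p = p + pvar y * b" by (simp only: diff_eq_eq add.commute)
    show ?case
    proof (cases "v \<in> F")
      case True
      then show ?thesis
        by (intro exI[of _ "(pvar v + pvar y) * b + p"]) (simp add: psubst_mult b algebra_simps)
    next
      case False
      then show ?thesis
        by (intro exI[of _ "pvar v * b"]) (simp add: psubst_mult b algebra_simps)
    qed
  qed
qed

text \<open>Over the star, the only relation of the subdivision is \<open>\<Prod>v\<in>F. x\<^sub>v = 0\<close>.\<close>

lemma \<psi>_sd:
  assumes "p \<in> poly_ring (insert y V)" "p \<in> sr_ideal sd"
  shows "\<exists>h. \<psi> p - (\<Prod>v\<in>F. pvar v - pvar y) * h \<in> sr_ideal star_y"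
proof (induction p rule: cpoly_sum_induct)
  case (single m c)
  then have m: "keys m \<subseteq> insert y V" "keys m \<notin> sd"
    using assms by (auto simp: poly_ring_def sr_ideal_def)
  show ?case
  proof (cases "keys m - {y} \<union> F \<in> \<Delta>")
    case True
    \<comment> \<open>Over the star, a monomial can fail to be a face of the subdivision only by
      containing \<open>F\<close>; \<open>\<psi>\<close> then turns the factor belonging to
      \<open>F\<close> into the monic product.\<close>
    have "F \<subseteq> keys m"
    proof (rule ccontr)
      assume "\<not> F \<subseteq> keys m"
      moreover have "keys m - {y} \<in> \<Delta>" by (rule downD[OF \<Delta>(1) True]) auto
      ultimately have "keys m \<in> sd"
        using True m(1) by (cases "y \<in> keys m") (simp_all add: sd_def)
      then show False using m by simp
    qed
    from monomial_factor[OF this] obtain h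
      where h: "single m c = (\<Prod>v\<in>F. pvar v) * h" by blast
    have "\<psi> (single m c) = (\<Prod>v\<in>F. pvar v - pvar y) * \<psi> h"
      by (simp add: h psubst_mult psubst_prod)
    then show ?thesis by (intro exI[of _ "\<psi> h"]) (simp add: csub_0[OF csub_sr_ideal])
  next
    case False
    have "\<psi> (single m c) \<in> sr_ideal star_y"
    proof (rule psubst_sr_ideal[where R = "\<lambda>A B. A - F - {y} \<subseteq> B" and \<Delta> = star_y and V = UNIV])
      fix A B v l assume "A - F - {y} \<subseteq> B" and
        l: "l \<in> keys (if v \<in> F then pvar v - pvar y else pvar v)"
      moreover have "keys l = {v} \<or> v \<in> F \<and> keys l = {y}"
        using l by (auto simp: pvar_def in_keys_iff lookup_minus lookup_single when_def split: if_splits)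
      ultimately show "insert v A - F - {y} \<subseteq> B \<union> keys l" by auto
    next
      fix A B assume "A - F - {y} \<subseteq> B" "B \<in> star_y"
      then show "A \<in> star_y" unfolding star_y_def by (auto intro: downD[OF \<Delta>(1), of "B - {y} \<union> F"])
    next
      show "single m c \<in> sr_ideal star_y" using False by (auto simp: sr_ideal_def star_y_def)
    qed (auto simp: poly_ring_def)
    then show ?thesis by (intro exI[of _ 0]) simp
  qed
next
  case zero
  show ?case
    by (intro exI[of _ 0]) (simp add: csub_0[OF csub_sr_ideal])
next
  case (add p q)
  then obtain g h where "\<psi> p - (\<Prod>v\<in>F. pvar v - pvar y) * g \<in> sr_ideal star_y"
    "\<psi> q - (\<Prod>v\<in>F. pvar v - pvar y) * h \<in> sr_ideal star_y" by blast
  from csub_add[OF csub_sr_ideal this] show ?case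
    by (intro exI[of _ "g + h"]) (simp add: psubst_add algebra_simps)
qed

text \<open>Applying \<open>\<psi>\<close> shows that the sum of the \<open>y^j * q j\<close> is a
  multiple of \<open>?M\<close> modulo the star. Up to sign \<open>?M\<close> is monic in
  \<open>y\<close> of degree \<open>card F\<close>, and the sum has smaller degree, so both are
  null. For \<open>q 0\<close> this is not enough, since the ideal of \<Delta> is contained in that
  of the star.\<close>

lemma joint_inj:
  assumes q: "\<And>j. j < card F \<Longrightarrow> q j \<in> poly_ring V"
    and mem: "(\<Sum>j<card F. pvar y ^ j * \<phi> (q j)) \<in> sr_ideal sd"
  shows "j < card F \<Longrightarrow> q j \<in> sr_ideal star" "q 0 \<in> sr_ideal \<Delta>"
proof -
  let ?s = "card F" and ?M = "\<Prod>v\<in>F. pvar v - pvar y"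
  let ?p = "\<Sum>j<?s. pvar y ^ j * \<phi> (q j)" and ?r = "\<Sum>j<?s. pvar y ^ j * q j"
  have \<phi>_ring: "\<phi> p \<in> poly_ring (insert y V)" if "p \<in> poly_ring V" for p
    by (rule psubst_poly_ring[OF that]) (auto intro: poly_ring_add poly_ring_pvar)
  have "?p \<in> poly_ring (insert y V)"
    using q by (intro csub_sum[OF csub_poly_ring] poly_ring_mult poly_ring_power poly_ring_pvar \<phi>_ring) auto
  from \<psi>_sd[OF this mem] obtain h where h: "\<psi> ?p - ?M * h \<in> sr_ideal star_y" ..
  have \<psi>y: "\<psi> (pvar y) = pvar y" using yF by simp
  have \<psi>p: "\<psi> ?p = ?r" by (simp only: psubst_sum psubst_mult psubst_power \<psi>y \<psi>_\<phi>)
  obtain c where c: "\<And>j. j < ?s \<Longrightarrow> c j \<in> hp F (?s - j)"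
    "?M = (- 1) ^ ?s * pvar y ^ ?s + (\<Sum>j<?s. pvar y ^ j * c j)"
    using expand_prod[OF finF, of "\<lambda>p. p" y] by auto
  have cst1: "(- 1) ^ ?s = cst ((- 1) ^ ?s)" by (simp add: cst_power cst_uminus)
  have cone: "insert y A \<in> star_y" if "A \<in> star_y" for A
    using that by (simp add: star_y_def)
  have "- h \<in> sr_ideal star_y"
  proof (rule monic_cancel[OF c(2)[unfolded cst1] _ _ _ down_star_y cone])
    show "ydeg_less y ?s (\<Sum>j<?s. pvar y ^ j * c j)"
      using c(1) yF by (intro ydeg_less_sum ydeg_less_power_mult[where V = F]) (auto intro: hp_poly_ring)
    show "ydeg_less y ?s ?r"
      using q y by (intro ydeg_less_sum ydeg_less_power_mult[where V = V]) auto
    show "?M * - h + ?r \<in> sr_ideal star_y" using h by (simp add: \<psi>p algebra_simps)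
  qed auto
  from csub_uminus[OF csub_sr_ideal this] have "h \<in> sr_ideal star_y" by simp
  from sr_ideal_mult[OF down_star_y this] csub_add[OF csub_sr_ideal h[unfolded \<psi>p], of "?M * h"]
  have r: "?r \<in> sr_ideal star_y" by simp
  have qy: "q j \<in> sr_ideal star_y" if "j < ?s" for j
    using sr_ideal_coeffs[OF q y cone r that] by simp
  show qs: "q j \<in> sr_ideal star" if "j < ?s" for j
    unfolding sr_ideal_def
  proof safe
    fix m assume m: "m \<in> keys (q j)" "keys m \<in> star"
    then have "keys m - {y} = keys m"
      using q[OF that] y by (auto simp: poly_ring_def)
    then have "keys m \<in> star_y" using m by (simp add: star_y_def star_def)
    then show False using qy[OF that] m by (auto simp: sr_ideal_def)
  qed
  \<comment> \<open>The summands with \<open>j > 0\<close> are now known to vanish, which isolates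
    the first one.\<close>
  have "\<phi> (q 0) \<in> sr_ideal sd"
  proof -
    have "pvar y ^ j * \<phi> (q j) \<in> sr_ideal sd" if "j \<in> {..<?s} - {0}" for j
    proof -
      have "pvar y ^ (j - 1) * (pvar y * \<phi> (q j)) \<in> sr_ideal sd"
        using that q qs by (intro sr_ideal_mult[OF down_sd] y_\<phi>_null) auto
      then show ?thesis using that by (cases j) (simp_all add: ac_simps)
    qed
    then have "(\<Sum>j\<in>{..<?s} - {0}. pvar y ^ j * \<phi> (q j)) \<in> sr_ideal sd"
      by (rule csub_sum[OF csub_sr_ideal])
    from csub_diff[OF csub_sr_ideal mem this]
    have "?p - (\<Sum>j\<in>{..<?s} - {0}. pvar y ^ j * \<phi> (q j)) \<in> sr_ideal sd" .
    moreover have "?p = \<phi> (q 0) + (\<Sum>j\<in>{..<?s} - {0}. pvar y ^ j * \<phi> (q j))"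
      using card_F by (subst sum.remove[of _ 0]) auto
    ultimately show ?thesis by simp
  qed
  show "q 0 \<in> sr_ideal \<Delta>"
    unfolding sr_ideal_def
  proof safe
    fix m assume m: "m \<in> keys (q 0)" "keys m \<in> \<Delta>"
    \<comment> \<open>A monomial of \<open>q 0\<close> on a face of \<Delta> lies off the star,
      hence does not contain \<open>F\<close> and is a face of the subdivision; being free of
      \<open>y\<close>, it survives in \<open>\<phi> (q 0)\<close>.\<close>
    have q0: "q 0 \<in> poly_ring V" "q 0 \<in> sr_ideal star" using q qs card_F by auto
    then have "keys m \<union> F \<notin> \<Delta>" using m by (auto simp: sr_ideal_def star_def)
    then have "\<not> F \<subseteq> keys m" using m(2) by (auto simp: sup.absorb1)
    moreover have "keys m \<subseteq> V" using m q0 by (simp add: poly_ring_def)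
    ultimately have "keys m \<in> sd" using m y by (auto simp: sd_def)
    moreover have "m \<in> keys (\<phi> (q 0))"
    proof -
      have "lookup m y = 0"
        by (rule poly_ring_lookup_0[OF q0(1) y m(1)])
      moreover from \<phi>_mod_y obtain b where "\<phi> (q 0) - q 0 = pvar y * b" by blast
      ultimately have "lookup (\<phi> (q 0) - q 0) m = 0" by (simp add: lookup_pvar_mult_0)
      then show ?thesis using m by (simp add: in_keys_iff lookup_minus)
    qed
    ultimately show False using \<open>\<phi> (q 0) \<in> sr_ideal sd\<close> by (auto simp: sr_ideal_def)
  qed
qed

text \<open>Elements of this form are closed under multiplication by \<open>\<phi> (pvar v)\<close>
  and by \<open>y\<close>, and a variable of \<open>F\<close> is
  \<open>\<phi> (pvar v) - pvar y\<close>. Multiplication by \<open>y\<close> overflows only at the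
  top power, which is reduced by an equation monic in \<open>y\<close>, up to sign, over the image
  of \<open>\<phi>\<close>.\<close>

lemma joint_sur:
  assumes "w \<in> hp (insert y V) u"
  shows "\<exists>q. (\<forall>j<card F. q j \<in> pieces V j (Suc u)) \<and>
    w - (\<Sum>j<card F. pvar y ^ j * \<phi> (q j)) \<in> sr_ideal sd"
  using assms
proof (induction w rule: hp_induct)
  case (const c)
  let ?q = "\<lambda>j. if j = 0 then cst c else 0"
  have "(\<Sum>j<card F. pvar y ^ j * \<phi> (?q j)) = cst c"
    using card_F by (subst sum.remove[of _ 0]) auto
  then show ?case
    by (intro exI[of _ ?q]) (auto simp: pieces_def hp_cst csub_0[OF csub_sr_ideal])
next
  case (zero u)
  then show ?case
    by (intro exI[of _ "\<lambda>_. 0"]) (auto intro: csub_0[OF csub_pieces] csub_0[OF csub_sr_ideal])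
next
  case (add u p q)
  then obtain a b where "\<And>j. j < card F \<Longrightarrow> a j \<in> pieces V j (Suc u)" "\<And>j. j < card F \<Longrightarrow> b j \<in> pieces V j (Suc u)"
    and *: "p - (\<Sum>j<card F. pvar y ^ j * \<phi> (a j)) \<in> sr_ideal sd"
    "q - (\<Sum>j<card F. pvar y ^ j * \<phi> (b j)) \<in> sr_ideal sd" by blast
  with csub_add[OF csub_sr_ideal *] show ?case
    by (intro exI[of _ "\<lambda>j. a j + b j"])
      (auto simp: psubst_add distrib_left sum.distrib algebra_simps intro: csub_add[OF csub_pieces])
next
  case (mult u p v)
  let ?s = "card F"
  from mult obtain q where q: "\<And>j. j < ?s \<Longrightarrow> q j \<in> pieces V j (Suc u)"
    "p - (\<Sum>j<?s. pvar y ^ j * \<phi> (q j)) \<in> sr_ideal sd" by blast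
  have y_mult: "\<exists>q'. (\<forall>j<?s. q' j \<in> pieces V j (Suc (Suc u))) \<and>
    pvar y * p - (\<Sum>j<?s. pvar y ^ j * \<phi> (q' j)) \<in> sr_ideal sd"
  proof -
    obtain c where c: "\<And>j. j < ?s \<Longrightarrow> c j \<in> hp F (?s - j)"
      "(\<Prod>v\<in>F. \<phi> (pvar v) - pvar y) = (- 1) ^ ?s * pvar y ^ ?s + (\<Sum>j<?s. pvar y ^ j * \<phi> (c j))"
      using expand_prod[OF finF, of \<phi> y] by (auto simp: psubst_mult psubst_diff)
    \<comment> \<open>The monomial of the removed face \<open>F\<close>, rewritten in the
      \<open>\<phi> (pvar v)\<close>, is the equation satisfied by \<open>y\<close>.\<close>
    have "(\<Prod>v\<in>F. \<phi> (pvar v) - pvar y) = (\<Prod>v\<in>F. pvar v)" by (intro prod.cong) auto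
    moreover have "(\<Prod>v\<in>F. pvar v) \<in> sr_ideal sd"
      by (rule prod_pvar_sr_ideal[OF finF]) (simp add: sd_def)
    ultimately have rel: "(- 1) ^ ?s * pvar y ^ ?s + (\<Sum>j<?s. pvar y ^ j * \<phi> (c j)) \<in> sr_ideal sd"
      using c(2) by simp
    define e :: "'v cpoly" where "e = (- 1) ^ ?s"
    have ee: "e * e = 1" by (simp add: e_def power_mult_distrib[symmetric])
    have e_pieces: "e * a \<in> pieces V j u" if "a \<in> pieces V j u" for a j u
      unfolding e_def by (rule csub_sgn[OF csub_pieces that])
    have \<phi>e: "\<phi> e = e" using psubst_cst[of _ "(- 1) ^ ?s"] by (simp add: e_def cst_power cst_uminus)
    obtain s' where s': "?s = Suc s'" using card_F by (cases ?s) auto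
    \<comment> \<open>A shift by one, followed by the reduction of the overflowing coefficient
      \<open>q s'\<close>; \<open>e\<close> is the leading coefficient of the equation and its own
      inverse.\<close>
    define q' where "q' j = (if j = 0 then 0 else q (j - 1)) - e * (q s' * c j)" for j
    have "q' j \<in> pieces V j (Suc (Suc u))" if j: "j < ?s" for j
    proof -
      have 1: "(if j = 0 then 0 else q (j - 1)) \<in> pieces V j (Suc (Suc u))"
      proof (cases j)
        case (Suc i)
        then show ?thesis using q(1)[of i] j by (simp add: pieces_Suc_Suc)
      qed (simp add: csub_0[OF csub_pieces])
      \<comment> \<open>\<open>q s'\<close> has degree \<open>u - s'\<close> and \<open>c j\<close>
        has degree \<open>?s - j\<close>, together \<open>u + 1 - j\<close>. For
        \<open>u < s'\<close>, where subtraction truncates, \<open>q s'\<close> is 0.\<close>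
      have 2: "q s' * c j \<in> pieces V j (Suc (Suc u))"
      proof (cases "u < s'")
        case True
        then have "q s' = 0" using q(1)[of s'] s' by (simp add: pieces_def)
        then show ?thesis by (simp add: csub_0[OF csub_pieces])
      next
        case False
        then have "q s' \<in> hp V (u - s')" using q(1)[of s'] s' by (simp add: pieces_def)
        moreover have "c j \<in> hp V (?s - j)" using c(1)[OF j] F(1) by (rule hp_mono)
        ultimately have "q s' * c j \<in> hp V ((u - s') + (?s - j))" by (rule hp_mult)
        moreover have "(u - s') + (?s - j) = Suc (Suc u) - Suc j" using False j s' by simp
        moreover have "\<not> Suc (Suc u) \<le> j" using False j s' by simp
        ultimately show ?thesis by (simp add: pieces_def)
      qed
      show ?thesis unfolding q'_def by (rule csub_diff[OF csub_pieces 1 e_pieces[OF 2]])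
    qed
    moreover have "pvar y * p - (\<Sum>j<?s. pvar y ^ j * \<phi> (q' j)) \<in> sr_ideal sd"
    proof -
      have "(\<Sum>j<?s. pvar y ^ j * \<phi> (if j = 0 then 0 else q (j - 1))) + pvar y ^ ?s * \<phi> (q s')
          = (\<Sum>j<?s. pvar y ^ Suc j * \<phi> (q j))"
        unfolding s' by (subst sum.lessThan_Suc_shift) simp
      also have "\<dots> = pvar y * (\<Sum>j<?s. pvar y ^ j * \<phi> (q j))"
        by (simp add: sum_distrib_left mult.assoc)
      finally have shift: "(\<Sum>j<?s. pvar y ^ j * \<phi> (if j = 0 then 0 else q (j - 1)))
          = pvar y * (\<Sum>j<?s. pvar y ^ j * \<phi> (q j)) - pvar y ^ ?s * \<phi> (q s')"
        by (simp add: algebra_simps)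
      have "(\<Sum>j<?s. pvar y ^ j * \<phi> (q' j)) = pvar y * (\<Sum>j<?s. pvar y ^ j * \<phi> (q j))
          - e * \<phi> (q s') * (e * pvar y ^ ?s + (\<Sum>j<?s. pvar y ^ j * \<phi> (c j)))"
      proof -
        have "(\<Sum>j<?s. pvar y ^ j * \<phi> (q' j)) = (\<Sum>j<?s. pvar y ^ j * \<phi> (if j = 0 then 0 else q (j - 1)))
            - e * \<phi> (q s') * (\<Sum>j<?s. pvar y ^ j * \<phi> (c j))"
          by (simp only: q'_def psubst_diff psubst_mult \<phi>e right_diff_distrib sum_subtractf
              sum_distrib_left mult.assoc mult.left_commute)
        moreover have "e * \<phi> (q s') * (e * pvar y ^ ?s) = pvar y ^ ?s * \<phi> (q s')"
        proof -
          have "e * \<phi> (q s') * (e * pvar y ^ ?s) = (e * e) * (pvar y ^ ?s * \<phi> (q s'))"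
            by (simp only: ac_simps)
          then show ?thesis by (simp only: ee mult_1_left)
        qed
        ultimately show ?thesis unfolding shift by (simp add: distrib_left)
      qed
      then have "pvar y * p - (\<Sum>j<?s. pvar y ^ j * \<phi> (q' j)) = pvar y * (p - (\<Sum>j<?s. pvar y ^ j * \<phi> (q j)))
          + e * \<phi> (q s') * (e * pvar y ^ ?s + (\<Sum>j<?s. pvar y ^ j * \<phi> (c j)))"
        by (simp add: right_diff_distrib)
      also have "\<dots> \<in> sr_ideal sd"
        by (intro csub_add[OF csub_sr_ideal] sr_ideal_mult[OF down_sd] q(2) rel[folded e_def])
      finally show ?thesis .
    qed
    ultimately show ?thesis by blast
  qed
  have v_mult: "\<exists>q'. (\<forall>j<?s. q' j \<in> pieces V j (Suc (Suc u))) \<and>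
    \<phi> (pvar v) * p - (\<Sum>j<?s. pvar y ^ j * \<phi> (q' j)) \<in> sr_ideal sd" if "v \<in> V"
  proof (intro exI[of _ "\<lambda>j. pvar v * q j"] conjI allI impI)
    show "pvar v * q j \<in> pieces V j (Suc (Suc u))" if "j < ?s" for j
      using pieces_mult[OF hp_pvar[OF \<open>v \<in> V\<close>] q(1)[OF that]] .
    have "\<phi> (pvar v) * p - (\<Sum>j<?s. pvar y ^ j * \<phi> (pvar v * q j))
      = \<phi> (pvar v) * (p - (\<Sum>j<?s. pvar y ^ j * \<phi> (q j)))"
      by (simp only: psubst_mult right_diff_distrib sum_distrib_left mult.left_commute)
    then show "\<phi> (pvar v) * p - (\<Sum>j<?s. pvar y ^ j * \<phi> (pvar v * q j)) \<in> sr_ideal sd"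
      using sr_ideal_mult[OF down_sd q(2)] by simp
  qed
  show ?case
  proof (cases "v = y")
    case True
    then show ?thesis using y_mult by simp
  next
    case False
    then have "v \<in> V" using mult by simp
    from v_mult[OF this] obtain a where a: "\<And>j. j < ?s \<Longrightarrow> a j \<in> pieces V j (Suc (Suc u))"
      "\<phi> (pvar v) * p - (\<Sum>j<?s. pvar y ^ j * \<phi> (a j)) \<in> sr_ideal sd" by blast
    show ?thesis
    proof (cases "v \<in> F")
      case True
      from y_mult obtain b where b: "\<And>j. j < ?s \<Longrightarrow> b j \<in> pieces V j (Suc (Suc u))"
        "pvar y * p - (\<Sum>j<?s. pvar y ^ j * \<phi> (b j)) \<in> sr_ideal sd" by blast
      have "pvar v * p - (\<Sum>j<?s. pvar y ^ j * \<phi> (a j - b j)) =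
        (\<phi> (pvar v) * p - (\<Sum>j<?s. pvar y ^ j * \<phi> (a j))) - (pvar y * p - (\<Sum>j<?s. pvar y ^ j * \<phi> (b j)))"
        using True by (simp add: psubst_diff right_diff_distrib sum_subtractf distrib_right)
      then have "pvar v * p - (\<Sum>j<?s. pvar y ^ j * \<phi> (a j - b j)) \<in> sr_ideal sd"
        using csub_diff[OF csub_sr_ideal a(2) b(2)] by simp
      then show ?thesis
        by (intro exI[of _ "\<lambda>j. a j - b j"]) (auto intro: csub_diff[OF csub_pieces a(1) b(1)])
    next
      case False
      then show ?thesis using a by auto
    qed
  qed
qed

text \<open>Summand \<open>j\<close> is a copy of the old ring for \<open>j = 0\<close> and of the
  ring of the star for \<open>j > 0\<close>, shifted to start in degree \<open>j\<close>; so its Tor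
  in degree \<open>s\<close> is that of the unshifted ring in degree \<open>s - j\<close>, and zero
  for \<open>s < j\<close>.\<close>

theorem sr_dim_stellar:
  assumes fin: "finite I" and \<theta>: "\<And>i. i \<in> I \<Longrightarrow> \<theta> i \<in> hp V 1"
    and base: "sr_dim I \<theta> V \<Delta> t s d0" and st: "\<And>s. sr_dim I \<theta> V star t s (d s)"
  shows "sr_dim I (\<lambda>i. \<phi> (\<theta> i)) (insert y V) sd t s
    (d0 + (\<Sum>j\<in>{1..<card F}. if j \<le> s then d (s - j) else 0))"
proof -
  let ?J = "{..<card F}" and ?N = "\<lambda>j. sr_ideal (if j = 0 then \<Delta> else star)"
  have 0: "koszul I (\<lambda>i. \<phi> (\<theta> i)) (pieces (insert y V) 0) (sr_ideal sd)"
    by (rule koszul_sr[OF fin \<phi>_hp[OF \<theta>] down_sd])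
  have K: "koszul I \<theta> (pieces V j) (?N j)" for j
    using koszul_sr[OF fin \<theta>] \<Delta>(1) down_star by simp
  have pc: "pvar y ^ j * \<phi> a \<in> pieces (insert y V) 0 u" if "a \<in> pieces V j u" for a j u
  proof (cases "u \<le> j")
    case True
    then have "a = 0" using that by (simp add: pieces_def)
    then show ?thesis by (simp add: csub_0[OF csub_pieces])
  next
    case False
    then have "\<phi> a \<in> hp (insert y V) (u - Suc j)" using that \<phi>_hp by (simp add: pieces_def)
    from hp_mult[OF hp_pvar_power this, of y j] False show ?thesis by (simp add: pieces_def)
  qed
  interpret koszul_sum I "\<lambda>i. \<phi> (\<theta> i)" "pieces (insert y V) 0" "sr_ideal sd" ?J "\<lambda>_. \<theta>"
    "pieces V" ?N "\<lambda>j a. pvar y ^ j * \<phi> a"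
  proof (rule koszul_sum.intro[OF 0], rule koszul_sum_axioms.intro)
    show "finite ?J" by simp
    show "koszul I \<theta> (pieces V j) (?N j)" for j by (rule K)
    show "pvar y ^ j * \<phi> (a + b) = pvar y ^ j * \<phi> a + pvar y ^ j * \<phi> b" for a b j
      by (simp add: psubst_add distrib_left)
    show "pvar y ^ j * \<phi> (cst c * a) = cst c * (pvar y ^ j * \<phi> a)" for j c a
      by (simp add: psubst_mult mult.left_commute)
    show "pvar y ^ j * \<phi> a \<in> pieces (insert y V) 0 u" if "a \<in> pieces V j u" for a j u
      by (rule pc[OF that])
    show "pvar y ^ j * \<phi> a \<in> sr_ideal sd" if "a \<in> pieces V j u" "a \<in> ?N j" for a j u
    proof (cases j)
      case 0
      then show ?thesis using that(2) \<phi>_null[OF pieces_poly_ring[OF that(1)]] by simp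
    next
      case (Suc i)
      have "pvar y ^ i * (pvar y * \<phi> a) \<in> sr_ideal sd"
        using that Suc by (intro sr_ideal_mult[OF down_sd] y_\<phi>_null) (auto intro: pieces_poly_ring)
      then show ?thesis by (simp add: Suc ac_simps)
    qed
    show "pvar y ^ j * \<phi> (\<theta> i * a) - \<phi> (\<theta> i) * (pvar y ^ j * \<phi> a) \<in> sr_ideal sd" for j i a
      by (simp add: psubst_mult mult.left_commute csub_0[OF csub_sr_ideal])
    show "f j \<in> ?N j" if f: "\<And>j. j \<in> ?J \<Longrightarrow> f j \<in> pieces V j u"
      "(\<Sum>j\<in>?J. pvar y ^ j * \<phi> (f j)) \<in> sr_ideal sd" "j \<in> ?J" for f u j
    proof -
      have f': "f i \<in> poly_ring V" if "i < card F" for i using f(1)[of i] that pieces_poly_ring by blast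
      show ?thesis using joint_inj[OF f' f(2)] f(3) by auto
    qed
    show "\<exists>f. (\<forall>j\<in>?J. f j \<in> pieces V j u) \<and> w - (\<Sum>j\<in>?J. pvar y ^ j * \<phi> (f j)) \<in> sr_ideal sd"
      if "w \<in> pieces (insert y V) 0 u" for w u
    proof (cases u)
      case 0
      then show ?thesis using that
        by (intro exI[of _ "\<lambda>_. 0"]) (simp add: csub_0[OF csub_sr_ideal])
    next
      case (Suc u')
      then show ?thesis using joint_sur[of w u'] that by (auto simp: pieces_Suc)
    qed
  qed
  have "kdim I (\<lambda>i. \<phi> (\<theta> i)) (pieces (insert y V) 0) (sr_ideal sd) t s
      (\<Sum>j\<in>?J. if j = 0 then d0 else if j \<le> s then d (s - j) else 0)"
  proof (rule kdim_sum)
    fix j assume "j \<in> ?J"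
    show "kdim I \<theta> (pieces V j) (?N j) t s (if j = 0 then d0 else if j \<le> s then d (s - j) else 0)"
    proof (cases "j = 0")
      case True
      then show ?thesis using base by simp
    next
      case False
      then show ?thesis using sr_dim_shift[OF st, of j s] K[of j] by simp
    qed
  qed
  also have "(\<Sum>j\<in>?J. if j = 0 then d0 else if j \<le> s then d (s - j) else 0)
      = d0 + (\<Sum>j\<in>?J - {0}. if j \<le> s then d (s - j) else 0)"
    using card_F by (subst sum.remove[of _ 0]) (auto intro!: sum.cong)
  also have "?J - {0} = {1..<card F}" by auto
  finally show ?thesis .
qed

end

section \<open>Koszul homology of Stanley--Reisner rings\<close>

text \<open>A direct sum with a single summand. The maps have to be mutually inverse only modulo the
  ideals, which leaves room for variables that vanish in the quotient.\<close>

lemma sr_dim_iso: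
  fixes \<phi> :: "'v cpoly \<Rightarrow> 'w cpoly" and \<psi> :: "'w cpoly \<Rightarrow> 'v cpoly"
  assumes src: "koszul I \<theta> (pieces V 0) (sr_ideal \<Delta>)" and tgt: "koszul I \<theta>' (pieces W 0) (sr_ideal \<Gamma>)"
    and add: "\<And>a b. \<phi> (a + b) = \<phi> a + \<phi> b" "\<And>a b. \<psi> (a + b) = \<psi> a + \<psi> b"
    and scal: "\<And>c a. \<phi> (cst c * a) = cst c * \<phi> a"
    and into: "\<And>a s. a \<in> hp V s \<Longrightarrow> \<phi> a \<in> hp W s" "\<And>a s. a \<in> hp W s \<Longrightarrow> \<psi> a \<in> hp V s"
    and null: "\<And>a. a \<in> poly_ring V \<Longrightarrow> a \<in> sr_ideal \<Delta> \<Longrightarrow> \<phi> a \<in> sr_ideal \<Gamma>"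
      "\<And>a. a \<in> poly_ring W \<Longrightarrow> a \<in> sr_ideal \<Gamma> \<Longrightarrow> \<psi> a \<in> sr_ideal \<Delta>"
    and inv: "\<And>a. a \<in> poly_ring V \<Longrightarrow> \<psi> (\<phi> a) - a \<in> sr_ideal \<Delta>"
      "\<And>a. a \<in> poly_ring W \<Longrightarrow> \<phi> (\<psi> a) - a \<in> sr_ideal \<Gamma>"
    and comm: "\<And>i a. i \<in> I \<Longrightarrow> a \<in> poly_ring V \<Longrightarrow> \<phi> (\<theta> i * a) - \<theta>' i * \<phi> a \<in> sr_ideal \<Gamma>"
    and d: "sr_dim I \<theta> V \<Delta> t s d"
  shows "sr_dim I \<theta>' W \<Gamma> t s d"
proof -
  have pc: "\<phi> a \<in> pieces W 0 u" if "a \<in> pieces V 0 u" for a u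
    using that into(1)[of a] scal[of 0 0] by (cases u) (auto simp: pieces_Suc)
  have pc': "\<psi> a \<in> pieces V 0 u" if "a \<in> pieces W 0 u" for a u
    using that into(2)[of a] add(2)[of 0 0] by (cases u) (auto simp: pieces_Suc)
  interpret koszul_sum I \<theta>' "pieces W 0" "sr_ideal \<Gamma>" "{()}" "\<lambda>_. \<theta>" "\<lambda>_. pieces V 0"
    "\<lambda>_. sr_ideal \<Delta>" "\<lambda>_. \<phi>"
  proof (rule koszul_sum.intro[OF tgt], rule koszul_sum_axioms.intro)
    show "f j \<in> sr_ideal \<Delta>" if f: "\<And>j. j \<in> {()} \<Longrightarrow> f j \<in> pieces V 0 u"
      "(\<Sum>j\<in>{()}. \<phi> (f j)) \<in> sr_ideal \<Gamma>" "j \<in> {()}" for f u j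
    proof -
      have fp: "f () \<in> poly_ring V" using f(1) pieces_poly_ring by blast
      have "\<phi> (f ()) \<in> poly_ring W" using f(1) pc pieces_poly_ring by blast
      then have "\<psi> (\<phi> (f ())) \<in> sr_ideal \<Delta>" using f(2) by (intro null(2)) simp_all
      from csub_congD'[OF csub_sr_ideal inv(1)[OF fp] this] show ?thesis by simp
    qed
    show "\<exists>f. (\<forall>j\<in>{()}. f j \<in> pieces V 0 u) \<and> w - (\<Sum>j\<in>{()}. \<phi> (f j)) \<in> sr_ideal \<Gamma>"
      if w: "w \<in> pieces W 0 u" for w u
      using pc'[OF w] csub_uminus[OF csub_sr_ideal inv(2)[OF pieces_poly_ring[OF w]]]
      by (intro exI[of _ "\<lambda>_. \<psi> w"]) simp
  qed (use src add scal pc null comm pieces_poly_ring in \<open>simp_all, blast+\<close>)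
  have "kdim I \<theta>' (pieces W 0) (sr_ideal \<Gamma>) t s (\<Sum>j\<in>{()}. d)"
    by (rule kdim_sum) (rule d)
  then show ?thesis by simp
qed

text \<open>Variables in \<open>W\<close> that are no vertices of \<Gamma> vanish in the quotient
  and go to 0 on the way back; accordingly the forms are compared only modulo the ideal.\<close>

lemma sr_dim_relabel:
  fixes g :: "'v \<Rightarrow> 'w"
  assumes fin: "finite I" and inj: "inj_on g V" and gV: "g ` V \<subseteq> W"
    and down: "down \<Delta>" "down \<Gamma>"
    and faces: "\<And>A. A \<subseteq> V \<Longrightarrow> g ` A \<in> \<Gamma> \<longleftrightarrow> A \<in> \<Delta>" and vert: "\<And>A. A \<in> \<Gamma> \<Longrightarrow> A \<subseteq> g ` V"
    and \<theta>: "\<And>i. i \<in> I \<Longrightarrow> \<theta> i \<in> hp V 1" and \<theta>': "\<And>i. i \<in> I \<Longrightarrow> \<theta>' i \<in> hp W 1"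
    and comp: "\<And>i. i \<in> I \<Longrightarrow> psubst (\<lambda>v. pvar (g v)) (\<theta> i) - \<theta>' i \<in> sr_ideal \<Gamma>"
    and d: "sr_dim I \<theta> V \<Delta> t s d"
  shows "sr_dim I \<theta>' W \<Gamma> t s d"
proof -
  let ?\<phi> = "psubst (\<lambda>v. pvar (g v))"
  let ?\<psi> = "psubst (\<lambda>w. if w \<in> g ` V then pvar (the_inv_into V g w) else 0)"
  have inv: "the_inv_into V g (g v) = v" if "v \<in> V" for v by (rule the_inv_into_f_f[OF inj that])
  show ?thesis
  proof (rule sr_dim_iso[where \<phi> = ?\<phi> and \<psi> = ?\<psi>, OF koszul_sr[OF fin \<theta> down(1)]
        koszul_sr[OF fin \<theta>' down(2)] psubst_add psubst_add _ _ _ _ _ _ _ _ d])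
    show "?\<phi> (cst c * a) = cst c * ?\<phi> a" for c a by (simp add: psubst_mult)
    show "?\<phi> a \<in> hp W s" if "a \<in> hp V s" for a s
      using that gV by (intro psubst_hp[of a V] hp_pvar) auto
    show "?\<psi> a \<in> hp V s" if "a \<in> hp W s" for a s
      using that by (intro psubst_hp[of a W]) (auto simp: inv csub_0[OF csub_hp] intro: hp_pvar[simplified])
    show "?\<phi> a \<in> sr_ideal \<Gamma>" if "a \<in> poly_ring V" "a \<in> sr_ideal \<Delta>" for a
      by (rule psubst_sr_ideal[where R = "\<lambda>A B. B = g ` A", OF _ _ _ that])
        (auto simp: pvar_def faces)
    show "?\<psi> a \<in> sr_ideal \<Delta>" if "a \<in> poly_ring W" "a \<in> sr_ideal \<Gamma>" for a
    proof (rule psubst_sr_ideal[where R = "\<lambda>A B. A = g ` B \<and> B \<subseteq> V", OF _ _ _ that])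
      fix A B w l assume "A = g ` B \<and> B \<subseteq> V"
        "l \<in> keys (if w \<in> g ` V then pvar (the_inv_into V g w) else 0 :: 'v cpoly)"
      then show "insert w A = g ` (B \<union> keys l) \<and> B \<union> keys l \<subseteq> V"
        by (auto simp: pvar_def inv split: if_splits)
    qed (auto simp: faces)
    show "?\<psi> (?\<phi> a) - a \<in> sr_ideal \<Delta>" if "a \<in> poly_ring V" for a
    proof -
      have "?\<psi> (?\<phi> a) = a"
        unfolding psubst_psubst using that by (intro psubst_id[of a V]) (auto simp: inv)
      then show ?thesis by (simp add: csub_0[OF csub_sr_ideal])
    qed
    show "?\<phi> (?\<psi> a) - a \<in> sr_ideal \<Gamma>" if "a \<in> poly_ring W" for a
      using that
    proof (induction a rule: poly_ring_induct)
      case (const c)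
      then show ?case by (simp add: csub_0[OF csub_sr_ideal])
    next
      case (add p q)
      from csub_add[OF csub_sr_ideal this(1,2)] show ?case by (simp add: psubst_add algebra_simps)
    next
      case (mult p w)
      show ?case
      proof (cases "w \<in> g ` V")
        case True
        have "?\<phi> (?\<psi> (pvar w * p)) - pvar w * p = pvar w * (?\<phi> (?\<psi> p) - p)"
          using True by (auto simp: psubst_mult inv right_diff_distrib)
        then show ?thesis using sr_ideal_mult[OF down(2) mult(3)] by simp
      next
        case False
        have "pvar w \<in> sr_ideal \<Gamma>"
          using False vert[of "{w}"] by (auto simp: sr_ideal_def pvar_def)
        from csub_uminus[OF csub_sr_ideal sr_ideal_mult[OF down(2) this, of p]]
        show ?thesis using False by (simp add: psubst_mult mult.commute)
      qed
    qed
    show "?\<phi> (\<theta> i * a) - \<theta>' i * ?\<phi> a \<in> sr_ideal \<Gamma>" if "i \<in> I" for i a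
      using sr_ideal_mult[OF down(2) comp[OF that], of "?\<phi> a"]
      by (simp add: psubst_mult algebra_simps)
  qed
qed

text \<open>Over a cone with apex \<open>v\<close>, the form \<open>\<theta> e\<close> is monic in
  \<open>v\<close> up to \<epsilon>, hence a nonzerodivisor, and the quotient by it is the
  substitution of \<open>L\<close> for \<open>v\<close>. The constant accommodates the sign of the
  eliminating form.\<close>

lemma sr_dim_cone:
  assumes fin: "finite I" and e: "e \<in> I" and v: "v \<in> V" and down: "down \<Delta>"
    and cone: "\<And>A. A \<in> \<Delta> \<Longrightarrow> insert v A \<in> \<Delta>"
    and \<theta>: "\<And>i. i \<in> I \<Longrightarrow> \<theta> i \<in> hp V 1"
    and L: "L \<in> hp (V - {v}) 1" and \<epsilon>: "\<epsilon> \<noteq> 0" and \<theta>e: "\<theta> e = cst \<epsilon> * (pvar v - L)"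
    and \<theta>': "\<And>i. i \<in> I - {e} \<Longrightarrow> \<theta>' i = psubst (pvar(v := L)) (\<theta> i)"
    and d: "sr_dim (I - {e}) \<theta>' (V - {v}) \<Delta> t s d"
  shows "sr_dim I \<theta> V \<Delta> t s d"
proof -
  let ?\<pi> = "psubst (pvar(v := L))"
  have \<pi>_hp: "?\<pi> a \<in> hp (V - {v}) u" if "a \<in> hp V u" for a u
    using that L hp_pvar[of _ "V - {v}"] by (intro psubst_hp[of a V]) auto
  have \<pi>_id: "?\<pi> a = a" if "a \<in> poly_ring (V - {v})" for a
    using that by (rule psubst_id) auto
  have vL: "pvar v - L \<in> hp V 1"
    by (intro csub_diff[OF csub_hp] hp_pvar v hp_mono[OF L]) auto
  \<comment> \<open>The remainder theorem for \<open>pvar v - L\<close>. Since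
    \<open>pieces V 0 u\<close> has degree \<open>u - 1\<close>, the quotient lies one degree below
    \<open>a\<close>.\<close>
  have div: "\<exists>b\<in>pieces V 0 u. a - ?\<pi> a = (pvar v - L) * b" if "a \<in> hp V u" for a u
    using that
  proof (induction a rule: hp_induct)
    case (const c)
    then show ?case by (intro bexI[of _ 0]) (simp_all add: csub_0[OF csub_pieces])
  next
    case (zero u)
    then show ?case by (intro bexI[of _ 0]) (simp_all add: csub_0[OF csub_pieces])
  next
    case (add u p q)
    then obtain a b where "a \<in> pieces V 0 u" "b \<in> pieces V 0 u"
      "p - ?\<pi> p = (pvar v - L) * a" "q - ?\<pi> q = (pvar v - L) * b" by blast
    moreover have "p + q - ?\<pi> (p + q) = (p - ?\<pi> p) + (q - ?\<pi> q)"
      by (simp only: psubst_add add_diff_add)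
    ultimately show ?case
      by (intro bexI[of _ "a + b"] csub_add[OF csub_pieces]) (simp_all only: distrib_left)
  next
    case (mult u p w)
    then obtain b where b: "b \<in> pieces V 0 u" "p - ?\<pi> p = (pvar v - L) * b" by blast
    have wb: "pvar w * b \<in> pieces V 0 (Suc u)" by (rule pieces_mult[OF hp_pvar[OF mult(1)] b(1)])
    show ?case
    proof (cases "w = v")
      case True
      have "pvar w * p - ?\<pi> (pvar w * p) = pvar w * (p - ?\<pi> p) + (pvar v - L) * ?\<pi> p"
        using True by (simp add: psubst_mult algebra_simps)
      also have "\<dots> = (pvar v - L) * (pvar w * b + ?\<pi> p)" by (simp add: b(2) algebra_simps)
      finally have eq: "pvar w * p - ?\<pi> (pvar w * p) = (pvar v - L) * (pvar w * b + ?\<pi> p)" .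
      have "?\<pi> p \<in> pieces V 0 (Suc u)"
        using hp_mono[OF \<pi>_hp[OF mult(2)], of V] by (simp add: pieces_Suc)
      from csub_add[OF csub_pieces wb this] show ?thesis by (intro bexI[of _ "pvar w * b + ?\<pi> p"] eq)
    next
      case False
      have "pvar w * p - ?\<pi> (pvar w * p) = pvar w * (p - ?\<pi> p)"
        using False by (simp add: psubst_mult algebra_simps)
      also have "\<dots> = (pvar v - L) * (pvar w * b)" by (simp add: b(2) algebra_simps)
      finally show ?thesis using wb by blast
    qed
  qed
  have \<theta>'_hp: "\<theta>' i \<in> hp (V - {v}) 1" if "i \<in> I - {e}" for i
    using \<theta>'[OF that] \<pi>_hp[OF \<theta>] that by simp
  have pieces_mono: "a \<in> pieces V 0 u" if "a \<in> pieces (V - {v}) 0 u" for a u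
    using that by (cases u) (auto simp: pieces_Suc intro: hp_mono)
  \<comment> \<open>The substitution can remove only \<open>v\<close> from a support, and over a
    cone this never turns a non-face into a face.\<close>
  have null: "?\<pi> a \<in> sr_ideal \<Delta>" if "a \<in> poly_ring V" "a \<in> sr_ideal \<Delta>" for a
  proof (rule psubst_sr_ideal[where R = "\<lambda>A B. A - {v} \<subseteq> B", OF _ _ _ that])
    fix A B w l assume "A - {v} \<subseteq> B" "l \<in> keys ((pvar(v := L)) w)"
    then show "insert w A - {v} \<subseteq> B \<union> keys l" by (auto simp: pvar_def)
  next
    fix A B assume "A - {v} \<subseteq> B" "B \<in> \<Delta>"
    then show "A \<in> \<Delta>" using downD[OF down cone, of B A] by auto
  qed auto
  interpret koszul_kill I \<theta> "pieces V 0" "sr_ideal \<Delta>" e \<theta>' "pieces (V - {v}) 0" "sr_ideal \<Delta>" ?\<pi>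
  proof (intro koszul_kill.intro koszul_kill_axioms.intro koszul_sr fin \<theta> \<theta>'_hp down e)
    show "finite (I - {e})" using fin by simp
    show "pieces V 0 0 = {0}" by simp
    show "?\<pi> (a + b) = ?\<pi> a + ?\<pi> b" for a b by (rule psubst_add)
    show "?\<pi> (cst c * a) = cst c * ?\<pi> a" for c a by (simp add: psubst_mult)
    show "?\<pi> a \<in> pieces (V - {v}) 0 u" if "a \<in> pieces V 0 u" for a u
      using that \<pi>_hp by (cases u) (auto simp: pieces_Suc)
    show "\<exists>a\<in>pieces V 0 u. ?\<pi> a - w \<in> sr_ideal \<Delta>" if "w \<in> pieces (V - {v}) 0 u" for w u
      using pieces_mono[OF that] \<pi>_id[OF pieces_poly_ring[OF that]]
      by (intro bexI[of _ w]) (simp_all add: csub_0[OF csub_sr_ideal])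
    show "?\<pi> a \<in> sr_ideal \<Delta>" if "a \<in> pieces V 0 u" "a \<in> sr_ideal \<Delta>" for a u
      using null that pieces_poly_ring by blast
    show "?\<pi> (\<theta> i * a) - \<theta>' i * ?\<pi> a \<in> sr_ideal \<Delta>" if "i \<in> I - {e}" for i a
      by (simp add: \<theta>'[OF that] psubst_mult csub_0[OF csub_sr_ideal])
    show "?\<pi> (\<theta> e * a) \<in> sr_ideal \<Delta>" for a
      using \<pi>_id[OF hp_poly_ring[OF L]]
      by (simp add: \<theta>e psubst_mult psubst_diff csub_0[OF csub_sr_ideal])
    show "\<exists>b\<in>pieces V 0 u. a - \<theta> e * b \<in> sr_ideal \<Delta>"
      if "a \<in> pieces V 0 (Suc u)" "?\<pi> a \<in> sr_ideal \<Delta>" for a u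
    proof -
      from div[of a u] that(1) obtain b where b: "b \<in> pieces V 0 u" "a - ?\<pi> a = (pvar v - L) * b"
        by (auto simp: pieces_Suc)
      have "\<theta> e * (cst (1 / \<epsilon>) * b) = cst (\<epsilon> * (1 / \<epsilon>)) * ((pvar v - L) * b)"
        unfolding \<theta>e cst_mult by (simp only: ac_simps)
      also have "\<dots> = a - ?\<pi> a" using \<epsilon> by (simp add: b(2))
      finally have "a - \<theta> e * (cst (1 / \<epsilon>) * b) = ?\<pi> a" by simp
      then show ?thesis using that(2) csub_cst[OF csub_pieces b(1)] by metis
    qed
    show "a \<in> sr_ideal \<Delta>" if "\<theta> e * a \<in> sr_ideal \<Delta>" for a
    proof (rule monic_cancel[where u = \<epsilon> and s = 1 and y = v and L = "- (cst \<epsilon> * L)" and r = 0,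
          OF _ \<epsilon> _ _ down cone])
      show "\<theta> e = cst \<epsilon> * pvar v ^ 1 + - (cst \<epsilon> * L)" by (simp add: \<theta>e right_diff_distrib)
      have "- (cst \<epsilon> * L) \<in> poly_ring (V - {v})"
        using csub_uminus[OF csub_poly_ring csub_cst[OF csub_poly_ring hp_poly_ring[OF L]]] .
      then show "ydeg_less v 1 (- (cst \<epsilon> * L))"
        using ydeg_less_power_mult[of "- (cst \<epsilon> * L)" "V - {v}" v 0 1] by simp
      show "ydeg_less v 1 0" by (simp add: ydeg_less_def)
      show "\<theta> e * a + 0 \<in> sr_ideal \<Delta>" using that by simp
    qed
  qed
  show ?thesis by (rule kdim_kill[OF d])
qed

lemma sr_dim_reindex:
  assumes fin: "finite I" and mono: "strict_mono_on I \<sigma>" and down: "down \<Delta>"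
    and \<theta>: "\<And>i. i \<in> I \<Longrightarrow> \<theta>' (\<sigma> i) = \<theta> i" "\<And>i. i \<in> I \<Longrightarrow> \<theta> i \<in> hp V 1"
    and d: "sr_dim I \<theta> V \<Delta> t s d"
  shows "sr_dim (\<sigma> ` I) \<theta>' V \<Delta> t s d"
proof (rule kdim_reindex[OF koszul_sr koszul_sr mono _ d])
  show "\<theta>' j \<in> hp V 1" if "j \<in> \<sigma> ` I" for j using that \<theta> by auto
qed (use assms in auto)

section \<open>Finite-dimensionality\<close>

lemma finite_monomials:
  assumes "finite V"
  shows "finite {m :: 'v \<Rightarrow>\<^sub>0 nat. keys m \<subseteq> V \<and> mdeg m = s}"
proof -
  have "inj_on (\<lambda>m. restrict (lookup m) V)
      {m :: 'v \<Rightarrow>\<^sub>0 nat. keys m \<subseteq> V \<and> mdeg m = s}"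
  proof (rule inj_onI)
    fix a b :: "'v \<Rightarrow>\<^sub>0 nat"
    assume a: "a \<in> {m. keys m \<subseteq> V \<and> mdeg m = s}"
      and b: "b \<in> {m. keys m \<subseteq> V \<and> mdeg m = s}"
      and eq: "restrict (lookup a) V = restrict (lookup b) V"
    show "a = b"
    proof (rule poly_mapping_eqI)
      fix v
      show "lookup a v = lookup b v"
      proof (cases "v \<in> V")
        case True
        then show ?thesis using fun_cong[OF eq, of v] by simp
      next
        case False
        then have "v \<notin> keys a" "v \<notin> keys b" using a b by auto
        then show ?thesis by (simp add: in_keys_iff)
      qed
    qed
  qed
  moreover have "lookup m v \<le> s" if "mdeg m = s" for m :: "'v \<Rightarrow>\<^sub>0 nat" and v
    using that member_le_sum[of v "keys m" "lookup m"]
    by (cases "v \<in> keys m") (auto simp: mdeg_def in_keys_iff)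
  then have "(\<lambda>m. restrict (lookup m) V) `
      {m :: 'v \<Rightarrow>\<^sub>0 nat. keys m \<subseteq> V \<and> mdeg m = s} \<subseteq> PiE V (\<lambda>_. {..s})"
    by auto
  ultimately show ?thesis
    using finite_PiE[OF assms, of "\<lambda>_. {..s}"] by (meson finite_atMost finite_imageD finite_subset)
qed

text \<open>A chain is determined by finitely many coefficients. Existence is indispensable, because
  a dimension defined by \<open>THE\<close> says nothing without it.\<close>

lemma sr_dim_exists:
  assumes V: "finite V" and K: "koszul I \<theta> (pieces V 0) (sr_ideal \<Delta>)"
  shows "\<exists>d. sr_dim I \<theta> V \<Delta> t s d"
proof -
  interpret koszul I \<theta> "pieces V 0" "sr_ideal \<Delta>" by (rule K)
  show ?thesis
    unfolding kdim_def
  proof (rule qdim_exists[where co = "\<lambda>(T, m) f. lookup (f T) m"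
        and Q = "Pow I \<times> {m. keys m \<subseteq> V \<and> mdeg m = s}",
        OF vector_space_fsc _ kcyc_sub kbd_sub])
    show "finite (Pow I \<times> {m. keys m \<subseteq> V \<and> mdeg m = s})"
      using fin finite_monomials[OF V] by blast
    fix f assume "f \<in> kcyc I \<theta> (pieces V 0) (sr_ideal \<Delta>) t s"
    then have f: "f \<in> kch I (pieces V 0) t (Suc s)" by (simp add: kcyc_def)
    assume z: "\<And>q. q \<in> Pow I \<times> {m. keys m \<subseteq> V \<and> mdeg m = s} \<Longrightarrow>
      (case q of (T, m) \<Rightarrow> \<lambda>f. lookup (f T) m) f = 0"
    show "f = 0"
    proof
      fix T
      have "lookup (f T) m = 0" for m
      proof (rule ccontr)
        assume nz: "lookup (f T) m \<noteq> 0"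
        have "T \<subseteq> I"
        proof (rule ccontr)
          assume "\<not> T \<subseteq> I"
          then have "f T = 0" by (intro kch_0[OF f]) simp
          then show False using nz by simp
        qed
        moreover have "f T \<in> hp V s" using kch_all[OF f] by (simp add: pieces_Suc)
        then have "keys m \<subseteq> V \<and> mdeg m = s" using nz by (auto simp: hp_iff in_keys_iff)
        ultimately show False using z[of "(T, m)"] nz by simp
      qed
      then show "f T = 0 T" by (simp add: zero_fun_def poly_mapping_eqI)
    qed
  qed (auto simp: plus_fun_def lookup_add fsc_def)
qed

section \<open>Comparison with the definition of Tor\<close>

lemma sr_dim_faces_cong:
  assumes fin: "finite I" and \<theta>: "\<And>i. i \<in> I \<Longrightarrow> \<theta> i \<in> hp V 1" and down: "down \<Delta>" "down \<Gamma>"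
    and eq: "\<And>A. A \<subseteq> V \<Longrightarrow> A \<in> \<Gamma> \<longleftrightarrow> A \<in> \<Delta>" and d: "sr_dim I \<theta> V \<Delta> t s d"
  shows "sr_dim I \<theta> V \<Gamma> t s d"
proof (rule sr_dim_iso[where \<phi> = "\<lambda>a. a" and \<psi> = "\<lambda>a. a",
      OF koszul_sr[OF fin \<theta> down(1)] koszul_sr[OF fin \<theta> down(2)] _ _ _ _ _ _ _ _ _ _ d])
  show "a \<in> sr_ideal \<Gamma>" if "a \<in> poly_ring V" "a \<in> sr_ideal \<Delta>" for a
    using that eq by (auto simp: sr_ideal_def poly_ring_def)
  show "a \<in> sr_ideal \<Delta>" if "a \<in> poly_ring V" "a \<in> sr_ideal \<Gamma>" for a
    using that eq by (auto simp: sr_ideal_def poly_ring_def)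
qed (simp_all add: csub_0[OF csub_sr_ideal])

lemma chain_scale_eq: "chain_scale c f = Poly_Mapping.map (\<lambda>p. cst c * p) f"
  unfolding chain_scale_def cst_def by (simp add: mult_map_scale_conv_mult[abs_def])

lemma lookup_chain_scale: "lookup (chain_scale c f) T = cst c * lookup f T"
  unfolding chain_scale_eq by transfer (simp add: when_def)

lemma vector_space_chain_scale: "vector_space chain_scale"
  by unfold_locales
    (auto intro!: poly_mapping_eqI simp: lookup_chain_scale lookup_add algebra_simps cst_add cst_mult)

lemma quot_basis_qfam: "quot_basis Z B C \<longleftrightarrow> qfam chain_scale Z B C id"
  by (auto simp: quot_basis_def qfam_def)

text \<open>A numbered family becomes a set basis through its image, with the same cardinality by
  injectivity; uniqueness of the cardinality makes the definite description denote
  \<open>d\<close>.\<close>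

lemma quot_dim_eqI:
  assumes d: "qdim chain_scale Z B d" and B: "module.subspace chain_scale B"
  shows "quot_dim Z B = d"
proof -
  from d obtain b where b: "qfam chain_scale Z B {..<d} b"
    unfolding qdim_def[OF vector_space_chain_scale] by (elim exE)
  have inj: "inj_on b {..<d}" by (rule qfam_inj_on[OF vector_space_chain_scale b B])
  have "bij_betw (the_inv_into {..<d} b) (b ` {..<d}) {..<d}"
    using inj by (intro bij_betw_the_inv_into) (simp add: bij_betw_def)
  from qfam_reindex[OF vector_space_chain_scale b this]
  have "qfam chain_scale Z B (b ` {..<d}) (b \<circ> the_inv_into {..<d} b)" .
  moreover have "(b \<circ> the_inv_into {..<d} b) c = id c" if "c \<in> b ` {..<d}" for c
    using that by (simp add: f_the_inv_into_f[OF inj])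
  ultimately have "qfam chain_scale Z B (b ` {..<d}) id"
    unfolding qfam_def by (simp cong: sum.cong)
  then have "quot_basis Z B (b ` {..<d})" by (simp add: quot_basis_qfam)
  moreover have "card (b ` {..<d}) = d" using inj by (simp add: card_image)
  moreover have "card C = d" if "quot_basis Z B C" for C
    using qfam_card_unique[OF vector_space_chain_scale _ b B] that quot_basis_qfam by fastforce
  ultimately show ?thesis unfolding quot_dim_def by (intro the_equality) auto
qed

text \<open>\<open>koszul_d\<close> sums over source sets, \<open>kd\<close> over the sets above a
  given target; the pairs \<open>(S, i)\<close> with \<open>S - {i} = T\<close> correspond to the
  indices \<open>i\<close> outside \<open>T\<close>.\<close>

lemma lookup_koszul_d:
  assumes "\<And>T. T \<in> keys f \<Longrightarrow> T \<subseteq> {1..<n}"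
  shows "lookup (koszul_d A n f) T
    = kd {1..<n} (\<lambda>i. act A i - act A n) (lookup f) T"
proof -
  let ?f = "lookup f" and ?\<theta> = "\<lambda>i. act A i - act A n"
  let ?g = "\<lambda>S i. (- 1) ^ card {j \<in> S. j \<le> i} * (?\<theta> i * ?f S)"
  have fin: "finite S" if "S \<in> keys f" for S
    using assms[OF that] finite_subset by blast
  have "lookup (koszul_d A n f) T
      = (\<Sum>S\<in>keys f. \<Sum>i\<in>S. if S - {i} = T then ?g S i else 0)"
    by (simp add: koszul_d_def lookup_sum lookup_single when_def)
  also have "\<dots> = (\<Sum>(S, i)\<in>(SIGMA S:keys f. S). if S - {i} = T then ?g S i else 0)"
    using fin by (subst sum.Sigma) auto
  also have "\<dots> = (\<Sum>(S, i)\<in>{(S, i). S \<in> keys f \<and> i \<in> S \<and> S - {i} = T}. ?g S i)"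
    using fin by (intro sum.mono_neutral_cong_right) (auto intro!: finite_SigmaI split: if_splits)
  also have "{(S, i). S \<in> keys f \<and> i \<in> S \<and> S - {i} = T}
      = (\<lambda>i. (insert i T, i)) ` {i \<in> {1..<n} - T. insert i T \<in> keys f}" (is "?L = ?R")
  proof (intro equalityI subsetI)
    fix x assume "x \<in> ?L"
    then obtain S i where x: "x = (S, i)" "S \<in> keys f" "i \<in> S" "S - {i} = T" by auto
    then have S: "S = insert i T" "i \<notin> T" by auto
    moreover have "i \<in> {1..<n}" using assms[OF x(2)] x(3) by blast
    ultimately have "i \<in> {i \<in> {1..<n} - T. insert i T \<in> keys f}" using x(2) by simp
    then show "x \<in> ?R" using x(1) S(1) by blast
  qed auto
  also have "(\<Sum>(S, i)\<in>?R. ?g S i)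
      = (\<Sum>i\<in>{i \<in> {1..<n} - T. insert i T \<in> keys f}. ?g (insert i T) i)"
    by (subst sum.reindex) (auto intro: inj_onI)
  also have "\<dots> = (\<Sum>i\<in>{1..<n} - T. ?g (insert i T) i)"
    by (intro sum.mono_neutral_left) (auto simp: in_keys_iff)
  finally show ?thesis by (simp add: kd_def ksg_def)
qed

text \<open>\<open>lookup\<close> identifies finitely supported chains with functions and matches
  cycles, boundaries and scalars. The two ideals are compared only on the polynomial ring, since
  \<open>sr_ideal\<close> may contain polynomials in other variables; all coefficients that occur
  stay inside that ring.\<close>

theorem tor_dim_eq:
  fixes A :: "'v graded_alg"
  assumes V: "finite (vars A)" and down: "down \<Delta>"
    and rel: "\<And>p. p \<in> poly_ring (vars A) \<Longrightarrow> p \<in> rel_ideal A \<longleftrightarrow> p \<in> sr_ideal \<Delta>"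
    and act: "\<And>i. i \<in> {1..n} \<Longrightarrow> act A i \<in> hp (vars A) 1"
  shows "sr_dim {1..<n} (\<lambda>i. act A i - act A n) (vars A) \<Delta> t s (tor_dim A n t s)"
proof -
  let ?V = "vars A" and ?I = "{1..<n}" and ?\<theta> = "\<lambda>i. act A i - act A n"
  let ?lk = "lookup :: 'v chain \<Rightarrow> _" and ?N = "sr_ideal \<Delta>"
  have \<theta>: "?\<theta> i \<in> hp ?V 1" if "i \<in> ?I" for i
    using that by (intro csub_diff[OF csub_hp] act) auto
  interpret koszul ?I ?\<theta> "pieces ?V 0" ?N by (rule koszul_sr[OF _ \<theta> down]) simp
  have ring: "pieces ?V 0 u \<subseteq> poly_ring ?V" for u using pieces_poly_ring by blast
  have ch: "f \<in> chains A n t s \<longleftrightarrow> ?lk f \<in> kch ?I (pieces ?V 0) t (Suc s)" for f t s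
  proof
    assume f: "f \<in> chains A n t s"
    show "?lk f \<in> kch ?I (pieces ?V 0) t (Suc s)"
    proof (rule kchI)
      show "?lk f T \<in> pieces ?V 0 (Suc s)" for T
        using f csub_0[OF csub_hp]
        by (cases "T \<in> keys f") (auto simp: chains_def pieces_Suc hp_def in_keys_iff)
      show "?lk f T = 0" if "\<not> (T \<subseteq> ?I \<and> card T = t)" for T
        using f that by (cases "T \<in> keys f") (auto simp: chains_def in_keys_iff)
    qed
  next
    assume f: "?lk f \<in> kch ?I (pieces ?V 0) t (Suc s)"
    have "?lk f T \<in> hp ?V s" for T using kch_all[OF f] by (simp add: pieces_Suc)
    moreover have "T \<subseteq> ?I \<and> card T = t" if "T \<in> keys f" for T
    proof (rule ccontr)
      assume "\<not> ?thesis"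
      from kch_0[OF f this] that show False by (simp add: in_keys_iff)
    qed
    ultimately show "f \<in> chains A n t s" by (auto simp: chains_def hp_def)
  qed
  have d: "?lk (koszul_d A n f) T = kd ?I ?\<theta> (?lk f) T" if "f \<in> chains A n t s" for f t s T
    using that by (intro lookup_koszul_d) (auto simp: chains_def)
  have kd_ring: "kd ?I ?\<theta> g T \<in> poly_ring ?V" if "g \<in> kch ?I (pieces ?V 0) t u" for g t u T
    using kd_mem[OF that] ring by blast
  have onto: "\<exists>f. ?lk f = g" if "g \<in> kch ?I (pieces ?V 0) t u" for g t u
  proof -
    have "g T = 0" if "\<not> T \<subseteq> ?I" for T
      using that by (intro kch_0[OF \<open>g \<in> _\<close>]) simp
    then have "{T. g T \<noteq> 0} \<subseteq> Pow ?I" by blast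
    then have "finite {T. g T \<noteq> 0}" by (rule finite_subset) simp
    then show ?thesis by (intro exI[of _ "Abs_poly_mapping g"]) (simp add: lookup_Abs_poly_mapping)
  qed
  have cyc: "f \<in> cycles A n t s \<longleftrightarrow> ?lk f \<in> kcyc ?I ?\<theta> (pieces ?V 0) ?N t s" for f
    using rel kd_ring ch d by (auto simp: cycles_def kcyc_def null_chain_def)
  \<comment> \<open>The case \<open>s = 0\<close> of \<open>boundaries\<close>, where only the zero
    chain maps in, is modelled by the zero piece at index 0.\<close>
  have zero_ch: "g = 0 \<longleftrightarrow> ?lk g \<in> kch ?I (pieces ?V 0) (Suc t) 0" for g
  proof
    assume "?lk g \<in> kch ?I (pieces ?V 0) (Suc t) 0"
    from kch_all[OF this] show "g = 0" by (intro poly_mapping_eqI) simp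
  next
    assume "g = 0"
    then have "?lk g = 0" by (simp add: fun_eq_iff zero_fun_def)
    then show "?lk g \<in> kch ?I (pieces ?V 0) (Suc t) 0" using kch_zero by simp
  qed
  define G where "G = (case s of 0 \<Rightarrow> {0} | Suc s' \<Rightarrow> chains A n (Suc t) s')"
  have G: "g \<in> G \<longleftrightarrow> ?lk g \<in> kch ?I (pieces ?V 0) (Suc t) s" for g
    using zero_ch ch by (auto simp: G_def split: nat.split)
  have dG: "?lk (koszul_d A n g) T = kd ?I ?\<theta> (?lk g) T" if "g \<in> G" for g T
  proof (cases s)
    case 0
    then have "g = 0" using that by (simp add: G_def)
    then show ?thesis by (intro lookup_koszul_d) simp
  next
    case (Suc s')
    then show ?thesis using that by (intro d) (auto simp: G_def)
  qed
  have bd: "f \<in> boundaries A n t s \<longleftrightarrow> ?lk f \<in> kbd ?I ?\<theta> (pieces ?V 0) ?N t s" for f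
  proof -
    have eq: "null_chain A (f - koszul_d A n g) \<longleftrightarrow> (\<forall>T. ?lk f T - kd ?I ?\<theta> (?lk g) T \<in> ?N)"
      if f: "f \<in> chains A n t s" and g: "g \<in> G" for g
    proof -
      have "?lk f T - kd ?I ?\<theta> (?lk g) T \<in> poly_ring ?V" for T
        using kch_all[OF iffD1[OF ch f]] ring kd_ring[OF iffD1[OF G g]]
        by (intro csub_diff[OF csub_poly_ring]) blast+
      then show ?thesis by (simp add: null_chain_def lookup_minus dG[OF g] rel)
    qed
    have "f \<in> boundaries A n t s \<longleftrightarrow> f \<in> chains A n t s \<and> (\<exists>g\<in>G. null_chain A (f - koszul_d A n g))"
      by (simp add: boundaries_def G_def)
    also have "\<dots> \<longleftrightarrow> f \<in> chains A n t s \<and> (\<exists>g\<in>G. \<forall>T. ?lk f T - kd ?I ?\<theta> (?lk g) T \<in> ?N)"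
      using eq by blast
    also have "\<dots> \<longleftrightarrow> f \<in> chains A n t s \<and>
        (\<exists>g\<in>kch ?I (pieces ?V 0) (Suc t) s. \<forall>T. ?lk f T - kd ?I ?\<theta> g T \<in> ?N)"
      using G onto by metis
    finally show ?thesis by (simp add: kbd_def ch)
  qed
  have lk_add: "?lk (x + y) = ?lk x + ?lk y" for x y by (simp add: fun_eq_iff lookup_add plus_fun_def)
  have lk_sc: "?lk (chain_scale c x) = fsc c (?lk x)" for c x
    by (simp add: fun_eq_iff lookup_chain_scale fsc_def)
  have lk_0: "?lk 0 = 0" by (simp add: fun_eq_iff zero_fun_def)
  interpret F: vector_space fsc by (rule vector_space_fsc)
  interpret C: vector_space chain_scale by (rule vector_space_chain_scale)
  have Zs: "C.subspace (cycles A n t s)"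
    using F.subspace_0[OF kcyc_sub] F.subspace_add[OF kcyc_sub] F.subspace_scale[OF kcyc_sub]
    by (intro C.subspaceI) (simp_all only: cyc lk_add lk_sc lk_0)
  have Bs: "C.subspace (boundaries A n t s)"
    using F.subspace_0[OF kbd_sub] F.subspace_add[OF kbd_sub] F.subspace_scale[OF kbd_sub]
    by (intro C.subspaceI) (simp_all only: bd lk_add lk_sc lk_0)
  obtain d where dd: "sr_dim ?I ?\<theta> ?V \<Delta> t s d"
    using sr_dim_exists[OF V koszul_axioms] by blast
  have "qdim chain_scale (cycles A n t s) (boundaries A n t s) d"
  proof (rule qdim_lift[where \<phi> = ?lk, OF vector_space_chain_scale vector_space_fsc Bs kbd_sub Zs
        lk_add lk_sc _ _ _ dd[unfolded kdim_def]])
    fix z assume z: "z \<in> kcyc ?I ?\<theta> (pieces ?V 0) ?N t s"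
    then obtain f where f: "?lk f = z" using onto unfolding kcyc_def by blast
    then have "f \<in> cycles A n t s" using z cyc by simp
    moreover have "z - ?lk f \<in> kbd ?I ?\<theta> (pieces ?V 0) ?N t s"
      using F.subspace_0[OF kbd_sub] f by simp
    ultimately show "\<exists>f\<in>cycles A n t s. z - ?lk f \<in> kbd ?I ?\<theta> (pieces ?V 0) ?N t s" by blast
  qed (simp_all add: cyc bd)
  from quot_dim_eqI[OF this Bs] dd show ?thesis by (simp add: tor_dim_def)
qed

section \<open>Ideals generated by squarefree monomials\<close>

lemma ideal_gen_add:
  assumes "p \<in> ideal_gen (poly_ring V) G" "q \<in> ideal_gen (poly_ring V) G"
  shows "p + q \<in> ideal_gen (poly_ring V) G"
proof -
  from assms obtain a E b F where
    E: "p = (\<Sum>g\<in>E. a g * g)" "finite E" "E \<subseteq> G" "\<forall>g\<in>E. a g \<in> poly_ring V" and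
    F: "q = (\<Sum>g\<in>F. b g * g)" "finite F" "F \<subseteq> G" "\<forall>g\<in>F. b g \<in> poly_ring V"
    unfolding ideal_gen_def by blast
  define c where "c g = (if g \<in> E then a g else 0) + (if g \<in> F then b g else 0)" for g
  have "(\<Sum>g\<in>E \<union> F. c g * g)
      = (\<Sum>g\<in>E \<union> F. (if g \<in> E then a g * g else 0)) + (\<Sum>g\<in>E \<union> F. (if g \<in> F then b g * g else 0))"
    unfolding sum.distrib[symmetric] by (intro sum.cong) (auto simp: c_def distrib_right)
  also have "(\<Sum>g\<in>E \<union> F. (if g \<in> E then a g * g else 0)) = p"
    unfolding E(1) using E F by (intro sum.mono_neutral_cong_right) auto
  also have "(\<Sum>g\<in>E \<union> F. (if g \<in> F then b g * g else 0)) = q"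
    unfolding F(1) using E F by (intro sum.mono_neutral_cong_right) auto
  finally have "p + q = (\<Sum>g\<in>E \<union> F. c g * g)" by simp
  moreover have "\<forall>g\<in>E \<union> F. c g \<in> poly_ring V"
    using E F by (auto simp: c_def poly_ring_0 intro: poly_ring_add)
  ultimately show ?thesis using E F unfolding ideal_gen_def by blast
qed

text \<open>Both sides are decided monomial by monomial: a support containing \<open>S\<close> means
  divisibility by the generator of \<open>S\<close>.\<close>

lemma ideal_gen_squarefree:
  assumes S: "\<And>S. S \<in> \<S> \<Longrightarrow> finite S \<and> S \<subseteq> V" and p: "p \<in> poly_ring V"
  shows "p \<in> ideal_gen (poly_ring V) {\<Prod>v\<in>S. pvar v | S. S \<in> \<S>} \<longleftrightarrow> p \<in> sr_ideal {A. \<forall>S\<in>\<S>. \<not> S \<subseteq> A}"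
    (is "_ \<in> ?I \<longleftrightarrow> _ \<in> sr_ideal ?\<Delta>")
proof
  have down: "down ?\<Delta>" unfolding down_def by blast
  assume "p \<in> ?I"
  then obtain q F where q: "p = (\<Sum>g\<in>F. q g * g)" "F \<subseteq> {\<Prod>v\<in>S. pvar v | S. S \<in> \<S>}"
    unfolding ideal_gen_def by blast
  have "g \<in> sr_ideal ?\<Delta>" if "g \<in> F" for g
  proof -
    have "g \<in> {\<Prod>v\<in>S. pvar v | S. S \<in> \<S>}" using q(2) that by (rule subsetD)
    then obtain T where T: "g = (\<Prod>v\<in>T. pvar v)" "T \<in> \<S>" by blast
    then show ?thesis using S[of T] by (auto intro!: prod_pvar_sr_ideal)
  qed
  then show "p \<in> sr_ideal ?\<Delta>"
    unfolding q(1) by (intro csub_sum[OF csub_sr_ideal] sr_ideal_mult[OF down])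
next
  assume p': "p \<in> sr_ideal ?\<Delta>"
  show "p \<in> ?I"
  proof (induction p rule: cpoly_sum_induct)
    case (single m c)
    then obtain T where T: "T \<in> \<S>" "T \<subseteq> keys m" and m: "keys m \<subseteq> V"
      using p p' by (auto simp: sr_ideal_def poly_ring_def)
    from monomial_factor[OF T(2)] obtain h where h: "h \<in> poly_ring (keys m)"
      "single m c = (\<Prod>v\<in>T. pvar v) * h" by blast
    show ?case unfolding ideal_gen_def
      using T(1) h poly_ring_mono[OF h(1) m]
      by (auto intro!: exI[of _ "{\<Prod>v\<in>T. pvar v}"] exI[of _ "\<lambda>_. h"] simp: mult.commute)
  next
    case zero
    show ?case unfolding ideal_gen_def by (auto intro!: exI[of _ "{}"])
  next
    case (add p q)
    then show ?case using ideal_gen_add by blast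
  qed
qed

section \<open>The barycentric subdivision of a skeleton\<close>

definition comparable :: "'a set \<Rightarrow> 'a set \<Rightarrow> bool"
  where "comparable G H \<longleftrightarrow> G \<subseteq> H \<or> H \<subseteq> G"

text \<open>The order complex of \<open>V\<close> under inclusion.\<close>

definition chain_complex :: "'a set set \<Rightarrow> 'a set set set"
  where "chain_complex V = {A. A \<subseteq> V \<and> (\<forall>G\<in>A. \<forall>H\<in>A. comparable G H)}"

lemma down_chain_complex: "down (chain_complex V)"
  unfolding down_def chain_complex_def by blast

abbreviation singles :: "'a set \<Rightarrow> 'a set set"
  where "singles F \<equiv> (\<lambda>i. {i}) ` F"

text \<open>The linear form by which \<open>x\<^sub>i\<close> acts.\<close>

definition lin :: "nat set set \<Rightarrow> nat \<Rightarrow> nat set cpoly"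
  where "lin V i = (\<Sum>G\<in>{G \<in> V. i \<in> G}. pvar G)"

lemma lin_hp: "lin V i \<in> hp V 1"
  unfolding lin_def by (intro csub_sum[OF csub_hp] hp_pvar) auto

lemma lin_hp_sub: "(\<And>G. G \<in> V \<Longrightarrow> i \<in> G \<Longrightarrow> G \<in> W) \<Longrightarrow> lin V i \<in> hp W 1"
  unfolding lin_def by (intro csub_sum[OF csub_hp] hp_pvar) auto

lemma lin_diff_hp: "lin V i - lin V c \<in> hp V 1"
  by (intro csub_diff[OF csub_hp] lin_hp)

text \<open>Variables that are no vertices vanish in the quotient, so enlarging the set of variables
  changes each \<open>lin\<close> only by an element of the ideal.\<close>

lemma sr_dim_extend_vars:
  assumes fin: "finite I" "finite V" and VW: "U \<subseteq> V" and down: "down \<Delta>" and vert: "\<And>A. A \<in> \<Delta> \<Longrightarrow> A \<subseteq> U"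
    and d: "sr_dim I (\<lambda>i. lin U i - lin U c) U \<Delta> t s d"
  shows "sr_dim I (\<lambda>i. lin V i - lin V c) V \<Delta> t s d"
proof (rule sr_dim_relabel[where g = "\<lambda>v. v", OF fin(1) _ _ down down _ _ lin_diff_hp lin_diff_hp _ d])
  have "lin U i - lin V i \<in> sr_ideal \<Delta>" for i
  proof -
    have "lin V i = lin U i + (\<Sum>G\<in>{G \<in> V - U. i \<in> G}. pvar G)"
      unfolding lin_def using fin(2) VW finite_subset[OF VW fin(2)]
      by (subst sum.union_disjoint[symmetric]) (auto intro!: sum.cong)
    moreover have "(\<Sum>G\<in>{G \<in> V - U. i \<in> G}. pvar G) \<in> sr_ideal \<Delta>"
      using vert by (intro csub_sum[OF csub_sr_ideal]) (auto simp: sr_ideal_def pvar_def)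
    ultimately show ?thesis using csub_uminus[OF csub_sr_ideal] by simp
  qed
  from csub_diff[OF csub_sr_ideal this this]
  show "psubst (\<lambda>v. pvar v) (lin U i - lin U c) - (lin V i - lin V c) \<in> sr_ideal \<Delta>" for i
    unfolding psubst_id[where V = UNIV and \<sigma> = "\<lambda>v. pvar v" and p = "lin U i - lin U c",
        OF _ refl, simplified poly_ring_def, simplified]
    by (simp add: algebra_simps)
qed (use VW vert in auto)

text \<open>The skeleton of the simplex on \<open>{1..n}\<close> after subdividing the faces in \<open>FF\<close>. A face consists
  of the singletons of a face of the skeleton not containing a member of \<open>FF\<close>, and a chain
  in \<open>FF\<close> above it.\<close>

locale skeleton =
  fixes n r :: nat
  assumes r: "0 < r" "r < n"
begin

text \<open>The flats at which a subdivision takes place; singletons are left out because their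
  vertices are present from the start.\<close>

definition big :: "nat set set"
  where "big = {G. G \<subseteq> {1..n} \<and> 2 \<le> card G \<and> card G < r}"

definition vs :: "nat set set \<Rightarrow> nat set set"
  where "vs FF = singles {1..n} \<union> FF"

definition subdiv :: "nat set set \<Rightarrow> nat set set set"
  where "subdiv FF = {A. A \<subseteq> vs FF \<and> (\<forall>G\<in>A \<inter> FF. \<forall>H\<in>A. comparable G H) \<and>
    card {i. {i} \<in> A} < r \<and> (\<forall>G\<in>FF. \<not> singles G \<subseteq> A)}"

lemma subdivI:
  "A \<subseteq> vs FF \<Longrightarrow> (\<And>G H. G \<in> A \<inter> FF \<Longrightarrow> H \<in> A \<Longrightarrow> comparable G H) \<Longrightarrow>
    card {i. {i} \<in> A} < r \<Longrightarrow> (\<And>G. G \<in> FF \<Longrightarrow> \<not> singles G \<subseteq> A) \<Longrightarrow> A \<in> subdiv FF"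
  unfolding subdiv_def by simp

lemma finite_big: "finite big"
  by (rule finite_subset[of _ "Pow {1..n}"]) (auto simp: big_def)

lemma finite_vs: "FF \<subseteq> big \<Longrightarrow> finite (vs FF)"
  using finite_subset[OF _ finite_big] by (simp add: vs_def)

lemma finite_base: "A \<subseteq> vs FF \<Longrightarrow> FF \<subseteq> big \<Longrightarrow> finite {i. {i} \<in> A}"
  by (rule finite_subset[of _ "{1..n}"]) (auto simp: vs_def big_def)

lemma down_subdiv: assumes "FF \<subseteq> big" shows "down (subdiv FF)"
  unfolding down_def
proof (intro ballI allI impI)
  fix A B assume A: "A \<in> subdiv FF" and B: "B \<subseteq> A"
  have "card {i. {i} \<in> B} \<le> card {i. {i} \<in> A}"
    using A B finite_base[OF _ assms] by (intro card_mono) (auto simp: subdiv_def)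
  then show "B \<in> subdiv FF" using A B unfolding subdiv_def by fastforce
qed

lemma big_not_single: "G \<in> big \<Longrightarrow> G \<noteq> {i}"
  by (auto simp: big_def)

lemma big_not_le_single: "G \<in> big \<Longrightarrow> \<not> G \<subseteq> {i}"
  using big_not_single[of G i] by (auto simp: big_def subset_singleton_iff)

lemma big_finite: "G \<in> big \<Longrightarrow> finite G"
  using finite_subset[of G "{1..n}"] by (simp add: big_def)

lemma comparable_single: "G \<in> big \<Longrightarrow> comparable G {i} \<longleftrightarrow> i \<in> G"
  using big_not_le_single[of G i] by (auto simp: comparable_def)

end

text \<open>The order of the subdivisions is kept implicit: \<open>FF\<close> holds the flats
  treated so far, is closed under larger flats, and a member \<open>F\<close> that is minimal under
  inclusion can be taken as the last one treated.\<close>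

locale subdivision_step = skeleton +
  fixes FF F
  assumes FF: "FF \<subseteq> big" and up: "\<And>G H. G \<in> FF \<Longrightarrow> H \<in> big \<Longrightarrow> G \<subseteq> H \<Longrightarrow> H \<in> FF"
    and F_in: "F \<in> FF" and min: "\<And>G. G \<in> FF \<Longrightarrow> G \<subseteq> F \<Longrightarrow> G = F"
begin

definition FF' where "FF' = FF - {F}"

lemma FF': "FF' \<subseteq> big"
  using FF by (auto simp: FF'_def)

lemma F_big: "F \<in> big"
  using F_in FF by auto

lemma F_sub: "F \<subseteq> {1..n}"
  using F_big by (simp add: big_def)

lemma FF_eq: "FF = insert F FF'"
  using F_in by (auto simp: FF'_def)

lemma vs_eq: "vs FF = insert F (vs FF')"
  unfolding vs_def by (subst FF_eq) simp

lemma FF_iff: "G \<in> FF \<longleftrightarrow> G = F \<or> G \<in> FF'"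
  using F_in by (auto simp: FF'_def)

lemma ball_FF: "(\<forall>G\<in>FF. P G) \<longleftrightarrow> P F \<and> (\<forall>G\<in>FF'. P G)"
  using F_in by (auto simp: FF'_def)

lemma F_notin: "F \<notin> vs FF'"
  using big_not_single[OF F_big] by (auto simp: vs_def FF'_def)

text \<open>A vertex \<open>{i}\<close> outside \<open>F\<close> would put all of
  \<open>insert i F\<close> into the base of a face. So this set has fewer than \<open>r\<close>
  elements and is a flat above \<open>F\<close>; it has already been subdivided, and its vertices no
  longer span a face. A vertex from \<open>FF'\<close> must be comparable to all \<open>{i}\<close>
  with \<open>i \<in> F\<close>, hence contains \<open>F\<close>.\<close>

lemma join_face:
  assumes B: "A \<union> singles F \<in> subdiv FF'"
  shows "{i} \<in> A \<Longrightarrow> i \<in> F" "G \<in> A \<Longrightarrow> G \<in> FF' \<Longrightarrow> F \<subseteq> G"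
proof -
  have sub: "A \<union> singles F \<subseteq> vs FF'" and cd: "card {i. {i} \<in> A \<union> singles F} < r"
    and no: "\<And>G. G \<in> FF' \<Longrightarrow> \<not> singles G \<subseteq> A \<union> singles F"
    and cmp: "\<And>G H. G \<in> A \<Longrightarrow> G \<in> FF' \<Longrightarrow> H \<in> A \<union> singles F \<Longrightarrow> comparable G H"
    using B by (auto simp: subdiv_def)
  show "i \<in> F" if i: "{i} \<in> A"
  proof (rule ccontr)
    assume iF: "i \<notin> F"
    have "insert i F \<subseteq> {i. {i} \<in> A \<union> singles F}" using i by auto
    then have "card (insert i F) < r"
      using card_mono[OF finite_base[OF sub FF']] cd by (meson le_less_trans)
    moreover have "i \<in> {1..n}" using i sub big_not_single FF' by (fastforce simp: vs_def)
    moreover have "card (insert i F) = Suc (card F)" using iF big_finite[OF F_big] by simp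
    ultimately have "insert i F \<in> big" using F_big by (simp add: big_def)
    from up[OF F_in this] have "insert i F \<in> FF'" using iF by (auto simp: FF'_def)
    from no[OF this] show False using i by auto
  qed
  show "F \<subseteq> G" if "G \<in> A" "G \<in> FF'"
    using cmp[OF that] comparable_single[of G] FF' that by blast
qed

lemma singles_F_sub: "singles F \<subseteq> vs FF'"
  using F_sub unfolding vs_def by blast

lemma stellar_step: "stellar (vs FF') F (singles F) (subdiv FF')"
proof
  show "finite (vs FF')" by (rule finite_vs[OF FF'])
  show "F \<notin> vs FF'" by (rule F_notin)
  show "singles F \<subseteq> vs FF'" by (rule singles_F_sub)
  show "singles F \<noteq> {}" using F_big by (auto simp: big_def)
  show "down (subdiv FF')" by (rule down_subdiv[OF FF'])
  show "A \<subseteq> vs FF'" if "A \<in> subdiv FF'" for A using that by (simp add: subdiv_def)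
qed

text \<open>For faces through the new vertex, \<open>join_face\<close> places the singletons inside
  \<open>F\<close> and the flats above \<open>F\<close>, so that everything is comparable to
  \<open>F\<close>. Conversely, comparability with \<open>F\<close> together with minimality gives
  these two facts back.\<close>

lemma sd_eq: "stellar.sd (vs FF') F (singles F) (subdiv FF') = subdiv FF"
proof -
  interpret stellar "vs FF'" F "singles F" "subdiv FF'" by (rule stellar_step)
  show ?thesis
  proof (intro set_eqI)
    fix A
    show "A \<in> sd \<longleftrightarrow> A \<in> subdiv FF"
    proof (cases "F \<in> A")
      case False
      then have *: "A \<subseteq> vs FF \<longleftrightarrow> A \<subseteq> vs FF'" "A \<inter> FF = A \<inter> FF'" by (auto simp: vs_eq FF'_def)
      have "A \<in> sd \<longleftrightarrow> A \<subseteq> vs FF \<and> \<not> singles F \<subseteq> A \<and> A \<in> subdiv FF'"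
        using False by (simp add: sd_def vs_eq)
      also have "\<dots> \<longleftrightarrow> A \<in> subdiv FF" unfolding subdiv_def mem_Collect_eq ball_FF * by blast
      finally show ?thesis .
    next
      case True
      let ?B = "A - {F} \<union> singles F"
      have single: "{i} \<in> A - {F} \<longleftrightarrow> {i} \<in> A" for i using big_not_single[OF F_big] by auto
      have bB: "{i. {i} \<in> ?B} = {i. {i} \<in> A} \<union> F" using single by auto
      show ?thesis
      proof
        assume "A \<in> sd"
        then have sub: "A \<subseteq> vs FF" and nF: "\<not> singles F \<subseteq> A" and B: "?B \<in> subdiv FF'"
          using True by (auto simp: sd_def vs_eq)
        note jf = join_face[OF B]
        have FH: "comparable F H" if "H \<in> A" for H
        proof (cases "H \<in> FF'")
          case True
          then show ?thesis using jf(2)[of H] that by (auto simp: comparable_def FF'_def)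
        next
          case False
          then show ?thesis
            using that sub jf(1) single by (auto simp: comparable_def vs_def FF_iff)
        qed
        have "comparable G H" if "G \<in> A" "G \<in> FF" "H \<in> A" for G H
        proof (cases "G = F \<or> H = F")
          case True
          then show ?thesis using FH that by (auto simp: comparable_def)
        next
          case False
          then show ?thesis using B that by (auto simp: subdiv_def FF'_def)
        qed
        moreover have "card {i. {i} \<in> A} < r"
        proof -
          have "finite {i. {i} \<in> ?B}" using B by (intro finite_base[OF _ FF']) (simp add: subdiv_def)
          then have "card {i. {i} \<in> A} \<le> card {i. {i} \<in> ?B}" unfolding bB by (intro card_mono) auto
          then show ?thesis using B by (simp add: subdiv_def)
        qed
        moreover have "\<not> singles G \<subseteq> A" if "G \<in> FF" for G
        proof (cases "G = F")
          case False
          then have "\<not> singles G \<subseteq> ?B" using B that by (auto simp: subdiv_def FF'_def)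
          then show ?thesis using single by blast
        qed (use nF in auto)
        ultimately show "A \<in> subdiv FF" using sub by (auto simp: subdiv_def)
      next
        assume A: "A \<in> subdiv FF"
        have cmp: "\<And>G H. G \<in> A \<Longrightarrow> G \<in> FF \<Longrightarrow> H \<in> A \<Longrightarrow> comparable G H"
          using A by (auto simp: subdiv_def)
        have base: "i \<in> F" if "{i} \<in> A" for i
          using cmp[OF True F_in that] comparable_single[OF F_big] by simp
        have above: "F \<subseteq> G" if "G \<in> A" "G \<in> FF" for G
          using cmp[OF True F_in that(1)] min[OF that(2)] by (auto simp: comparable_def)
        have bF: "{i. {i} \<in> ?B} = F" using bB base by auto
        have "?B \<subseteq> vs FF'" using A singles_F_sub by (auto simp: subdiv_def vs_eq)
        moreover have "comparable G H" if "G \<in> ?B \<inter> FF'" "H \<in> ?B" for G H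
        proof -
          have "G \<in> big" using that(1) FF' by blast
          then have "G \<notin> singles F" using big_not_single by blast
          then have GF: "G \<in> FF" "G \<in> A" using that(1) by (auto simp: FF'_def)
          show ?thesis
          proof (cases "H \<in> A")
            case True
            then show ?thesis by (rule cmp[OF GF(2,1)])
          next
            case False
            then have "H \<in> singles F" using that(2) by blast
            then obtain i where "H = {i}" "i \<in> F" by blast
            then show ?thesis using above[OF GF(2,1)] by (auto simp: comparable_def)
          qed
        qed
        moreover have "card {i. {i} \<in> ?B} < r" unfolding bF using F_big by (simp add: big_def)
        moreover have "\<not> singles G \<subseteq> ?B" if G: "G \<in> FF'" for G
        proof
          assume "singles G \<subseteq> ?B"
          then have "G \<subseteq> {i. {i} \<in> ?B}" by blast
          then have "G = F" using min[of G] G unfolding bF by (auto simp: FF'_def)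
          then show False using G by (simp add: FF'_def)
        qed
        ultimately have "?B \<in> subdiv FF'" by (intro subdivI)
        moreover have "A \<subseteq> vs FF" "\<not> singles F \<subseteq> A" using A F_in by (auto simp: subdiv_def)
        ultimately show "A \<in> sd" using True by (simp add: sd_def vs_eq)
      qed
    qed
  qed
qed

definition above :: "nat set set"
  where "above = {G. F \<subset> G \<and> G \<subseteq> {1..n} \<and> card G < r}"

text \<open>Singletons of elements of \<open>F\<close> are unrestricted, so each of them is a cone
  point, as the elimination of the vertices requires.\<close>

definition link_join :: "nat set set set"
  where "link_join = {A. A \<subseteq> singles F \<union> above \<and> A \<inter> above \<in> chain_complex above}"

lemma above_FF': "above \<subseteq> FF'"
proof
  fix G assume G: "G \<in> above"
  then have "card F \<le> card G" by (intro card_mono) (auto simp: above_def intro: finite_subset)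
  then have "G \<in> big" using G F_big by (simp add: above_def big_def)
  from up[OF F_in this] G show "G \<in> FF'" by (auto simp: above_def FF'_def)
qed

lemma above_iff: "G \<in> FF' \<Longrightarrow> F \<subseteq> G \<Longrightarrow> G \<in> above"
  using FF' by (auto simp: above_def big_def FF'_def)

lemma finite_above: "finite above"
  using finite_subset[OF above_FF'] finite_subset[OF FF' finite_big] by blast

lemma above_not_single: "{i} \<notin> above"
  using above_FF' FF' big_not_single by blast

lemma down_link_join: "down link_join"
  unfolding down_def link_join_def chain_complex_def by blast

text \<open>One inclusion is \<open>join_face\<close>. For the other, the base of the enlarged face
  is exactly \<open>F\<close>, which has fewer than \<open>r\<close> elements and, being minimal,
  contains no other member of \<open>FF\<close>.\<close>

lemma star_eq: "stellar.star (singles F) (subdiv FF') = link_join"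
proof -
  interpret stellar "vs FF'" F "singles F" "subdiv FF'" by (rule stellar_step)
  show ?thesis
  proof (intro equalityI subsetI)
    fix A assume "A \<in> star"
    then have B: "A \<union> singles F \<in> subdiv FF'" by (simp add: star_def)
    note jf = join_face[OF B]
    have "A \<subseteq> singles F \<union> above"
    proof
      fix G assume G: "G \<in> A"
      then have "G \<in> vs FF'" using B by (auto simp: subdiv_def)
      then show "G \<in> singles F \<union> above" using jf G above_iff by (auto simp: vs_def)
    qed
    moreover have "\<forall>G\<in>A \<inter> above. \<forall>H\<in>A \<inter> above. comparable G H"
      using B above_FF' unfolding subdiv_def by blast
    ultimately show "A \<in> link_join" by (auto simp: link_join_def chain_complex_def)
  next
    fix A assume A: "A \<in> link_join"
    have bF: "{i. {i} \<in> A \<union> singles F} = F"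
      using A above_not_single by (auto simp: link_join_def)
    have "A \<union> singles F \<subseteq> vs FF'"
      using A singles_F_sub above_FF' unfolding link_join_def vs_def by blast
    moreover have "comparable G H" if "G \<in> (A \<union> singles F) \<inter> FF'" "H \<in> A \<union> singles F" for G H
    proof -
      have "G \<in> big" using that(1) FF' by blast
      then have "G \<notin> singles F" using big_not_single by blast
      then have G: "G \<in> A" "G \<in> above" using that(1) A by (auto simp: link_join_def)
      show ?thesis
      proof (cases "H \<in> above")
        case True
        then have "H \<in> A" using that(2) above_not_single by auto
        then show ?thesis using A G True by (auto simp: link_join_def chain_complex_def)
      next
        case False
        then have "H \<in> singles F" using that(2) A by (auto simp: link_join_def)
        then show ?thesis using G by (auto simp: above_def comparable_def)
      qed
    qed
    moreover have "card {i. {i} \<in> A \<union> singles F} < r" unfolding bF using F_big by (simp add: big_def)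
    moreover have "\<not> singles G \<subseteq> A \<union> singles F" if G: "G \<in> FF'" for G
    proof
      assume "singles G \<subseteq> A \<union> singles F"
      then have "G \<subseteq> {i. {i} \<in> A \<union> singles F}" by auto
      then have "G = F" using min[of G] G unfolding bF by (auto simp: FF'_def)
      then show False using G by (simp add: FF'_def)
    qed
    ultimately have "A \<union> singles F \<in> subdiv FF'" by (intro subdivI)
    then show "A \<in> star" by (simp add: star_def)
  qed
qed

text \<open>The only vertex in \<open>singles F\<close> that can contain \<open>i\<close> is
  \<open>{i}\<close>, so the substitution adds the variable of \<open>F\<close> once, and exactly if
  \<open>i \<in> F\<close>. This makes the stellar decomposition linear over the
  \<open>x_i\<close>.\<close>

lemma lin_insert:
  assumes "i \<in> {1..n}"
  shows "psubst (\<lambda>v. if v \<in> singles F then pvar v + pvar F else pvar v) (lin (vs FF') i) = lin (vs FF) i"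
proof -
  let ?S = "{G \<in> vs FF'. i \<in> G}"
  have fin: "finite ?S" using finite_vs[OF FF'] by simp
  have "psubst (\<lambda>v. if v \<in> singles F then pvar v + pvar F else pvar v) (lin (vs FF') i)
      = (\<Sum>G\<in>?S. pvar G + (if G \<in> singles F then pvar F else 0))"
    unfolding lin_def psubst_sum psubst_pvar by (intro sum.cong) auto
  also have "\<dots> = lin (vs FF') i + (\<Sum>G\<in>?S \<inter> singles F. pvar F)"
    using fin by (simp add: sum.distrib lin_def sum.inter_restrict[symmetric])
  also have "?S \<inter> singles F = (if i \<in> F then {{i}} else {})"
    using assms by (auto simp: vs_def)
  also have "lin (vs FF') i + (\<Sum>G\<in>(if i \<in> F then {{i}} else {}). pvar F) = lin (vs FF) i"
  proof (cases "i \<in> F")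
    case True
    then have "{G \<in> vs FF. i \<in> G} = insert F ?S" by (auto simp: vs_eq)
    then show ?thesis using True fin F_notin by (simp add: lin_def add.commute)
  next
    case False
    then have "{G \<in> vs FF. i \<in> G} = ?S" by (auto simp: vs_eq)
    then show ?thesis using False by (simp add: lin_def)
  qed
  finally show ?thesis .
qed

text \<open>The simplex on \<open>F\<close> is removed from the star vertex by vertex. If \<open>n\<close> lies in \<open>F\<close>, the last
  cone point is \<open>{n}\<close>, and the form \<open>x\<^sub>c - x\<^sub>n\<close> eliminates it.\<close>

lemma link_join_dim:
  assumes c: "c \<in> {1..n} - F" "n \<notin> F \<Longrightarrow> c = n"
    and d: "sr_dim ({1..n} - F - {c}) (\<lambda>i. lin above i - lin above c) above (chain_complex above) t s d"
  shows "sr_dim {1..<n} (\<lambda>i. lin (vs FF') i - lin (vs FF') n) (vs FF') link_join t s d"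
proof -
  define U where "U = singles F \<union> above"
  let ?\<theta> = "\<lambda>i. lin U i - lin U n"
  have finF: "finite F" using F_big by (rule big_finite)
  have finU: "finite U" using finF finite_above by (simp add: U_def)
  have lin_out: "lin U i = lin above i" if "i \<notin> F" for i
  proof -
    have "{G \<in> U. i \<in> G} = {G \<in> above. i \<in> G}" using that by (auto simp: U_def)
    then show ?thesis by (simp add: lin_def)
  qed
  \<comment> \<open>Every flat above \<open>F\<close> contains \<open>i\<close>, so the second
    summand is the same for all \<open>i \<in> F\<close>.\<close>
  have lin_in: "lin U i = pvar {i} + (\<Sum>G\<in>above. pvar G)" if "i \<in> F" for i
  proof -
    have "{G \<in> U. i \<in> G} = insert {i} above" using that by (auto simp: U_def above_def)
    then show ?thesis using finite_above above_not_single by (simp add: lin_def)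
  qed
  have above_hp: "(\<Sum>G\<in>above. pvar G) \<in> hp W 1" if "above \<subseteq> W" for W
    using that by (intro csub_sum[OF csub_hp] hp_pvar) auto
  have cone: "insert {i} A \<in> link_join" if "A \<in> link_join" "i \<in> F" for A i
    using that above_not_single by (auto simp: link_join_def)
  have d0: "sr_dim ({1..n} - F - {c}) (\<lambda>i. lin above i - lin above c) above link_join t s d"
    by (rule sr_dim_faces_cong[OF _ lin_diff_hp down_chain_complex down_link_join _ d])
      (auto simp: link_join_def Int_absorb2 chain_complex_def)
  \<comment> \<open>Forms exist only for indices below \<open>n\<close>: the vertices of
    \<open>E\<close> are removed by their own forms, while \<open>{n}\<close> needs another
    one.\<close>
  define E where "E = F - {n}"
  have d1: "sr_dim ({1..<n} - E) ?\<theta> (U - singles E) link_join t s d"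
  proof (cases "n \<in> F")
    case False
    have "{1..<n} - E = {1..n} - F - {c}" using False c(2) by (auto simp: E_def)
    moreover have "U - singles E = above" using False above_not_single by (auto simp: U_def E_def)
    moreover have "sr_dim ({1..n} - F - {c}) ?\<theta> above link_join t s d"
      by (rule iffD1[OF kdim_cong d0]) (use lin_out c False in auto)
    ultimately show ?thesis by simp
  next
    case True
    \<comment> \<open>Solving the form of \<open>c\<close> for \<open>{n}\<close> gives
      \<open>?L\<close>, with sign -1. Under this substitution \<open>lin U n\<close> becomes
      \<open>lin above c\<close>, so \<open>c\<close> replaces \<open>n\<close> as reference
      index.\<close>
    let ?L = "lin above c - (\<Sum>G\<in>above. pvar G)"
    have "{1..<n} = {1..n} - {n}" by auto
    then have I: "{1..<n} - E - {c} = {1..n} - F - {c}" using True by (auto simp: E_def)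
    have V: "U - singles E = insert {n} above" using True above_not_single by (auto simp: U_def E_def)
    have V': "insert {n} above - {{n}} = above" using above_not_single by auto
    have cE: "c \<in> {1..<n} - E" using c True by (auto simp: E_def order.strict_iff_order)
    have \<theta>hp: "?\<theta> i \<in> hp (insert {n} above) 1" if "i \<in> {1..<n} - E" for i
    proof (rule csub_diff[OF csub_hp])
      have "i \<notin> F" using that by (auto simp: E_def)
      then show "lin U i \<in> hp (insert {n} above) 1"
        unfolding lin_out[OF \<open>i \<notin> F\<close>] by (intro hp_mono[OF lin_hp]) auto
      show "lin U n \<in> hp (insert {n} above) 1"
        unfolding lin_in[OF True] by (intro csub_add[OF csub_hp] hp_pvar above_hp) auto
    qed
    have L: "?L \<in> hp above 1" by (intro csub_diff[OF csub_hp] lin_hp above_hp) simp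
    have sub: "psubst (pvar({n} := ?L)) p = p" if "p \<in> hp above 1" for p
      by (rule psubst_id[OF hp_poly_ring[OF that]]) (use above_not_single in auto)
    show ?thesis unfolding V
    proof (rule sr_dim_cone[where v = "{n}" and e = c and \<epsilon> = "- 1" and L = ?L
          and \<theta>' = "\<lambda>i. lin above i - lin above c", OF _ cE _ down_link_join cone \<theta>hp])
      show "?\<theta> c = cst (- 1) * (pvar {n} - ?L)"
        using c by (simp add: lin_out lin_in[OF True] cst_uminus)
      show "lin above i - lin above c = psubst (pvar({n} := ?L)) (?\<theta> i)" if "i \<in> {1..<n} - E - {c}" for i
      proof -
        have "i \<notin> F" using that by (auto simp: E_def)
        then show ?thesis
          using sub[OF lin_hp] sub[OF above_hp] by (simp add: lin_out lin_in[OF True] psubst_diff psubst_add)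
      qed
      show "sr_dim ({1..<n} - E - {c}) (\<lambda>i. lin above i - lin above c) (insert {n} above - {{n}}) link_join t s d"
        unfolding I V' by (rule d0)
      show "?L \<in> hp (insert {n} above - {{n}}) 1" unfolding V' by (rule L)
    qed (use True in auto)
  qed
  \<comment> \<open>Removed vertices are put back one at a time until the whole simplex on
    \<open>F\<close> is restored.\<close>
  have "E' \<subseteq> E \<Longrightarrow> sr_dim ({1..<n} - E') ?\<theta> (U - singles E') link_join t s d
    \<Longrightarrow> sr_dim {1..<n} ?\<theta> U link_join t s d" if "finite E'" for E'
    using that
  proof (induction E' rule: finite_induct)
    case (insert i E')
    let ?V = "U - singles E'" and ?L = "lin U n - (\<Sum>G\<in>above. pvar G)"
    have iF: "i \<in> F" "i \<noteq> n" using insert.prems(1) by (auto simp: E_def)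
    have aV: "above \<subseteq> ?V - {{i}}" using above_not_single by (auto simp: U_def)
    have I: "{1..<n} - E' - {i} = {1..<n} - insert i E'" and V: "?V - {{i}} = U - singles (insert i E')"
      by auto
    have lin_hp': "lin U m \<in> hp (U - singles S) 1" if "m \<notin> S" for m S
      using that by (intro lin_hp_sub) auto
    have nE: "n \<notin> E'" using insert.prems(1) by (auto simp: E_def)
    have \<theta>hp: "?\<theta> m \<in> hp ?V 1" if "m \<in> {1..<n} - E'" for m
      using that nE by (intro csub_diff[OF csub_hp] lin_hp') auto
    have L: "?L \<in> hp (?V - {{i}}) 1"
    proof (rule csub_diff[OF csub_hp])
      show "lin U n \<in> hp (?V - {{i}}) 1" using nE iF unfolding V by (intro lin_hp') auto
    qed (rule above_hp[OF aV])
    have "sr_dim ({1..<n} - E') ?\<theta> ?V link_join t s d"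
    proof (rule sr_dim_cone[where v = "{i}" and e = i and \<epsilon> = 1 and L = ?L and \<theta>' = ?\<theta>,
          OF _ _ _ down_link_join cone \<theta>hp L])
      show "i \<in> {1..<n} - E'" using iF F_sub insert.hyps by fastforce
      show "{i} \<in> ?V" using iF insert.hyps by (auto simp: U_def)
      show "?\<theta> i = cst 1 * (pvar {i} - ?L)" using lin_in[OF iF(1)] by simp
      \<comment> \<open>The vertex \<open>{i}\<close> occurs only in the form of \<open>i\<close>,
        as \<open>m\<close> and \<open>n\<close> differ from \<open>i\<close>; the other forms are
        unchanged.\<close>
      show "?\<theta> m = psubst (pvar({i} := ?L)) (?\<theta> m)" if m: "m \<in> {1..<n} - E' - {i}" for m
      proof -
        have "?\<theta> m \<in> hp (U - singles {i}) 1"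
          using m iF by (intro csub_diff[OF csub_hp] lin_hp') auto
        from psubst_id[OF hp_poly_ring[OF this], of "pvar({i} := ?L)"] show ?thesis by simp
      qed
      show "sr_dim ({1..<n} - E' - {i}) ?\<theta> (?V - {{i}}) link_join t s d"
        unfolding I V by (rule insert.prems(2))
    qed (use iF in auto)
    with insert show ?case by simp
  qed simp
  from this[of E] d1 finF have "sr_dim {1..<n} ?\<theta> U link_join t s d" by (simp add: E_def)
  then show ?thesis
    by (rule sr_dim_extend_vars[rotated -1])
      (use finite_vs[OF FF'] above_FF' F_sub down_link_join in
        \<open>auto simp: U_def vs_def link_join_def\<close>)
qed

end

section \<open>Uniform matroids\<close>

lemma matroid_rank_uniform:
  assumes "r \<le> n" "X \<subseteq> {1..n}"
  shows "matroid_rank (uniform_bases r n) X = min (card X) r"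
  unfolding matroid_rank_def
proof (rule Max_eqI)
  have finX: "finite X" using assms(2) finite_subset by blast
  show "finite ((\<lambda>B. card (X \<inter> B)) ` uniform_bases r n)"
    by (rule finite_imageI, rule finite_subset[of _ "Pow {1..n}"]) (auto simp: uniform_bases_def)
  show "y \<le> min (card X) r" if "y \<in> (\<lambda>B. card (X \<inter> B)) ` uniform_bases r n" for y
  proof -
    from that obtain B where B: "y = card (X \<inter> B)" "B \<subseteq> {1..n}" "card B = r"
      by (auto simp: uniform_bases_def)
    have "finite B" using B(2) finite_subset by blast
    then show ?thesis using B finX by (auto intro!: card_mono)
  qed
  show "min (card X) r \<in> (\<lambda>B. card (X \<inter> B)) ` uniform_bases r n"
  proof (cases "r \<le> card X")
    case True
    then obtain B where "B \<subseteq> X" "card B = r" using obtain_subset_with_card_n by metis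
    then show ?thesis using True assms(2)
      by (intro image_eqI[of _ _ B]) (auto simp: uniform_bases_def Int_absorb1)
  next
    case False
    then obtain B where "X \<subseteq> B" "B \<subseteq> {1..n}" "card B = r"
      using exists_subset_between[of X r "{1..n}"] assms by auto
    then show ?thesis using False
      by (intro image_eqI[of _ _ B]) (auto simp: uniform_bases_def Int_absorb2)
  qed
qed

text \<open>Adding an element raises the rank \<open>min (card G) r\<close> exactly while
  \<open>card G < r\<close>.\<close>

lemma proper_flats_uniform:
  assumes "r \<le> n"
  shows "proper_flats n (uniform_bases r n) = {G. G \<noteq> {} \<and> G \<subseteq> {1..n} \<and> card G < r}"
proof -
  have "is_flat n (uniform_bases r n) G \<longleftrightarrow> card G < r \<or> G = {1..n}" if G: "G \<subseteq> {1..n}" for G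
  proof -
    have fin: "finite G" using G finite_subset by blast
    have "matroid_rank (uniform_bases r n) (insert e G) > matroid_rank (uniform_bases r n) G \<longleftrightarrow> card G < r"
      if "e \<in> {1..n} - G" for e
    proof -
      have "card (insert e G) = Suc (card G)" using that fin by simp
      moreover have "insert e G \<subseteq> {1..n}" using that G by blast
      ultimately show ?thesis
        using matroid_rank_uniform[OF assms, of "insert e G"] matroid_rank_uniform[OF assms G] by auto
    qed
    then show ?thesis using G unfolding is_flat_def by blast
  qed
  moreover have "is_flat n (uniform_bases r n) G \<Longrightarrow> G \<subseteq> {1..n}" for G by (simp add: is_flat_def)
  ultimately show ?thesis unfolding proper_flats_def using assms by auto
qed

lemma sr_ideal_faces_cong:
  assumes "p \<in> poly_ring V" "\<And>A. A \<subseteq> V \<Longrightarrow> A \<in> \<Delta> \<longleftrightarrow> A \<in> \<Gamma>"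
  shows "p \<in> sr_ideal \<Delta> \<longleftrightarrow> p \<in> sr_ideal \<Gamma>"
  using assms by (auto simp: sr_ideal_def poly_ring_def)

text \<open>The order complex is a flag complex: its minimal non-faces are the incomparable pairs,
  which are the supports of the generators.\<close>

lemma bergman_dim:
  "sr_dim {1..<n} (\<lambda>i. lin (proper_flats n Bs) i - lin (proper_flats n Bs) n) (proper_flats n Bs)
    (chain_complex (proper_flats n Bs)) t s (tor_dim (bergman_alg n Bs) n t s)"
proof -
  let ?V = "proper_flats n Bs" and ?A = "bergman_alg n Bs"
  let ?S = "{{F, G} | F G. F \<in> ?V \<and> G \<in> ?V \<and> \<not> F \<subseteq> G \<and> \<not> G \<subseteq> F}"
  have fin: "finite ?V"
    by (rule finite_subset[of _ "Pow {1..n}"]) (auto simp: proper_flats_def is_flat_def)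
  have gens: "gens ?A = {\<Prod>v\<in>S. pvar v | S. S \<in> ?S}"
  proof -
    have "pvar F * pvar G = (\<Prod>v\<in>{F, G}. pvar v)" if "\<not> F \<subseteq> G" for F G :: "nat set"
    proof -
      have "F \<noteq> G" using that by auto
      then show ?thesis by simp
    qed
    note prod = this
    show ?thesis
    proof (intro equalityI subsetI)
      fix p assume "p \<in> gens ?A"
      then obtain F G where FG: "p = pvar F * pvar G" "F \<in> ?V" "G \<in> ?V" "\<not> F \<subseteq> G" "\<not> G \<subseteq> F"
        by (auto simp: bergman_alg_def)
      then have "{F, G} \<in> ?S" by blast
      then show "p \<in> {\<Prod>v\<in>S. pvar v | S. S \<in> ?S}" using FG(1) prod[OF FG(4)] by blast
    next
      fix p assume "p \<in> {\<Prod>v\<in>S. pvar v | S. S \<in> ?S}"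
      then obtain F G where FG: "p = (\<Prod>v\<in>{F, G}. pvar v)" "F \<in> ?V" "G \<in> ?V" "\<not> F \<subseteq> G" "\<not> G \<subseteq> F"
        by blast
      then show "p \<in> gens ?A" unfolding prod[OF FG(4), symmetric] by (auto simp: bergman_alg_def)
    qed
  qed
  have rel: "p \<in> rel_ideal ?A \<longleftrightarrow> p \<in> sr_ideal (chain_complex ?V)" if p: "p \<in> poly_ring ?V" for p
  proof -
    have "p \<in> rel_ideal ?A \<longleftrightarrow> p \<in> sr_ideal {A. \<forall>S\<in>?S. \<not> S \<subseteq> A}"
      unfolding rel_ideal_def gens using ideal_gen_squarefree[of ?S ?V p] p
      by (auto simp: bergman_alg_def)
    also have "\<dots> \<longleftrightarrow> p \<in> sr_ideal (chain_complex ?V)"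
    proof (rule sr_ideal_faces_cong[OF p])
      fix A assume A: "A \<subseteq> ?V"
      show "A \<in> {A. \<forall>S\<in>?S. \<not> S \<subseteq> A} \<longleftrightarrow> A \<in> chain_complex ?V"
      proof
        assume *: "A \<in> {A. \<forall>S\<in>?S. \<not> S \<subseteq> A}"
        have "comparable F G" if "F \<in> A" "G \<in> A" for F G
        proof (rule ccontr)
          assume "\<not> comparable F G"
          then have "{F, G} \<in> ?S" using A that unfolding comparable_def by blast
          then have "\<not> {F, G} \<subseteq> A" using * by blast
          then show False using that by simp
        qed
        then show "A \<in> chain_complex ?V" using A by (simp add: chain_complex_def)
      next
        assume A: "A \<in> chain_complex ?V"
        have False if "S \<in> ?S" "S \<subseteq> A" for S
        proof -
          from that obtain F G where "S = {F, G}" "\<not> F \<subseteq> G" "\<not> G \<subseteq> F" by blast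
          then show False using A that(2) by (auto simp: chain_complex_def comparable_def)
        qed
        note no = this
        show "A \<in> {A. \<forall>S\<in>?S. \<not> S \<subseteq> A}"
        proof (intro CollectI ballI notI)
          fix S assume "S \<in> ?S" "S \<subseteq> A"
          then show False by (rule no)
        qed
      qed
    qed
    finally show ?thesis .
  qed
  have act: "act ?A = lin ?V" by (simp add: bergman_alg_def lin_def fun_eq_iff)
  have vars: "vars ?A = ?V" by (simp add: bergman_alg_def)
  show ?thesis
    by (rule tor_dim_eq[of ?A "chain_complex ?V" n t s, unfolded act vars,
          OF fin down_chain_complex rel lin_hp])
qed

context skeleton
begin

text \<open>The starting point of the subdivisions: \<open>i\<close> is renamed to
  \<open>{i}\<close>, so that the variables become sets like all later vertices. The non-faces of
  the skeleton are the sets containing a basis.\<close>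

lemma empty_dim:
  "sr_dim {1..<n} (\<lambda>i. lin (vs {}) i - lin (vs {}) n) (vs {}) (subdiv {}) t s
    (tor_dim (empty_alg n (uniform_bases r n)) n t s)"
proof -
  let ?A = "empty_alg n (uniform_bases r n)" and ?\<Delta> = "{a. a \<subseteq> {1..n} \<and> card a < r}"
  have vars: "vars ?A = {1..n}" and act: "act ?A = pvar" by (simp_all add: empty_alg_def)
  have down: "down ?\<Delta>"
    unfolding down_def
  proof (intro ballI allI impI)
    fix a b assume a: "a \<in> ?\<Delta>" and b: "b \<subseteq> a"
    then have "card b \<le> card a" by (intro card_mono) (auto intro: finite_subset)
    then show "b \<in> ?\<Delta>" using a b by auto
  qed
  have rel: "p \<in> rel_ideal ?A \<longleftrightarrow> p \<in> sr_ideal ?\<Delta>" if p: "p \<in> poly_ring {1..n}" for p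
  proof -
    have "finite S \<and> S \<subseteq> {1..n}" if "S \<in> uniform_bases r n" for S
      using that finite_subset[of S "{1..n}"] by (simp add: uniform_bases_def)
    from ideal_gen_squarefree[of "uniform_bases r n" "{1..n}" p, OF this p]
    have "p \<in> rel_ideal ?A \<longleftrightarrow> p \<in> sr_ideal {a. \<forall>S\<in>uniform_bases r n. \<not> S \<subseteq> a}"
      by (simp add: rel_ideal_def empty_alg_def)
    also have "\<dots> \<longleftrightarrow> p \<in> sr_ideal ?\<Delta>"
    proof (rule sr_ideal_faces_cong[OF p])
      have "(\<forall>S\<in>uniform_bases r n. \<not> S \<subseteq> a) \<longleftrightarrow> card a < r" if a: "a \<subseteq> {1..n}" for a
      proof
        assume *: "\<forall>S\<in>uniform_bases r n. \<not> S \<subseteq> a"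
        show "card a < r"
        proof (rule ccontr)
          assume "\<not> card a < r"
          then obtain S where "S \<subseteq> a" "card S = r" using obtain_subset_with_card_n by (metis not_less)
          then show False using * a by (auto simp: uniform_bases_def)
        qed
      next
        assume c: "card a < r"
        have fin: "finite a" using a finite_subset by blast
        have False if "S \<in> uniform_bases r n" "S \<subseteq> a" for S
          using card_mono[OF fin that(2)] that(1) c by (simp add: uniform_bases_def)
        then show "\<forall>S\<in>uniform_bases r n. \<not> S \<subseteq> a" by blast
      qed
      then show "a \<in> {a. \<forall>S\<in>uniform_bases r n. \<not> S \<subseteq> a} \<longleftrightarrow> a \<in> ?\<Delta>" if "a \<subseteq> {1..n}" for a
        using that by simp
    qed
    finally show ?thesis .
  qed
  have d: "sr_dim {1..<n} (\<lambda>i. pvar i - pvar n) {1..n} ?\<Delta> t s (tor_dim ?A n t s)"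
    using tor_dim_eq[of ?A ?\<Delta> n t s, unfolded vars act] rel down hp_pvar[of _ "{1..n}"] by simp
  have lin: "lin (vs {}) i = pvar {i}" if "i \<in> {1..n}" for i
  proof -
    have "{G \<in> vs {}. i \<in> G} = {{i}}" using that by (auto simp: vs_def)
    then show ?thesis by (simp add: lin_def)
  qed
  show ?thesis
  proof (rule sr_dim_relabel[where g = "\<lambda>i. {i}", OF _ _ _ down down_subdiv _ _ _ lin_diff_hp _ d])
    show "(\<lambda>i. {i}) ` a \<in> subdiv {} \<longleftrightarrow> a \<in> ?\<Delta>" if "a \<subseteq> {1..n}" for a
    proof -
      have "{i. {i} \<in> (\<lambda>i. {i}) ` a} = a" by auto
      moreover have "singles a \<subseteq> vs {}" using that unfolding vs_def by blast
      ultimately show ?thesis using that by (simp add: subdiv_def)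
    qed
    show "pvar i - pvar n \<in> hp {1..n} 1" if "i \<in> {1..<n}" for i
      using that by (intro csub_diff[OF csub_hp] hp_pvar) auto
    show "psubst (\<lambda>v. pvar {v}) (pvar i - pvar n) - (lin (vs {}) i - lin (vs {}) n) \<in> sr_ideal (subdiv {})"
      if "i \<in> {1..<n}" for i
      using that by (simp add: lin psubst_diff csub_0[OF csub_sr_ideal])
  qed (auto simp: vs_def subdiv_def)
qed

text \<open>Contracting a flat with \<open>i\<close> elements lowers both rank and ground set of the
  uniform matroid by \<open>i\<close>.\<close>

abbreviation link_tor :: "nat \<Rightarrow> nat \<Rightarrow> nat \<Rightarrow> nat"
  where "link_tor i \<equiv> tor_dim (bergman_alg (n - i) (uniform_bases (r - i) (n - i))) (n - i)"

end

context subdivision_step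
begin

text \<open>The flats above \<open>F\<close> are those of the contraction, whose ground set \<open>{1..n} - F\<close> is numbered in
  increasing order.\<close>

lemma link_dim:
  "sr_dim {1..<n} (\<lambda>i. lin (vs FF') i - lin (vs FF') n) (vs FF') link_join t s (link_tor (card F) t s)"
proof -
  define J where "J = {1..n} - F"
  define m where "m = n - card F"
  have finF: "finite F" by (rule big_finite[OF F_big])
  have cF: "card F < r" using F_big by (simp add: big_def)
  have cJ: "card J = m" using F_sub finF by (simp add: J_def m_def card_Diff_subset)
  have m: "0 < m" using cF r by (simp add: m_def)
  obtain h where h: "bij_betw h {..<m} J" "strict_mono_on {..<m} h"
    using ex_bij_betw_strict_mono_card[of J] cJ by (metis J_def finite_Diff finite_atLeastAtMost)
  \<comment> \<open>\<open>h\<close> counts from 0, the ground set of a matroid from 1.\<close>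
  define \<sigma> where "\<sigma> j = h (j - 1)" for j
  have mono: "strict_mono_on {1..m} \<sigma>"
  proof (rule strict_mono_onI)
    fix i j assume "i \<in> {1..m}" "j \<in> {1..m}" "i < j"
    then have "i - 1 \<in> {..<m}" "j - 1 \<in> {..<m}" "i - 1 < j - 1" by auto
    then show "\<sigma> i < \<sigma> j" unfolding \<sigma>_def by (rule strict_mono_onD[OF h(2)])
  qed
  have im: "\<sigma> ` {1..m} = J"
  proof -
    have "(\<lambda>j. j - 1) ` {1..m} = {..<m}"
    proof (intro equalityI subsetI)
      fix x assume "x \<in> {..<m}"
      then have "x = Suc x - 1" "Suc x \<in> {1..m}" by auto
      then show "x \<in> (\<lambda>j. j - 1) ` {1..m}" by blast
    qed auto
    moreover have "\<sigma> ` {1..m} = h ` (\<lambda>j. j - 1) ` {1..m}"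
      unfolding image_image by (rule image_cong) (simp_all add: \<sigma>_def)
    ultimately show ?thesis using h(1) by (simp only: bij_betw_def)
  qed
  have inj: "inj_on \<sigma> {1..m}" by (rule strict_mono_on_imp_inj_on[OF mono])
  have \<sigma>J: "\<sigma> j \<in> J" if "j \<in> {1..m}" for j using im that by blast
  define c where "c = \<sigma> m"
  have cJ': "c \<in> J" using \<sigma>J m by (simp add: c_def)
  \<comment> \<open>The reference index of the contraction is the largest element outside
    \<open>F\<close>, which is \<open>n\<close> unless \<open>n \<in> F\<close>;
    \<open>link_join_dim\<close> asks for this.\<close>
  have cn: "c = n" if "n \<notin> F"
  proof -
    have "n \<in> J" using that r by (simp add: J_def)
    then obtain j where j: "j \<in> {1..m}" "n = \<sigma> j" using im by blast
    have "\<sigma> j \<le> \<sigma> m"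
      using strict_mono_on_leD[OF mono j(1), of m] j(1) m by simp
    moreover have "c \<le> n" using cJ' by (simp add: J_def)
    ultimately show ?thesis using j by (simp add: c_def)
  qed
  let ?V = "proper_flats m (uniform_bases (r - card F) m)"
  have V: "?V = {G. G \<noteq> {} \<and> G \<subseteq> {1..m} \<and> card G < r - card F}"
    using r cF by (intro proper_flats_uniform) (simp add: m_def)
  \<comment> \<open>The usual bijection between the flats of a contraction and the flats above
    \<open>F\<close>.\<close>
  define g where "g G = F \<union> \<sigma> ` G" for G
  have \<sigma>F: "\<sigma> ` G \<inter> F = {}" if "G \<subseteq> {1..m}" for G using that \<sigma>J by (auto simp: J_def)
  have \<sigma>mem: "\<sigma> j \<in> \<sigma> ` G \<longleftrightarrow> j \<in> G" if "G \<subseteq> {1..m}" "j \<in> {1..m}" for G j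
    using that inj by (auto dest: inj_onD)
  have g_sub: "g G \<subseteq> g H \<longleftrightarrow> G \<subseteq> H" if "G \<subseteq> {1..m}" "H \<subseteq> {1..m}" for G H
  proof -
    have "g G \<subseteq> g H \<longleftrightarrow> \<sigma> ` G \<subseteq> \<sigma> ` H" using \<sigma>F[OF that(1)] by (auto simp: g_def)
    also have "\<dots> \<longleftrightarrow> (\<forall>j\<in>G. \<sigma> j \<in> \<sigma> ` H)" by (rule image_subset_iff)
    also have "\<dots> \<longleftrightarrow> G \<subseteq> H" using \<sigma>mem[OF that(2)] that(1) by blast
    finally show ?thesis .
  qed
  have card_g: "card (g G) = card F + card G" if "G \<subseteq> {1..m}" for G
  proof -
    have "finite (\<sigma> ` G)" using that finite_subset by blast
    then have "card (g G) = card F + card (\<sigma> ` G)"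
      using finF \<sigma>F[OF that] by (simp add: g_def card_Un_disjoint Int_commute)
    also have "card (\<sigma> ` G) = card G" using that by (intro card_image inj_on_subset[OF inj])
    finally show ?thesis .
  qed
  have g_above: "g G \<in> above" if "G \<in> ?V" for G
  proof -
    have G: "G \<subseteq> {1..m}" "G \<noteq> {}" "card G < r - card F" using that by (auto simp: V)
    have "\<sigma> ` G \<subseteq> {1..n}" using G(1) \<sigma>J by (auto simp: J_def)
    moreover have "F \<subset> g G" using \<sigma>F[OF G(1)] G(2) by (auto simp: g_def)
    ultimately show ?thesis using F_sub G card_g[OF G(1)] by (auto simp: above_def g_def)
  qed
  have g_im: "g ` ?V = above"
  proof (intro equalityI subsetI)
    fix H assume H: "H \<in> above"
    define G where "G = {j \<in> {1..m}. \<sigma> j \<in> H}"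
    have "\<sigma> ` G = H - F"
    proof (intro equalityI subsetI)
      fix x assume x: "x \<in> H - F"
      then have "x \<in> J" using H by (auto simp: above_def J_def)
      then obtain j where "j \<in> {1..m}" "x = \<sigma> j" using im by blast
      then show "x \<in> \<sigma> ` G" using x by (auto simp: G_def)
    qed (use \<sigma>J in \<open>auto simp: G_def J_def\<close>)
    then have gG: "g G = H" using H by (auto simp: g_def above_def)
    have G: "G \<subseteq> {1..m}" by (auto simp: G_def)
    have "G \<noteq> {}" using gG H by (auto simp: g_def above_def)
    moreover have "card F + card G < r" using card_g[OF G] gG H by (simp add: above_def)
    then have "card G < r - card F" by linarith
    ultimately have "G \<in> ?V" using G by (simp add: V)
    then show "H \<in> g ` ?V" using gG by blast
  qed (use g_above in auto)
  have g_inj: "inj_on g ?V" using g_sub by (intro inj_onI) (auto simp: V)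
  have lin_g: "psubst (\<lambda>v. pvar (g v)) (lin ?V j) = lin above (\<sigma> j)" if j: "j \<in> {1..m}" for j
  proof -
    have "{H \<in> above. \<sigma> j \<in> H} = g ` {G \<in> ?V. j \<in> G}"
    proof -
      have "\<sigma> j \<in> g G \<longleftrightarrow> j \<in> G" if "G \<in> ?V" for G
        using that \<sigma>mem[of G j] j \<sigma>J[OF j] by (auto simp: g_def V J_def)
      then show ?thesis unfolding g_im[symmetric] by blast
    qed
    then show ?thesis
      using sum.reindex[of g "{G \<in> ?V. j \<in> G}" pvar] inj_on_subset[OF g_inj, of "{G \<in> ?V. j \<in> G}"]
      by (simp add: lin_def psubst_sum)
  qed
  let ?d = "tor_dim (bergman_alg m (uniform_bases (r - card F) m)) m t s"
  have 1: "sr_dim {1..<m} (\<lambda>j. lin above (\<sigma> j) - lin above c) above (chain_complex above) t s ?d"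
  proof (rule sr_dim_relabel[where g = g, OF _ g_inj _ down_chain_complex down_chain_complex _ _
        lin_diff_hp lin_diff_hp _ bergman_dim])
    show "g ` A \<in> chain_complex above \<longleftrightarrow> A \<in> chain_complex ?V" if A: "A \<subseteq> ?V" for A
    proof -
      have "comparable (g G) (g H) \<longleftrightarrow> comparable G H" if "G \<in> A" "H \<in> A" for G H
        using that A g_sub[of G H] g_sub[of H G] by (auto simp: comparable_def V)
      note cmp = this
      have "g ` A \<subseteq> above" using A g_im by blast
      then show ?thesis using A cmp by (simp add: chain_complex_def)
    qed
    show "psubst (\<lambda>v. pvar (g v)) (lin ?V j - lin ?V m) - (lin above (\<sigma> j) - lin above c) \<in> sr_ideal (chain_complex above)"
      if "j \<in> {1..<m}" for j
      using that m by (simp add: psubst_diff lin_g c_def csub_0[OF csub_sr_ideal])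
  qed (auto simp: g_im chain_complex_def)
  have 2: "\<sigma> ` {1..<m} = {1..n} - F - {c}"
  proof -
    have "{1..<m} = {1..m} - {m}" by auto
    then have "\<sigma> ` {1..<m} = \<sigma> ` {1..m} - \<sigma> ` {m}"
      using inj_on_image_set_diff[OF inj, of "{1..m}" "{m}"] m by auto
    then show ?thesis by (simp only: im c_def J_def image_insert image_empty)
  qed
  have "sr_dim (\<sigma> ` {1..<m}) (\<lambda>i. lin above i - lin above c) above (chain_complex above) t s ?d"
    by (rule sr_dim_reindex[OF _ _ down_chain_complex _ lin_diff_hp 1])
      (use mono in \<open>auto simp: strict_mono_on_def\<close>)
  then show ?thesis
    unfolding 2 m_def[symmetric] using cJ' cn by (intro link_join_dim) (auto simp: J_def)
qed

lemma step_dim: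
  assumes "sr_dim {1..<n} (\<lambda>i. lin (vs FF') i - lin (vs FF') n) (vs FF') (subdiv FF') t s d0"
  shows "sr_dim {1..<n} (\<lambda>i. lin (vs FF) i - lin (vs FF) n) (vs FF) (subdiv FF) t s
    (d0 + (\<Sum>j\<in>{1..<card F}. if j \<le> s then link_tor (card F) t (s - j) else 0))"
proof -
  interpret stellar "vs FF'" F "singles F" "subdiv FF'" by (rule stellar_step)
  have "card (singles F) = card F" by (simp add: card_image)
  with sr_dim_stellar[OF _ lin_diff_hp assms, unfolded star_eq, OF _ link_dim]
  have "sr_dim {1..<n} (\<lambda>i. \<phi> (lin (vs FF') i - lin (vs FF') n)) (insert F (vs FF')) sd t s
    (d0 + (\<Sum>j\<in>{1..<card F}. if j \<le> s then link_tor (card F) t (s - j) else 0))" by simp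
  then show ?thesis
    unfolding sd_eq vs_eq[symmetric]
    by (rule iffD1[OF kdim_cong, rotated]) (use r in \<open>simp add: psubst_diff lin_insert\<close>)
qed

end

context skeleton
begin

text \<open>Removing a minimal member keeps \<open>FF\<close> closed under larger flats, so the last
  subdivision can be undone. Its contribution does not depend on the rest of \<open>FF\<close>,
  since the link of \<open>F\<close> consists of all chains of flats above \<open>F\<close>.\<close>

lemma subdiv_dim:
  assumes "FF \<subseteq> big" "\<And>G H. G \<in> FF \<Longrightarrow> H \<in> big \<Longrightarrow> G \<subseteq> H \<Longrightarrow> H \<in> FF"
  shows "sr_dim {1..<n} (\<lambda>i. lin (vs FF) i - lin (vs FF) n) (vs FF) (subdiv FF) t s
    (tor_dim (empty_alg n (uniform_bases r n)) n t s +
     (\<Sum>F\<in>FF. \<Sum>j\<in>{1..<card F}. if j \<le> s then link_tor (card F) t (s - j) else 0))"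
  using finite_subset[OF assms(1) finite_big] assms
proof (induction FF rule: finite_psubset_induct)
  case (psubset FF)
  show ?case
  proof (cases "FF = {}")
    case True
    then show ?thesis using empty_dim by simp
  next
    case False
    from finite_has_minimal[OF psubset.hyps(1) this] obtain F
      where F: "F \<in> FF" "\<And>G. G \<in> FF \<Longrightarrow> G \<subseteq> F \<Longrightarrow> G = F" by metis
    interpret subdivision_step n r FF F
      by unfold_locales (use psubset.prems F in auto)
    have sub: "FF' \<subset> FF" using F(1) by (auto simp: FF'_def)
    have up': "\<And>G H. G \<in> FF' \<Longrightarrow> H \<in> big \<Longrightarrow> G \<subseteq> H \<Longrightarrow> H \<in> FF'"
      using psubset.prems(2) F(2) by (fastforce simp: FF'_def)
    have "sr_dim {1..<n} (\<lambda>i. lin (vs FF') i - lin (vs FF') n) (vs FF') (subdiv FF') t s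
      (tor_dim (empty_alg n (uniform_bases r n)) n t s +
       (\<Sum>F\<in>FF'. \<Sum>j\<in>{1..<card F}. if j \<le> s then link_tor (card F) t (s - j) else 0))"
      by (rule psubset.IH[OF sub FF' up'])
    from step_dim[OF this]
    show ?thesis
      using sum.remove[OF psubset.hyps(1) F(1),
          of "\<lambda>F. \<Sum>j\<in>{1..<card F}. if j \<le> s then link_tor (card F) t (s - j) else 0"]
      by (simp add: FF'_def algebra_simps)
  qed
qed

text \<open>Two distinct singletons in a face would form a flat of size 2 contained in the base,
  although all such flats are subdivided. So the base has at most one element, and the other
  conditions say that the face is a chain.\<close>

lemma subdiv_big: "subdiv big = chain_complex (proper_flats n (uniform_bases r n))"
proof -
  have V: "proper_flats n (uniform_bases r n) = {G. G \<noteq> {} \<and> G \<subseteq> {1..n} \<and> card G < r}"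
    using r by (intro proper_flats_uniform) simp
  show ?thesis
  proof (intro equalityI subsetI)
    fix A assume A: "A \<in> subdiv big"
    then have sub: "A \<subseteq> vs big" and cd: "card {i. {i} \<in> A} < r"
      and no: "\<And>G. G \<in> big \<Longrightarrow> \<not> singles G \<subseteq> A"
      and cmp: "\<And>G H. G \<in> A \<Longrightarrow> G \<in> big \<Longrightarrow> H \<in> A \<Longrightarrow> comparable G H"
      by (auto simp: subdiv_def)
    have fin: "finite {i. {i} \<in> A}" by (rule finite_base[OF sub order.refl])
    have pair: "i = j" if "{i} \<in> A" "{j} \<in> A" for i j
    proof (rule ccontr)
      assume ij: "i \<noteq> j"
      then have "card {i, j} \<le> card {i. {i} \<in> A}" using that by (intro card_mono fin) auto
      then have "card {i, j} < r" using cd by simp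
      moreover have "{i, j} \<subseteq> {1..n}" using that sub big_not_single by (fastforce simp: vs_def)
      ultimately have "{i, j} \<in> big" using ij by (simp add: big_def)
      from no[OF this] show False using that by simp
    qed
    have "G \<in> proper_flats n (uniform_bases r n)" if "G \<in> A" for G
    proof (cases "G \<in> big")
      case True
      then show ?thesis by (auto simp: V big_def)
    next
      case False
      then have "G \<in> singles {1..n}" using sub that unfolding vs_def by blast
      then obtain i where i: "G = {i}" "i \<in> {1..n}" by blast
      have "card {i} \<le> card {i. {i} \<in> A}" using that i by (intro card_mono fin) auto
      then have "1 < r" using cd by simp
      then show ?thesis using i by (simp add: V)
    qed
    moreover have "comparable G H" if GH: "G \<in> A" "H \<in> A" for G H
    proof (cases "G \<in> big \<or> H \<in> big")
      case True
      then show ?thesis using cmp GH by (auto simp: comparable_def)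
    next
      case False
      then have "G \<in> singles {1..n}" "H \<in> singles {1..n}" using GH sub unfolding vs_def by blast+
      then obtain i j where "G = {i}" "H = {j}" by blast
      then show ?thesis using pair GH by (auto simp: comparable_def)
    qed
    ultimately show "A \<in> chain_complex (proper_flats n (uniform_bases r n))"
      unfolding chain_complex_def by blast
  next
    fix A assume A: "A \<in> chain_complex (proper_flats n (uniform_bases r n))"
    then have sub: "\<And>G. G \<in> A \<Longrightarrow> G \<noteq> {} \<and> G \<subseteq> {1..n} \<and> card G < r"
      and cmp: "\<And>G H. G \<in> A \<Longrightarrow> H \<in> A \<Longrightarrow> comparable G H"
      unfolding chain_complex_def V by blast+
    have pair: "i = j" if "{i} \<in> A" "{j} \<in> A" for i j
      using cmp[OF that] by (auto simp: comparable_def)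
    show "A \<in> subdiv big"
    proof (rule subdivI)
      show "A \<subseteq> vs big"
      proof
        fix G assume G: "G \<in> A"
        have finG: "finite G" using sub[OF G] finite_subset by blast
        show "G \<in> vs big"
        proof (cases "card G = 1")
          case True
          then obtain i where "G = {i}" by (rule card_1_singletonE)
          then show ?thesis using sub[OF G] by (simp add: vs_def)
        next
          case False
          moreover have "card G \<noteq> 0" using sub[OF G] finG by simp
          ultimately have "2 \<le> card G" by simp
          then show ?thesis using sub[OF G] by (simp add: vs_def big_def)
        qed
      qed
      show "card {i. {i} \<in> A} < r"
      proof (cases "\<exists>i. {i} \<in> A")
        case True
        then obtain i where i: "{i} \<in> A" ..
        then have "{i. {i} \<in> A} = {i}" using pair by blast
        then show ?thesis using sub[OF i] by simp
      next
        case False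
        then show ?thesis using r by simp
      qed
      show "\<not> singles G \<subseteq> A" if "G \<in> big" for G
      proof
        assume *: "singles G \<subseteq> A"
        have "\<forall>i\<in>G. \<forall>j\<in>G. i = j" using pair * by blast
        then have "card G \<le> 1" by (simp add: card_le_Suc0_iff_eq[OF big_finite[OF that]])
        then show False using that by (simp add: big_def)
      qed
    qed (use cmp in blast)
  qed
qed

text \<open>The complex with all flats subdivided is measured twice, through the sum over the
  subdivisions and as the order complex of the proper flats. Uniqueness of dimension equates the
  results, and the flats are then collected by size.\<close>

theorem tor_dim_bergman:
  "tor_dim (bergman_alg n (uniform_bases r n)) n t s =
    tor_dim (empty_alg n (uniform_bases r n)) n t s +
    (\<Sum>i = 1..r - 1. (n choose i) * (\<Sum>j\<in>{1..<i}. if j \<le> s then link_tor i t (s - j) else 0))"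
proof -
  let ?V = "proper_flats n (uniform_bases r n)"
  let ?h = "\<lambda>i. \<Sum>j\<in>{1..<i}. if j \<le> s then link_tor i t (s - j) else 0"
  have "sr_dim {1..<n} (\<lambda>i. lin (vs big) i - lin (vs big) n) (vs big) (subdiv big) t s
      (tor_dim (empty_alg n (uniform_bases r n)) n t s + (\<Sum>F\<in>big. ?h (card F)))"
    by (rule subdiv_dim) auto
  moreover have "sr_dim {1..<n} (\<lambda>i. lin (vs big) i - lin (vs big) n) (vs big) (subdiv big) t s
      (tor_dim (bergman_alg n (uniform_bases r n)) n t s)"
    unfolding subdiv_big
  \<comment> \<open>For \<open>r = 1\<close> the singletons are variables in \<open>vs big\<close>
    but not flats, hence the passage to more variables than vertices.\<close>
  proof (rule sr_dim_extend_vars[OF _ finite_vs[OF order.refl] _ down_chain_complex _ bergman_dim])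
    show "?V \<subseteq> vs big"
    proof
      fix G assume "G \<in> ?V"
      then have "{G} \<in> subdiv big"
        unfolding subdiv_big by (simp add: chain_complex_def comparable_def)
      then show "G \<in> vs big" by (simp add: subdiv_def)
    qed
  qed (auto simp: chain_complex_def)
  moreover have "koszul {1..<n} (\<lambda>i. lin (vs big) i - lin (vs big) n) (pieces (vs big) 0) (sr_ideal (subdiv big))"
    by (rule koszul_sr[OF _ lin_diff_hp down_subdiv]) auto
  ultimately have "tor_dim (bergman_alg n (uniform_bases r n)) n t s
      = tor_dim (empty_alg n (uniform_bases r n)) n t s + (\<Sum>F\<in>big. ?h (card F))"
    using koszul.kdim_unique by blast
  also have "(\<Sum>F\<in>big. ?h (card F)) = (\<Sum>i = 1..r - 1. (n choose i) * ?h i)"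
  proof -
    have big: "big = (\<Union>i\<in>{2..r - 1}. {G. G \<subseteq> {1..n} \<and> card G = i})"
      using r by (auto simp: big_def)
    have "(\<Sum>F\<in>big. ?h (card F)) = (\<Sum>i = 2..r - 1. \<Sum>F\<in>{G. G \<subseteq> {1..n} \<and> card G = i}. ?h (card F))"
      unfolding big by (rule sum.UNION_disjoint) (auto intro: finite_subset[of _ "Pow {1..n}"])
    also have "\<dots> = (\<Sum>i = 2..r - 1. (n choose i) * ?h i)"
    proof (rule sum.cong[OF refl])
      fix i
      have "(\<Sum>F\<in>{G. G \<subseteq> {1..n} \<and> card G = i}. ?h (card F)) = (\<Sum>F\<in>{G. G \<subseteq> {1..n} \<and> card G = i}. ?h i)"
        by (rule sum.cong) auto
      then show "(\<Sum>F\<in>{G. G \<subseteq> {1..n} \<and> card G = i}. ?h (card F)) = (n choose i) * ?h i"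
        using n_subsets[of "{1..n}" i] by simp
    qed
    \<comment> \<open>The range \<open>{1..<1}\<close> is empty, so starting at 1 adds
      nothing.\<close>
    also have "\<dots> = (\<Sum>i = 1..r - 1. (n choose i) * ?h i)"
      by (intro sum.mono_neutral_left) (auto simp: not_le)
    finally show ?thesis .
  qed
  finally show ?thesis .
qed

end

section \<open>Passage to Hilbert series\<close>

lemma geometric_fps:
  assumes "0 < i"
  shows "(fps_X - fps_X ^ i) / (1 - fps_X) = (\<Sum>j\<in>{1..<i}. fps_X ^ j :: rat fps)"
proof -
  have tele: "(1 - fps_X) * (\<Sum>j\<in>{0..<k}. fps_X ^ Suc j) = fps_X - (fps_X ^ Suc k :: rat fps)" for k
  proof (induction k)
    case (Suc k)
    have "(1 - fps_X) * (\<Sum>j\<in>{0..<Suc k}. fps_X ^ Suc j)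
        = (1 - fps_X) * (\<Sum>j\<in>{0..<k}. fps_X ^ Suc j) + (1 - fps_X) * (fps_X ^ Suc k :: rat fps)"
      by (simp only: sum.atLeast0_lessThan_Suc distrib_left)
    also have "\<dots> = (fps_X - fps_X ^ Suc k) + (fps_X ^ Suc k - fps_X ^ Suc (Suc k))"
      unfolding Suc.IH by (simp only: left_diff_distrib mult_1_left power_Suc)
    also have "\<dots> = fps_X - fps_X ^ Suc (Suc k)" by simp
    finally show ?case .
  qed simp
  obtain k where k: "i = Suc k" using assms by (cases i) auto
  have "(\<Sum>j\<in>{1..<i}. fps_X ^ j) = (\<Sum>j\<in>{0..<k}. fps_X ^ Suc j :: rat fps)"
    unfolding k One_nat_def by (rule sum.shift_bounds_Suc_ivl)
  then have "fps_X - fps_X ^ i = (1 - fps_X) * (\<Sum>j\<in>{1..<i}. fps_X ^ j :: rat fps)"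
    using tele[of k] k by simp
  moreover have "1 - fps_X \<noteq> (0 :: rat fps)"
  proof
    assume "1 - fps_X = (0 :: rat fps)"
    then have "fps_nth (1 - fps_X :: rat fps) 0 = 0" by (simp only: fps_zero_nth)
    then show False by simp
  qed
  ultimately show ?thesis by simp
qed

theorem theorem6p5:
  fixes r k :: nat
  assumes "0 < r" and "0 < k"
  shows "hilb_bergman (k + r) (uniform_bases r (k + r)) =
    hilb_empty (k + r) (uniform_bases r (k + r)) +
    (\<Sum>i = 1..r - 1. of_nat ((r + k) choose i) *
       fps_const ((fps_X - fps_X ^ i) / (1 - fps_X)) *
       hilb_bergman (r + k - i) (uniform_bases (r - i) (r + k - i)))"
proof (intro fps_ext)
  fix t s
  interpret skeleton "k + r" r by unfold_locales (use assms in auto)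
  \<comment> \<open>The series in \<open>y\<close> is a constant for the outer variable, so it acts
    on each coefficient of \<open>x^t\<close> separately, where \<open>y^j\<close> shifts the degree
    by \<open>j\<close>.\<close>
  have coef: "fps_nth (fps_nth (of_nat c * fps_const ((fps_X - fps_X ^ i) / (1 - fps_X)) * hilb_tor A m) t) s
      = of_nat (c * (\<Sum>j\<in>{1..<i}. if j \<le> s then tor_dim A m t (s - j) else 0))"
    if "0 < i" for c i m and A :: "nat set graded_alg"
  proof -
    have "fps_nth (of_nat c * fps_const ((fps_X - fps_X ^ i) / (1 - fps_X)) * hilb_tor A m) t
        = of_nat c * (\<Sum>j\<in>{1..<i}. fps_X ^ j) * fps_nth (hilb_tor A m) t"
      by (simp only: geometric_fps[OF that] fps_of_nat[symmetric] fps_const_mult fps_mult_left_const_nth)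
    also have "\<dots> = of_nat c * (\<Sum>j\<in>{1..<i}. fps_X ^ j * fps_nth (hilb_tor A m) t)"
      by (simp add: mult.assoc sum_distrib_right)
    finally have "fps_nth (fps_nth (of_nat c * fps_const ((fps_X - fps_X ^ i) / (1 - fps_X)) * hilb_tor A m) t) s
        = of_nat c * (\<Sum>j\<in>{1..<i}. fps_nth (fps_X ^ j * fps_nth (hilb_tor A m) t) s)"
      by (simp only: fps_mult_of_nat_nth fps_sum_nth)
    also have "(\<Sum>j\<in>{1..<i}. fps_nth (fps_X ^ j * fps_nth (hilb_tor A m) t) s)
        = (\<Sum>j\<in>{1..<i}. of_nat (if j \<le> s then tor_dim A m t (s - j) else 0))"
      by (rule sum.cong) (auto simp: fps_X_power_mult_nth hilb_tor_def)
    finally show ?thesis by (simp only: of_nat_mult of_nat_sum)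
  qed
  show "fps_nth (fps_nth (hilb_bergman (k + r) (uniform_bases r (k + r))) t) s =
    fps_nth (fps_nth (hilb_empty (k + r) (uniform_bases r (k + r)) +
    (\<Sum>i = 1..r - 1. of_nat ((r + k) choose i) *
       fps_const ((fps_X - fps_X ^ i) / (1 - fps_X)) *
       hilb_bergman (r + k - i) (uniform_bases (r - i) (r + k - i)))) t) s"
  proof -
    have "fps_nth (fps_nth (\<Sum>i = 1..r - 1. of_nat ((r + k) choose i) *
        fps_const ((fps_X - fps_X ^ i) / (1 - fps_X)) *
        hilb_bergman (r + k - i) (uniform_bases (r - i) (r + k - i))) t) s
      = of_nat (\<Sum>i = 1..r - 1. ((k + r) choose i) *
          (\<Sum>j\<in>{1..<i}. if j \<le> s then link_tor i t (s - j) else 0))"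
      unfolding fps_sum_nth of_nat_sum hilb_bergman_def add.commute[of r k]
      by (rule sum.cong[OF refl], rule coef) simp
    then show ?thesis
      by (simp only: fps_add_nth hilb_bergman_def hilb_empty_def hilb_tor_def Abs_fps_inverse fps_nth_Abs_fps
          tor_dim_bergman[of t s] of_nat_add)
  qed
qed

end
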